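(* Let $d,m\ge 1$ be integers, $n=d+m$, let $A\in\mathbb{R}^{(d+1)\times m}$ and let $\mathcal{L}=\{(\bm{x},\widetilde{\bm{x}}A)\mid \bm{x}\in\mathbb{R}^d\}\subset\mathbb{R}^n$, where $\widetilde{\bm{x}}=(1,\bm{x})$. Suppose that $\omega(A)=\omega$ and $\sigma(A)=\sigma$. Then for any $\bm{\theta}\in\mathbb{R}^n$ we have $$\dim\left(\mathcal{S}_n(\tau,\bm{\theta})\cap\mathcal{L}\right)\le\begin{cases}\dfrac{n+1}{\tau+1}-m&\text{when }\ \frac1n\le\tau\le\frac1\omega;\\[8pt] \dfrac{(d+1)\omega-m}{(\tau+1)\omega}&\text{when }\ \frac1\omega\le\tau\le\frac1\omega+\sigma-\frac{d+1}{m};\\[8pt] \dfrac{m(\sigma-\tau)}{\tau+1}&\text{when }\ \frac1\omega+\sigma-\frac{d+1}{m}\le\tau\le\sigma;\\[8pt] 0&\text{when }\ \sigma\le\tau.\end{cases}$$ Moreover, in the homogeneous case $\bm{\theta}=\bm{0}$ we have the exact formula $$\dim\left(\mathcal{S}_n(\tau,\bm{0})\cap\mathcal{L}\right)=\frac{n+1}{\tau+1}-m\quad\text{when }\ \frac1n\le\tau<\tau_0,\qquad\text{where }\tau_0:=\frac{1}{\max\{m,\omega\}}.$$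
   Context: Vectors are row vectors; $|\cdot|$ is the supremum norm; $\|\bm{y}\|$ is the sup-norm distance of $\bm{y}$ to the nearest integer vector (also for column vectors). $\dim$ is Hausdorff dimension. The diophantine exponent $\omega(A)$ of a real matrix $A$ with $m$ columns is the supremum (possibly $\infty$) of all $\omega\in\mathbb{R}$ such that $\|A\bm{q}^{\mathrm T}\|<|\bm{q}|^{-\omega}$ holds for infinitely many $\bm{q}\in\mathbb{Z}^m$; $\sigma(A):=\omega(A^{\mathrm T})$. Usual conventions ($1/\infty=0$, etc.) apply for infinite exponents. $\mathcal{S}_n(\tau,\bm{\theta})=\{\bm{y}\in\mathbb{R}^n:\|q\bm{y}-\bm{\theta}\|<q^{-\tau}\text{ for infinitely many }q\in\mathbb{N}\}$. *)

theory Defs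
  imports "HOL-Analysis.Analysis"
begin

section \<open>Hausdorff dimension\<close>

text \<open>
  The weight of a covering set is its diameter to the power \<open>s\<close>, with the convention that for
  \<open>s = 0\<close> every nonempty set has weight 1 (recall that \<open>0 powr 0 = 0\<close> in HOL, which would
  otherwise give singletons weight 0). The restriction to bounded covering sets is needed
  because \<^const>\<open>diameter\<close> is a real number and has no meaningful value on unbounded sets.
\<close>

definition hausdorff_weight :: "real \<Rightarrow> 'a::metric_space set \<Rightarrow> ennreal" where
  "hausdorff_weight s U =
     (if U = {} then 0 else if s = 0 then 1 else ennreal (diameter U powr s))"

definition hausdorff_premeasure :: "real \<Rightarrow> real \<Rightarrow> 'a::metric_space set \<Rightarrow> ennreal" where
  "hausdorff_premeasure s \<delta> S =
     (INF U \<in> {U :: nat \<Rightarrow> 'a set. S \<subseteq> (\<Union>i. U i) \<and> (\<forall>i. bounded (U i) \<and> diameter (U i) \<le> \<delta>)}.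
        (\<Sum>i. hausdorff_weight s (U i)))"

definition hausdorff_measure :: "real \<Rightarrow> 'a::metric_space set \<Rightarrow> ennreal" where
  "hausdorff_measure s S = (SUP \<delta> \<in> {0<..}. hausdorff_premeasure s \<delta> S)"

text \<open>With this definition the empty set has dimension 0.\<close>

definition hausdorff_dim :: "'a::metric_space set \<Rightarrow> ereal" where
  "hausdorff_dim S = (INF s \<in> {s::real. 0 \<le> s \<and> hausdorff_measure s S = 0}. ereal s)"

section \<open>Diophantine exponents and approximable points\<close>

text \<open>The supremum norm on \<^typ>\<open>real ^ 'n\<close> is the library's \<^const>\<open>infnorm\<close>.\<close>

definition of_int_vec :: "int ^ 'n \<Rightarrow> real ^ 'n" where
  "of_int_vec q = (\<chi> i. of_int (q $ i))"

definition int_dist :: "real ^ 'n \<Rightarrow> real" where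
  "int_dist y = (INF p :: int ^ 'n. infnorm (y - of_int_vec p))"

definition dioph_exponent :: "real ^ 'c ^ 'r \<Rightarrow> ereal" where
  "dioph_exponent A =
     (SUP w \<in> {w::real. infinite {q :: int ^ 'c.
        int_dist (A *v of_int_vec q) < infnorm (of_int_vec q) powr (- w)}}. ereal w)"

definition approximable :: "real \<Rightarrow> real ^ 'n \<Rightarrow> (real ^ 'n) set" where
  "approximable \<tau> \<theta> =
     {y. infinite {q::nat. 0 < q \<and> int_dist (real q *\<^sub>R y - \<theta>) < real q powr (- \<tau>)}}"

section \<open>Affine subspaces\<close>

text \<open>
  The index type \<^typ>\<open>'d option\<close> has \<open>d + 1\<close> elements, \<^const>\<open>None\<close> being the additional
  leading coordinate. Similarly \<^typ>\<open>'d + 'm\<close> indexes the coordinates of \<open>\<real>\<^sup>n\<close>, \<open>n = d + m\<close>.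
\<close>

definition extend_one :: "real ^ 'd::finite \<Rightarrow> real ^ 'd option" where
  "extend_one x = (\<chi> k. case k of None \<Rightarrow> 1 | Some i \<Rightarrow> x $ i)"

definition join_vec :: "real ^ 'd::finite \<Rightarrow> real ^ 'm::finite \<Rightarrow> real ^ ('d + 'm)" where
  "join_vec x y = (\<chi> k. case k of Inl i \<Rightarrow> x $ i | Inr j \<Rightarrow> y $ j)"

definition affine_subspace :: "real ^ 'm::finite ^ ('d::finite) option \<Rightarrow> (real ^ ('d + 'm)) set" where
  "affine_subspace A = {join_vec x (extend_one x v* A) | x. True}"

text \<open>
  The quotient \<open>((d + 1) \<omega> - m) / ((\<tau> + 1) \<omega>)\<close>. For \<open>\<omega> = \<infinity>\<close> it is read as
  \<open>(d + 1 - m / \<omega>) / (\<tau> + 1)\<close> with \<open>m / \<infinity> = 0\<close>; in \<^typ>\<open>ereal\<close> the quotient \<open>\<infinity> / \<infinity>\<close> would be 0.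
\<close>

definition middle_bound :: "real \<Rightarrow> real \<Rightarrow> ereal \<Rightarrow> real \<Rightarrow> ereal" where
  "middle_bound d m \<omega> \<tau> =
     (if \<omega> = \<infinity> then ereal ((d + 1) / (\<tau> + 1))
      else (ereal (d + 1) * \<omega> - ereal m) / (ereal (\<tau> + 1) * \<omega>))"

end

theory Submission
  imports Defs "HOL-Real_Asymp.Real_Asymp"
begin

text \<open>
  If \<open>q y\<close> is close to \<open>\<theta> + p\<close> for a point \<open>y = (x, (1, x) A)\<close>, then the integer vector
  \<open>a = (q, p\<^sub>1, \<dots>, p\<^sub>d)\<close> has \<open>a A\<close> close to a fixed point modulo 1, and \<open>a\<close> determines \<open>y\<close> up
  to \<open>q\<close> to the power \<open>-1 - \<tau>\<close>. So upper bounds for the dimension reduce to counting \<open>a\<close> with \<open>|a| \<le> R\<close>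
  and \<open>\<parallel>a A\<parallel> < \<psi>\<close>; passing to differences makes this count homogeneous. Below \<open>1/\<omega>\<close> the count has
  the expected order \<open>R\<^sup>d\<^sup>+\<^sup>1 \<psi>\<^sup>m\<close> by duality: the points \<open>A c\<close> with \<open>|c| \<le> 1/\<psi>\<close> are separated modulo 1,
  which bounds the dual exponential sums. For large \<open>\<tau>\<close> one uses instead that the points \<open>a A\<close>
  themselves are separated, as measured by \<open>\<sigma>\<close>.

  For the lower bound, a pigeonhole argument shows that every \<open>x\<close> is close to the centre \<open>p / q\<close> of some
  such \<open>a\<close> with \<open>q \<le> Q\<close>, and the count shows that the \<open>a\<close> with \<open>q\<close> much smaller than \<open>Q\<close> only serve a set of
  small volume. Hence every ball contains many well separated small balls of points of the required
  quality. Given a cover of small Hausdorff sum, one descends through nested balls, choosing at every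
  stage a ball in which the conditional weight of the cover does not increase; the limit point
  is not covered.
\<close>

text \<open>Constants and factors \<open>R powr \<epsilon>\<close> do not affect a dimension, so all
  estimates use some \<open>w\<close> strictly above \<open>\<omega>\<close> or
  \<open>\<sigma>\<close>, for which a bound \<open>c * |q| powr (- w)\<close> holds at every
  nonzero \<open>q\<close>. The points \<open>A c\<close> are known to be
  \<open>1 / R\<close>-separated only for \<open>|c|\<close> up to about
  \<open>R powr (1 / w)\<close>; below width \<open>R powr (- 1 / w)\<close> the duality bound stays
  at exponent \<open>d + 1 - m / w\<close>, which is the numerator of the second case divided by
  \<open>\<omega>\<close>. Separation of the points \<open>a A\<close> gives exponent
  \<open>m * (\<sigma> - \<tau>)\<close>, and the two agree at
  \<open>\<tau> = 1 / \<omega> + \<sigma> - (d + 1) / m\<close>. In the lower bound, denominators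
  near \<open>y\<close> produce a term \<open>y powr (1 - m / w)\<close>, which the largest
  \<open>y\<close> dominates only if \<open>w > m\<close>; hence the maximum in
  \<open>\<tau>\<^sub>0\<close>. The condition \<open>1 / n \<le> \<tau>\<close> makes balls of
  radius \<open>Q powr (- 1 - \<tau>)\<close> no larger than the spacing of their centres.\<close>

section \<open>Supremum norm and distance to the nearest integer vector\<close>

lemma infnorm_cart_Max: "infnorm (x::real^'n) = Max (range (\<lambda>i. \<bar>x $ i\<bar>))"
proof -
  have "infnorm x = Sup (range (\<lambda>i. \<bar>x $ i\<bar>))"
    by (simp add: infnorm_cart full_SetCompr_eq)
  also have "\<dots> = Max (range (\<lambda>i. \<bar>x $ i\<bar>))"
    by (rule cSup_eq_Max) auto
  finally show ?thesis .
qed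

lemma infnorm_less_iff_cart: "infnorm (x::real^'n) < t \<longleftrightarrow> (\<forall>i. \<bar>x $ i\<bar> < t)"
  by (simp add: infnorm_cart_Max)

lemma infnorm_le_iff_cart: "infnorm (x::real^'n) \<le> t \<longleftrightarrow> (\<forall>i. \<bar>x $ i\<bar> \<le> t)"
  by (simp add: infnorm_cart_Max)

lemma infnorm_ge_iff_cart: "t \<le> infnorm (x::real^'n) \<longleftrightarrow> (\<exists>i. t \<le> \<bar>x $ i\<bar>)"
  by (simp add: infnorm_cart_Max Max_ge_iff)

lemma norm_le_card_infnorm: "norm (x::real^'n) \<le> real CARD('n) * infnorm x"
proof -
  have "norm x \<le> (\<Sum>i\<in>UNIV. \<bar>x $ i\<bar>)" by (rule norm_le_l1_cart)
  also have "\<dots> \<le> (\<Sum>i\<in>(UNIV::'n set). infnorm x)"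
    by (intro sum_mono component_le_infnorm_cart)
  finally show ?thesis by simp
qed

lemma of_int_vec_nth [simp]: "of_int_vec q $ i = of_int (q $ i)"
  by (simp add: of_int_vec_def)

lemma of_int_vec_add: "of_int_vec (a + b) = of_int_vec a + of_int_vec b"
  by (simp add: vec_eq_iff)

lemma of_int_vec_diff: "of_int_vec (a - b) = of_int_vec a - of_int_vec b"
  by (simp add: vec_eq_iff)

lemma of_int_vec_0 [simp]: "of_int_vec 0 = 0"
  by (simp add: vec_eq_iff)

lemma of_int_vec_eq_0_iff [simp]: "of_int_vec a = 0 \<longleftrightarrow> a = 0"
  by (simp add: vec_eq_iff)

lemma infnorm_of_int_vec_ge_1: "a \<noteq> 0 \<Longrightarrow> 1 \<le> infnorm (of_int_vec a)"
proof -
  assume "a \<noteq> 0"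
  then obtain i where "a $ i \<noteq> 0" by (auto simp: vec_eq_iff)
  then have "1 \<le> \<bar>real_of_int (a $ i)\<bar>" by linarith
  then show ?thesis by (auto simp: infnorm_ge_iff_cart)
qed

lemma int_dist_less_iff: "int_dist y < t \<longleftrightarrow> (\<exists>p. infnorm (y - of_int_vec p) < t)"
  unfolding int_dist_def
  by (subst cINF_less_iff) (auto intro: bdd_belowI[where m = 0] infnorm_pos_le)

lemma int_dist_nonneg: "0 \<le> int_dist y"
  unfolding int_dist_def by (rule cINF_greatest) (auto intro: infnorm_pos_le)

lemma int_dist_less_1: "int_dist y < 1"
  unfolding int_dist_less_iff
proof
  show "infnorm (y - of_int_vec (\<chi> i. \<lfloor>y $ i\<rfloor>)) < 1"
    unfolding infnorm_less_iff_cart by (simp; linarith)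
qed

lemma int_dist_le: "int_dist y \<le> infnorm (y - of_int_vec p)"
  unfolding int_dist_def
  by (rule cINF_lower) (auto intro: bdd_belowI[where m = 0] infnorm_pos_le)

lemma int_dist_triangle: "int_dist (x + y) \<le> int_dist x + int_dist y"
proof (rule dense_ge)
  fix t assume t: "int_dist x + int_dist y < t"
  define e where "e = (t - int_dist x - int_dist y) / 2"
  have "int_dist x < int_dist x + e" "int_dist y < int_dist y + e"
    using t by (simp_all add: e_def)
  then obtain p q where p: "infnorm (x - of_int_vec p) < int_dist x + e"
    and q: "infnorm (y - of_int_vec q) < int_dist y + e"
    unfolding int_dist_less_iff by blast
  have "int_dist (x + y) \<le> infnorm (x + y - of_int_vec (p + q))"
    by (rule int_dist_le)
  also have "x + y - of_int_vec (p + q) = (x - of_int_vec p) + (y - of_int_vec q)"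
    by (simp add: of_int_vec_add)
  also have "infnorm \<dots> \<le> infnorm (x - of_int_vec p) + infnorm (y - of_int_vec q)"
    by (rule infnorm_triangle)
  also have "\<dots> < t" using p q by (simp add: e_def field_simps)
  finally show "int_dist (x + y) \<le> t" by simp
qed

lemma int_dist_minus: "int_dist (- y) = int_dist y"
proof -
  have "int_dist (- y) \<le> int_dist y" for y :: "real^'n"
  proof (rule dense_ge)
    fix t assume "int_dist y < t"
    then obtain p where p: "infnorm (y - of_int_vec p) < t"
      unfolding int_dist_less_iff by blast
    have "int_dist (- y) \<le> infnorm (- y - of_int_vec (- p))" by (rule int_dist_le)
    also have "- y - of_int_vec (- p) = - (y - of_int_vec p)"
      by (simp add: vec_eq_iff)
    finally show "int_dist (- y) \<le> t" using p by (simp only: infnorm_neg)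
  qed
  from this[of y] this[of "- y"] show ?thesis by simp
qed

lemma int_dist_diff: "int_dist (x - y) \<le> int_dist x + int_dist y"
  using int_dist_triangle[of x "- y"] by (simp add: int_dist_minus)

lemma int_dist_scaleR_nat: "int_dist (real n *\<^sub>R y) \<le> real n * int_dist y"
proof (induction n)
  case 0
  have "int_dist (0::real^'n) \<le> infnorm (0 - of_int_vec (0::int^'n))" by (rule int_dist_le)
  then show ?case by (simp add: infnorm_0)
next
  case (Suc n)
  have "int_dist (real (Suc n) *\<^sub>R y) = int_dist (real n *\<^sub>R y + y)"
    by (simp add: algebra_simps)
  also have "\<dots> \<le> real n * int_dist y + int_dist y"
    using int_dist_triangle Suc by (smt (verit))
  finally show ?case by (simp add: algebra_simps)
qed

section \<open>Boxes of vectors: factorisation of sums and counting\<close>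

lemma bij_betw_vec_nth_PiE:
  "bij_betw vec_nth {v::'a^'k. \<forall>i. v $ i \<in> T} (PiE UNIV (\<lambda>_::'k::finite. T))"
  by (rule bij_betwI[where g = vec_lambda]) (auto simp: PiE_UNIV_domain)

text \<open>The distributive law, indexed by vectors instead of functions. It factors exponential
  sums over a box, and majorants summed over cells, into one-dimensional sums.\<close>

lemma sum_prod_vec:
  fixes f :: "'k::finite \<Rightarrow> 'a \<Rightarrow> 'b::comm_semiring_1"
  assumes "finite T"
  shows "(\<Sum>v\<in>{v::'a^'k. \<forall>i. v $ i \<in> T}. \<Prod>i\<in>UNIV. f i (v $ i)) = (\<Prod>i\<in>UNIV. \<Sum>t\<in>T. f i t)"
proof -
  have "(\<Prod>i\<in>UNIV. \<Sum>t\<in>T. f i t) = (\<Sum>g\<in>PiE UNIV (\<lambda>_. T). \<Prod>i\<in>UNIV. f i (g i))"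
    using assms by (intro prod_sum_PiE) auto
  also have "\<dots> = (\<Sum>v\<in>{v::'a^'k. \<forall>i. v $ i \<in> T}. \<Prod>i\<in>UNIV. f i (v $ i))"
    by (rule sum.reindex_bij_betw[symmetric, OF bij_betw_vec_nth_PiE])
  finally show ?thesis by simp
qed

lemma finite_vec_box: "finite T \<Longrightarrow> finite {v::'a^'k::finite. \<forall>i. v $ i \<in> T}"
  using bij_betw_finite[OF bij_betw_vec_nth_PiE[where 'a='a and 'k='k and T=T]]
  by (simp add: finite_PiE)

lemma card_vec_box: "finite T \<Longrightarrow> card {v::'a^'k::finite. \<forall>i. v $ i \<in> T} = card T ^ CARD('k)"
  using bij_betw_same_card[OF bij_betw_vec_nth_PiE[where 'a='a and 'k='k and T=T]]
  by (simp add: card_PiE)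

lemma int_vec_ball_eq_box:
  "{a::int^'k. infnorm (of_int_vec a) \<le> R} = {a. \<forall>i. a $ i \<in> {-\<lfloor>R\<rfloor>..\<lfloor>R\<rfloor>}}"
proof -
  have "\<bar>real_of_int z\<bar> \<le> R \<longleftrightarrow> z \<in> {-\<lfloor>R\<rfloor>..\<lfloor>R\<rfloor>}" for z
  proof -
    have "\<bar>real_of_int z\<bar> \<le> R \<longleftrightarrow> \<bar>z\<bar> \<le> \<lfloor>R\<rfloor>" by (simp add: le_floor_iff)
    then show ?thesis by auto
  qed
  then show ?thesis by (simp add: infnorm_le_iff_cart)
qed

lemma finite_int_vec_ball: "finite {a::int^'k. infnorm (of_int_vec a) \<le> R}"
  unfolding int_vec_ball_eq_box by (rule finite_vec_box) simp

lemma card_int_vec_ball_le: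
  assumes "1 \<le> R"
  shows "real (card {a::int^'k. infnorm (of_int_vec a) \<le> R}) \<le> (3 * R) ^ CARD('k)"
proof -
  have *: "real (nat (2 * \<lfloor>R\<rfloor> + 1)) \<le> 3 * R"
    using assms by (simp add: nat_le_real_less) linarith
  have "real (card {a::int^'k. infnorm (of_int_vec a) \<le> R}) = real (nat (2 * \<lfloor>R\<rfloor> + 1)) ^ CARD('k)"
    unfolding int_vec_ball_eq_box by (subst card_vec_box) (auto simp: algebra_simps)
  also have "\<dots> \<le> (3 * R) ^ CARD('k)" by (rule power_mono[OF *]) simp
  finally show ?thesis .
qed

text \<open>Cut space into cells of side \<open>\<delta>\<close> with a corner at \<open>z\<close>.
  Two points of one cell differ by less than \<open>\<delta>\<close> in every coordinate, so each
  cell holds at most one point of \<open>S\<close>, and the cube of radius \<open>X\<close> meets at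
  most \<open>2 * X / \<delta> + 2\<close> cells in each direction.\<close>

lemma card_separated_le:
  fixes S :: "(real^'k) set"
  assumes bd: "\<And>v. v \<in> S \<Longrightarrow> infnorm (v - z) \<le> X" and "0 \<le> X" and "0 < \<delta>"
    and sep: "\<And>v v'. \<lbrakk>v \<in> S; v' \<in> S; v \<noteq> v'\<rbrakk> \<Longrightarrow> \<delta> \<le> infnorm (v - v')"
  shows "finite S" and "real (card S) \<le> (2 * X / \<delta> + 2) ^ CARD('k)"
proof -
  define f where "f v = (\<chi> i. \<lfloor>(v $ i - z $ i) / \<delta>\<rfloor>)" for v :: "real^'k"
  define T where "T = {\<lfloor>- X / \<delta>\<rfloor>..\<lfloor>X / \<delta>\<rfloor>}"
  have inj: "inj_on f S"
  proof (rule inj_onI, rule ccontr)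
    fix v v' assume *: "v \<in> S" "v' \<in> S" "f v = f v'" "v \<noteq> v'"
    obtain i where i: "\<delta> \<le> \<bar>(v - v') $ i\<bar>"
      using sep[OF *(1,2,4)] unfolding infnorm_ge_iff_cart by blast
    have "\<lfloor>(v $ i - z $ i) / \<delta>\<rfloor> = \<lfloor>(v' $ i - z $ i) / \<delta>\<rfloor>"
      using *(3) by (simp add: f_def vec_eq_iff)
    then have "\<bar>(v $ i - z $ i) / \<delta> - (v' $ i - z $ i) / \<delta>\<bar> < 1" by linarith
    then have "\<bar>(v $ i - v' $ i) / \<delta>\<bar> < 1" by (simp add: diff_divide_distrib)
    then show False using i \<open>0 < \<delta>\<close> by (simp add: abs_divide field_simps)
  qed
  have sub: "f ` S \<subseteq> {u. \<forall>i. u $ i \<in> T}"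
  proof
    fix u assume "u \<in> f ` S"
    then obtain v where v: "v \<in> S" "u = f v" by blast
    have "u $ i \<in> T" for i
    proof -
      have "\<bar>v $ i - z $ i\<bar> \<le> X" using bd[OF v(1)] by (simp add: infnorm_le_iff_cart)
      then have "- X / \<delta> \<le> (v $ i - z $ i) / \<delta>" "(v $ i - z $ i) / \<delta> \<le> X / \<delta>"
        using \<open>0 < \<delta>\<close> by (intro divide_right_mono; simp)+
      then show ?thesis unfolding T_def v(2) f_def by (auto intro: floor_mono)
    qed
    then show "u \<in> {u. \<forall>i. u $ i \<in> T}" by simp
  qed
  have fin: "finite {u::int^'k. \<forall>i. u $ i \<in> T}"
    by (rule finite_vec_box) (simp add: T_def)
  show "finite S" using finite_imageD[OF finite_subset[OF sub fin] inj] .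
  have "card S = card (f ` S)" using inj by (simp add: card_image)
  also have "\<dots> \<le> card T ^ CARD('k)"
    using card_mono[OF fin sub] card_vec_box[of T, where 'k='k] by (simp add: T_def)
  finally have "real (card S) \<le> real (card T) ^ CARD('k)" by (metis of_nat_le_iff of_nat_power)
  also have "\<dots> \<le> (2 * X / \<delta> + 2) ^ CARD('k)"
  proof (rule power_mono)
    have "0 \<le> X / \<delta>" using assms by simp
    then have "real (card T) = of_int (\<lfloor>X / \<delta>\<rfloor> - \<lfloor>- X / \<delta>\<rfloor> + 1)"
      unfolding T_def by (simp add: floor_le_iff) linarith
    also have "\<dots> \<le> 2 * X / \<delta> + 2" by (simp; linarith)
    finally show "real (card T) \<le> 2 * X / \<delta> + 2" .
  qed simp
  finally show "real (card S) \<le> (2 * X / \<delta> + 2) ^ CARD('k)" .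
qed

subsection \<open>Diophantine exponents and Bohr sets\<close>

text \<open>The exponent 0 always qualifies: the right-hand side is then 1 for every nonzero
  \<open>q\<close>, and the distance to the nearest integer vector is below 1.\<close>

lemma dioph_exponent_nonneg: "0 \<le> dioph_exponent (B :: real^'c^'r)"
proof -
  have "infinite {q :: int ^ 'c. int_dist (B *v of_int_vec q) < infnorm (of_int_vec q) powr (- 0)}"
  proof -
    have "inj (\<lambda>n::nat. (\<chi> i. int n + 1) :: int^'c)"
      by (auto intro!: injI simp: vec_eq_iff)
    then have "infinite (range (\<lambda>n::nat. (\<chi> i. int n + 1) :: int^'c))"
      by (rule range_inj_infinite)
    then have "infinite {q :: int ^ 'c. q \<noteq> 0}"
      by (rule infinite_super[rotated]) (auto simp: vec_eq_iff)
    then show ?thesis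
    proof (rule infinite_super[rotated], intro subsetI CollectI)
      fix q :: "int^'c" assume "q \<in> {q. q \<noteq> 0}"
      then have "infnorm (of_int_vec q) powr (- 0) = 1"
        using infnorm_of_int_vec_ge_1[of q] by simp
      then show "int_dist (B *v of_int_vec q) < infnorm (of_int_vec q) powr (- 0)"
        using int_dist_less_1 by simp
    qed
  qed
  then have "ereal 0 \<le> dioph_exponent B"
    unfolding dioph_exponent_def by (intro SUP_upper) simp
  then show ?thesis by (simp add: zero_ereal_def)
qed

text \<open>Only finitely many \<open>q\<close> violate the bound with \<open>c = 1\<close>, so
  \<open>c\<close> can be a minimum over these, provided that no \<open>q \<noteq> 0\<close> has
  distance exactly 0. Such a \<open>q\<close> would make all its positive multiples violate the
  bound.\<close>

lemma dioph_exponent_lower_bound: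
  fixes B :: "real^'c^'r"
  assumes w: "dioph_exponent B < ereal w" "0 < w"
  obtains c where "0 < c" "c \<le> 1"
    "\<And>q. q \<noteq> 0 \<Longrightarrow> c * infnorm (of_int_vec q) powr (- w) \<le> int_dist (B *v of_int_vec q)"
proof -
  define F where "F = {q :: int ^ 'c. int_dist (B *v of_int_vec q) < infnorm (of_int_vec q) powr (- w)}"
  have fin: "finite F"
  proof (rule ccontr)
    assume "infinite F"
    then have "ereal w \<le> dioph_exponent B"
      unfolding dioph_exponent_def F_def by (intro SUP_upper) simp
    then show False using w by simp
  qed
  have pos: "0 < int_dist (B *v of_int_vec q)" if q: "q \<noteq> 0" for q
  proof (rule ccontr)
    assume "\<not> ?thesis"
    then have 0: "int_dist (B *v of_int_vec q) = 0" using int_dist_nonneg by (smt (verit))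
    define g where "g n = (\<chi> i. (int n + 1) * q $ i)" for n
    have g: "of_int_vec (g n) = real (Suc n) *\<^sub>R of_int_vec q" for n
      by (simp add: vec_eq_iff g_def add.commute)
    have "g n \<in> F" for n
    proof -
      have "int_dist (B *v of_int_vec (g n)) \<le> real (Suc n) * int_dist (B *v of_int_vec q)"
        unfolding g matrix_vector_mult_scaleR by (rule int_dist_scaleR_nat)
      also have "\<dots> = 0" using 0 by simp
      also have "0 < infnorm (of_int_vec (g n)) powr (- w)"
        unfolding g using q by (simp add: infnorm_mul infnorm_eq_0)
      finally show ?thesis by (simp add: F_def)
    qed
    moreover have "inj g"
    proof (rule injI)
      fix a b assume "g a = g b"
      obtain i where "q $ i \<noteq> 0" using q by (auto simp: vec_eq_iff)
      with \<open>g a = g b\<close> show "a = b" by (auto simp: g_def vec_eq_iff dest!: spec[of _ i])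
    qed
    ultimately have "infinite F"
      using range_inj_infinite infinite_super[of "range g" F] by blast
    with fin show False by simp
  qed
  \<comment> \<open>The entry 1 keeps the minimum defined when there is no exception and gives
    \<open>c \<le> 1\<close>, which settles every \<open>q\<close> outside \<open>F\<close>.\<close>
  define c where "c = Min (insert 1 ((\<lambda>q. int_dist (B *v of_int_vec q) * infnorm (of_int_vec q) powr w) ` (F - {0})))"
  have fin': "finite (insert 1 ((\<lambda>q. int_dist (B *v of_int_vec q) * infnorm (of_int_vec q) powr w) ` (F - {0})))"
    using fin by simp
  show ?thesis
  proof (rule that)
    show "0 < c" unfolding c_def using fin'
      by (subst Min_gr_iff) (auto intro!: mult_pos_pos pos simp: infnorm_eq_0)
    show "c \<le> 1" unfolding c_def by (rule Min_le[OF fin']) simp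
    fix q :: "int^'c" assume q: "q \<noteq> 0"
    have i1: "1 \<le> infnorm (of_int_vec q)" by (rule infnorm_of_int_vec_ge_1[OF q])
    show "c * infnorm (of_int_vec q) powr (- w) \<le> int_dist (B *v of_int_vec q)"
    proof (cases "q \<in> F")
      case True
      then have "c \<le> int_dist (B *v of_int_vec q) * infnorm (of_int_vec q) powr w"
        unfolding c_def using q by (intro Min_le[OF fin']) auto
      then have "c * infnorm (of_int_vec q) powr (- w)
          \<le> int_dist (B *v of_int_vec q) * infnorm (of_int_vec q) powr w * infnorm (of_int_vec q) powr (- w)"
        by (intro mult_right_mono) auto
      also have "\<dots> = int_dist (B *v of_int_vec q)"
        using i1 by (simp add: mult.assoc flip: powr_add)
      finally show ?thesis .
    next
      case False
      have "c * infnorm (of_int_vec q) powr (- w) \<le> 1 * infnorm (of_int_vec q) powr (- w)"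
        using \<open>c \<le> 1\<close> by (intro mult_right_mono) auto
      then show ?thesis using False by (simp add: F_def)
    qed
  qed
qed

text \<open>A Bohr set in the sense of additive combinatorics, with the columns of \<open>A\<close>
  as frequencies, cut down to a box. As \<open>a\<close> multiplies from the left, the exponent of
  \<open>transpose A\<close> controls these points, and that of \<open>A\<close> the dual
  ones.\<close>

definition bohr_set :: "real^'m^'k \<Rightarrow> real \<Rightarrow> real \<Rightarrow> (int^'k) set" where
  "bohr_set A R \<psi> = {a. infnorm (of_int_vec a) \<le> R \<and> int_dist (of_int_vec a v* A) < \<psi>}"

lemma finite_bohr_set [simp]: "finite (bohr_set A R \<psi>)"
  by (rule finite_subset[OF _ finite_int_vec_ball[of R]]) (auto simp: bohr_set_def)

lemma bohr_set_mono: "R \<le> R' \<Longrightarrow> \<psi> \<le> \<psi>' \<Longrightarrow> bohr_set A R \<psi> \<subseteq> bohr_set A R' \<psi>'"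
  by (auto simp: bohr_set_def)

lemma card_bohr_set_trivial:
  fixes A :: "real^'m^'k"
  assumes "1 \<le> R"
  shows "real (card (bohr_set A R \<psi>)) \<le> (3 * R) ^ CARD('k)"
proof -
  have "card (bohr_set A R \<psi>) \<le> card {a::int^'k. infnorm (of_int_vec a) \<le> R}"
    by (rule card_mono[OF finite_int_vec_ball]) (auto simp: bohr_set_def)
  then show ?thesis using card_int_vec_ball_le[OF assms, where 'k='k] by linarith
qed

text \<open>Distinct \<open>a\<close>, \<open>a'\<close> in the box differ by a vector of norm at
  most \<open>2 * R\<close>, so their images are at least \<open>c * (2 * R) powr (- w)\<close>
  apart modulo 1. Shifted by integer vectors, all images of the Bohr set lie in the cube of radius
  \<open>\<psi>\<close> about 0, where only so many separated points fit.\<close>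

lemma card_bohr_set_separation:
  fixes A :: "real^'m^'k"
  assumes w: "dioph_exponent (transpose A) < ereal w" "0 < w"
  obtains C where "0 < C"
    "\<And>R \<psi>. \<lbrakk>1 \<le> R; 0 < \<psi>\<rbrakk> \<Longrightarrow> real (card (bohr_set A R \<psi>)) \<le> C * (1 + \<psi> * R powr w) ^ CARD('m)"
proof -
  obtain c where c: "0 < c" "\<And>q. q \<noteq> 0 \<Longrightarrow>
      c * infnorm (of_int_vec q) powr (- w) \<le> int_dist (transpose A *v of_int_vec q)"
    using dioph_exponent_lower_bound[OF w] by metis
  define C0 where "C0 = 2 * 2 powr w / c + 2"
  have C0: "0 < C0" using c by (auto simp: C0_def intro!: add_nonneg_pos)
  show ?thesis
  proof (rule that)
    show "0 < C0 ^ CARD('m)" using C0 by simp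
    fix R \<psi> :: real assume R: "1 \<le> R" and psi: "0 < \<psi>"
    define S where "S = bohr_set A R \<psi>"
    have "\<forall>a\<in>S. \<exists>p. infnorm (of_int_vec a v* A - of_int_vec p) < \<psi>"
      by (auto simp: S_def bohr_set_def int_dist_less_iff)
    then obtain p where p: "\<And>a. a \<in> S \<Longrightarrow> infnorm (of_int_vec a v* A - of_int_vec (p a)) < \<psi>"
      by metis
    define u where "u a = of_int_vec a v* A - of_int_vec (p a)" for a
    define \<delta> where "\<delta> = c * (2 * R) powr (- w)"
    have \<delta>: "0 < \<delta>" using c R by (simp add: \<delta>_def)
    have sep: "\<delta> \<le> infnorm (u a - u a')" if "a \<in> S" "a' \<in> S" "a \<noteq> a'" for a a'
    proof -
      have R2: "infnorm (of_int_vec (a - a')) \<le> 2 * R"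
      proof -
        have "infnorm (of_int_vec a + - of_int_vec a') \<le> infnorm (of_int_vec a) + infnorm (- of_int_vec a')"
          by (rule infnorm_triangle)
        also have "\<dots> \<le> 2 * R" using that by (simp add: infnorm_neg S_def bohr_set_def)
        finally show ?thesis by (simp add: of_int_vec_diff)
      qed
      have "\<delta> \<le> c * infnorm (of_int_vec (a - a')) powr (- w)"
        unfolding \<delta>_def using c w R2 infnorm_of_int_vec_ge_1[of "a - a'"] that
        by (intro mult_left_mono powr_mono2') auto
      also have "\<dots> \<le> int_dist (transpose A *v of_int_vec (a - a'))" using that by (intro c) auto
      also have "\<dots> \<le> infnorm (transpose A *v of_int_vec (a - a') - of_int_vec (p a - p a'))"
        by (rule int_dist_le)
      also have "transpose A *v of_int_vec (a - a') - of_int_vec (p a - p a') = u a - u a'"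
        by (simp add: u_def of_int_vec_diff matrix_vector_mult_diff_distrib)
      finally show ?thesis .
    qed
    have inj: "inj_on u S"
      by (rule inj_onI, rule ccontr) (use sep \<delta> in \<open>fastforce simp: infnorm_0\<close>)
    have "real (card S) = real (card (u ` S))" using inj by (simp add: card_image)
    also have "\<dots> \<le> (2 * \<psi> / \<delta> + 2) ^ CARD('m)"
    proof (rule card_separated_le(2)[where z = 0])
      fix v assume "v \<in> u ` S"
      then show "infnorm (v - 0) \<le> \<psi>" using p by (auto simp: u_def less_imp_le)
    next
      fix v v' assume "v \<in> u ` S" "v' \<in> u ` S" "v \<noteq> v'"
      then show "\<delta> \<le> infnorm (v - v')" using sep by blast
    qed (use psi \<delta> in auto)
    also have "\<dots> \<le> (C0 * (1 + \<psi> * R powr w)) ^ CARD('m)"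
    proof (rule power_mono)
      have "2 * \<psi> / \<delta> = 2 * 2 powr w / c * (\<psi> * R powr w)"
        using R c by (simp add: \<delta>_def powr_minus powr_mult field_simps)
      moreover have "0 \<le> 2 * 2 powr w / c" "0 \<le> \<psi> * R powr w" using c psi by auto
      ultimately show "2 * \<psi> / \<delta> + 2 \<le> C0 * (1 + \<psi> * R powr w)"
        by (simp only: C0_def distrib_left distrib_right mult_1_right)
    qed (use psi \<delta> in auto)
    finally show "real (card (bohr_set A R \<psi>)) \<le> C0 ^ CARD('m) * (1 + \<psi> * R powr w) ^ CARD('m)"
      by (simp add: S_def power_mult_distrib)
  qed
qed

subsection \<open>Exponential sums\<close>

text \<open>A weak form of Jordan's inequality \<open>2 * f \<le> sin (pi * f)\<close>; the factor 2
  only affects constants.\<close>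

lemma sin_pi_ge:
  assumes "0 \<le> f" "f \<le> 1 / 2"
  shows "f \<le> sin (pi * f)"
proof -
  have *: "x / 2 \<le> sin x" if "0 \<le> x" "x \<le> pi / 2" for x :: real
  proof -
    have y: "0 \<le> x / 2" "x / 2 \<le> pi / 4" using that by auto
    have c: "sqrt 2 / 2 \<le> cos (x / 2)"
      using cos_monotone_0_pi_le[of "x / 2" "pi / 4"] y by (simp add: cos_45)
    \<comment> \<open>The derivative of \<open>sin t - t * cos t\<close> is
      \<open>t * sin t\<close>. At \<open>x / 2\<close> this gives
      \<open>sin (x / 2) \<ge> x / 2 * cos (x / 2)\<close>; by the double angle formula
      \<open>sin x\<close> is at least \<open>x\<close> times the square of
      \<open>cos (x / 2)\<close>, and that square is at least \<open>1 / 2\<close>.\<close>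
    have "sin 0 - 0 * cos 0 \<le> sin (x / 2) - x / 2 * cos (x / 2)"
    proof (rule DERIV_nonneg_imp_nondecreasing[where f = "\<lambda>t. sin t - t * cos t"])
      fix t :: real assume t: "0 \<le> t" "t \<le> x / 2"
      have "((\<lambda>t. sin t - t * cos t) has_real_derivative t * sin t) (at t)"
        by (auto intro!: derivative_eq_intros)
      moreover have "0 \<le> t * sin t" using t y pi_gt_zero by (intro mult_nonneg_nonneg sin_ge_zero) linarith+
      ultimately show "\<exists>D. ((\<lambda>t. sin t - t * cos t) has_real_derivative D) (at t) \<and> 0 \<le> D" by blast
    qed (use y in auto)
    then have "x / 2 * cos (x / 2) * (2 * cos (x / 2)) \<le> sin (x / 2) * (2 * cos (x / 2))"
      using less_le_trans[OF _ c, of 0] by (intro mult_right_mono) auto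
    also have "\<dots> = sin x" using sin_double[of "x / 2"] by simp
    finally have "x / 2 * (2 * (cos (x / 2))\<^sup>2) \<le> sin x" by (simp add: power2_eq_square mult_ac)
    moreover have "x / 2 * 1 \<le> x / 2 * (2 * (cos (x / 2))\<^sup>2)"
    proof (rule mult_left_mono)
      have "(sqrt 2 / 2)\<^sup>2 \<le> (cos (x / 2))\<^sup>2" using c by (intro power_mono) auto
      then show "1 \<le> 2 * (cos (x / 2))\<^sup>2" by (simp add: power_divide)
    qed (use that in simp)
    ultimately show ?thesis by simp
  qed
  have "f = 2 * f / 2" by simp
  also have "\<dots> \<le> pi * f / 2" using assms pi_ge_two by (intro divide_right_mono mult_right_mono) auto
  also have "\<dots> \<le> sin (pi * f)" using assms by (intro *) auto
  finally show ?thesis .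
qed

lemma norm_cis_minus_1: "cmod (1 - cis t) = 2 * \<bar>sin (t / 2)\<bar>"
proof -
  have "(cmod (1 - cis t))\<^sup>2 = (1 - cos t)\<^sup>2 + (sin t)\<^sup>2"
    by (simp add: cmod_power2)
  also have "\<dots> = (2 * \<bar>sin (t / 2)\<bar>)\<^sup>2"
    using cos_double_sin[of "t / 2"] sin_squared_eq[of t] by (simp add: power2_eq_square algebra_simps)
  finally show ?thesis by (rule power2_eq_imp_eq) auto
qed

text \<open>Majorant of the Dirichlet kernel at distance \<open>j\<close> cells from an integer, up to the factor \<open>M\<^sup>2\<close>; the \<open>max\<close>
  avoids the division by zero at \<open>j = 0\<close>.\<close>

definition decay :: "nat \<Rightarrow> real" where
  "decay j = 1 / (real (max 1 j))\<^sup>2"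

text \<open>The indices 0 and 1 contribute 1 each; from 2 on,
  \<open>1 / j^2 \<le> 1 / (j - 1) - 1 / j\<close> telescopes to at most 1.\<close>

lemma sum_decay_le: "(\<Sum>j<M. decay j) \<le> 3"
proof -
  have "(\<Sum>j<Suc (Suc M). decay j) \<le> 3 - 1 / real (Suc M)" for M
  proof (induction M)
    case 0
    then show ?case by (simp add: decay_def)
  next
    case (Suc M)
    have "1 / (real (Suc (Suc M)))\<^sup>2 \<le> 1 / (real (Suc M) * real (Suc (Suc M)))"
      unfolding power2_eq_square by (intro divide_left_mono mult_right_mono) auto
    also have "\<dots> = 1 / real (Suc M) - 1 / real (Suc (Suc M))" by (simp add: field_simps)
    finally show ?case using Suc by (simp add: decay_def)
  qed
  moreover have "(\<Sum>j<M. decay j) \<le> (\<Sum>j<Suc (Suc M). decay j)"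
    by (rule sum_mono2) (auto simp: decay_def)
  ultimately show ?thesis by (smt (verit) divide_nonneg_nonneg of_nat_0_le_iff)
qed

text \<open>The geometric sum is at most \<open>M\<close>, and at most
  \<open>2 / cmod (1 - z)\<close> when \<open>z \<noteq> 1\<close>, where
  \<open>cmod (1 - z) = 2 * sin (pi * f)\<close> is at least twice the distance of \<open>f\<close>
  to the nearer end of the unit interval. Cell \<open>j\<close> lies \<open>j\<close> cells from 0
  and \<open>M - 1 - j\<close> cells from 1, so the two decay terms cover both ends.\<close>

lemma dirichlet_kernel_bound:
  fixes x :: real and M :: nat
  assumes M: "1 \<le> M" and j: "j = nat \<lfloor>real M * frac x\<rfloor>"
  shows "(cmod (\<Sum>l\<in>{0..<int M}. cis (2 * pi * (of_int l * x))))\<^sup>2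
      \<le> (real M)\<^sup>2 * (decay j + decay (M - 1 - j))"
proof -
  define f where "f = frac x"
  have f: "0 \<le> f" "f < 1" by (auto simp: f_def frac_lt_1)
  define z where "z = cis (2 * pi * f)"
  have *: "cis (2 * pi * (real l * x)) = z ^ l" for l :: nat
  proof -
    have "2 * pi * (real l * x) = 2 * pi * (real l * f) + 2 * pi * of_int (int l * \<lfloor>x\<rfloor>)"
      by (simp add: f_def frac_def algebra_simps)
    then have "cis (2 * pi * (real l * x)) = cis (2 * pi * (real l * f)) * cis (2 * pi * of_int (int l * \<lfloor>x\<rfloor>))"
      by (simp only: cis_mult)
    also have "cis (2 * pi * of_int (int l * \<lfloor>x\<rfloor>)) = 1"
      by (intro cis_multiple_2pi) auto
    finally show ?thesis by (simp add: z_def Complex.DeMoivre mult.assoc mult.left_commute)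
  qed
  have "(\<Sum>l\<in>{0..<int M}. cis (2 * pi * (of_int l * x))) = (\<Sum>l<M. z ^ l)"
    by (rule sum.reindex_bij_witness[of _ int nat]) (auto simp: *[symmetric])
  moreover have "(cmod (\<Sum>l<M. z ^ l))\<^sup>2 \<le> (real M)\<^sup>2 * (decay j + decay (M - 1 - j))"
  proof (cases "j = 0 \<or> M - 1 - j = 0")
    case True
    \<comment> \<open>In an end cell \<open>z\<close> may equal 1 or be close to it, and only the
      number of terms is used.\<close>
    have "cmod (\<Sum>l<M. z ^ l) \<le> (\<Sum>l<M. cmod (z ^ l))" by (rule norm_sum)
    also have "\<dots> = real M" by (simp add: z_def norm_power)
    finally have "(cmod (\<Sum>l<M. z ^ l))\<^sup>2 \<le> (real M)\<^sup>2 * 1" by (simp add: power_mono)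
    also have "\<dots> \<le> (real M)\<^sup>2 * (decay j + decay (M - 1 - j))"
      using True by (intro mult_left_mono) (auto simp: decay_def)
    finally show ?thesis .
  next
    case False
    define i where "i = M - 1 - j"
    have ij: "1 \<le> j" "1 \<le> i" "real M = real i + real j + 1" using False by (auto simp: i_def)
    have jf: "real j \<le> real M * f" "real M * f < real j + 1"
      using f M unfolding j f_def[symmetric] by (auto simp: of_nat_nat)
    have fj: "real j / real M \<le> f" using jf M by (simp add: field_simps)
    have fi: "real i / real M \<le> 1 - f" using jf ij M by (simp add: field_simps)
    have f0: "0 < f" "f < 1" using fj fi ij M by (smt (verit) divide_pos_pos of_nat_0_less_iff order_less_le_trans zero_less_one)+
    have s: "min f (1 - f) \<le> sin (pi * f)"
    proof (cases "f \<le> 1 / 2")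
      case True then show ?thesis using sin_pi_ge[of f] f by auto
    next
      case False
      then have "1 - f \<le> sin (pi * (1 - f))" using f by (intro sin_pi_ge) auto
      also have "pi * (1 - f) = pi - pi * f" by (simp add: algebra_simps)
      finally show ?thesis by simp
    qed
    have "0 < min f (1 - f)" using f0 by auto
    then have nz: "cmod (1 - z) \<ge> 2 * min f (1 - f)"
      using s unfolding z_def norm_cis_minus_1 by simp
    then have "z \<noteq> 1" using \<open>0 < min f (1 - f)\<close> by auto
    then have "(\<Sum>l<M. z ^ l) = (1 - z ^ M) / (1 - z)"
      by (simp add: sum_gp_strict)
    then have "cmod (\<Sum>l<M. z ^ l) = cmod (1 - z ^ M) / cmod (1 - z)" by (simp add: norm_divide)
    also have "\<dots> \<le> 2 / (2 * min f (1 - f))"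
    proof (rule frac_le)
      have "cmod (1 - z ^ M) \<le> cmod 1 + cmod (z ^ M)" by (rule norm_triangle_ineq4)
      then show "cmod (1 - z ^ M) \<le> 2" by (simp add: z_def norm_power)
    qed (use nz \<open>0 < min f (1 - f)\<close> in auto)
    finally have "(cmod (\<Sum>l<M. z ^ l))\<^sup>2 \<le> (1 / min f (1 - f))\<^sup>2" by (intro power_mono) auto
    also have "\<dots> \<le> (1 / f)\<^sup>2 + (1 / (1 - f))\<^sup>2" by (auto simp: min_def)
    also have "\<dots> \<le> (1 / (real j / real M))\<^sup>2 + (1 / (real i / real M))\<^sup>2"
      using fi fj ij M f0 by (intro add_mono power_mono divide_left_mono) auto
    also have "\<dots> = (real M)\<^sup>2 * (decay j + decay i)"
      using ij by (simp add: decay_def power_divide algebra_simps max_def)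
    finally show ?thesis by (simp add: i_def)
  qed
  ultimately show ?thesis by simp
qed

text \<open>An inequality of large sieve type. Separated points occupy distinct cells of side
  \<open>1 / M\<close> of the torus, so the sum is at most the sum of the majorant over all cells.
  That sum factors over the coordinates, and each factor is \<open>M^2\<close> times two sums
  bounded by \<open>sum_decay_le\<close>, hence the 6.\<close>

lemma sum_dirichlet_kernels_separated:
  fixes x :: "'i \<Rightarrow> real^'k" and M :: nat
  assumes fin: "finite I" and M: "1 \<le> M"
    and sep: "\<And>c c'. \<lbrakk>c \<in> I; c' \<in> I; c \<noteq> c'\<rbrakk> \<Longrightarrow> 1 / real M \<le> int_dist (x c - x c')"
  shows "(\<Sum>c\<in>I. \<Prod>i\<in>UNIV. (cmod (\<Sum>l\<in>{0..<int M}. cis (2 * pi * (of_int l * x c $ i))))\<^sup>2)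
    \<le> (6 * (real M)\<^sup>2) ^ CARD('k)"
proof -
  define cell where "cell c = (\<chi> i. nat \<lfloor>real M * frac (x c $ i)\<rfloor>)" for c
  define g where "g j = (real M)\<^sup>2 * (decay j + decay (M - 1 - j))" for j
  have g0: "0 \<le> g j" for j by (simp add: g_def decay_def)
  have cell_less: "cell c $ i < M" for c i
  proof -
    have "real M * frac (x c $ i) < real M * 1" using M by (intro mult_strict_left_mono frac_lt_1) auto
    then have "\<lfloor>real M * frac (x c $ i)\<rfloor> < int M" by (simp add: floor_less_iff)
    then show ?thesis using M by (simp add: cell_def nat_less_iff)
  qed
  have inj: "inj_on cell I"
  proof (rule inj_onI, rule ccontr)
    fix c c' assume c: "c \<in> I" "c' \<in> I" "cell c = cell c'" "c \<noteq> c'"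
    have "int_dist (x c - x c') < 1 / real M"
      unfolding int_dist_less_iff infnorm_less_iff_cart
    proof (intro exI[of _ "\<chi> i. \<lfloor>x c $ i\<rfloor> - \<lfloor>x c' $ i\<rfloor>"] allI)
      fix i
      have "nat \<lfloor>real M * frac (x c $ i)\<rfloor> = nat \<lfloor>real M * frac (x c' $ i)\<rfloor>"
        using c(3) by (simp add: cell_def vec_eq_iff)
      moreover have "0 \<le> \<lfloor>real M * frac (x c $ i)\<rfloor>" "0 \<le> \<lfloor>real M * frac (x c' $ i)\<rfloor>" by auto
      ultimately have "\<lfloor>real M * frac (x c $ i)\<rfloor> = \<lfloor>real M * frac (x c' $ i)\<rfloor>" by linarith
      then have "\<bar>real M * frac (x c $ i) - real M * frac (x c' $ i)\<bar> < 1" by linarith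
      then have "\<bar>real M * (frac (x c $ i) - frac (x c' $ i))\<bar> < 1" by (simp only: right_diff_distrib)
      then have "\<bar>frac (x c $ i) - frac (x c' $ i)\<bar> < 1 / real M"
        using M by (simp add: abs_mult pos_less_divide_eq mult.commute del: right_diff_distrib)
      then show "\<bar>(x c - x c' - of_int_vec (\<chi> i. \<lfloor>x c $ i\<rfloor> - \<lfloor>x c' $ i\<rfloor>)) $ i\<bar> < 1 / real M"
        by (simp add: frac_def algebra_simps)
    qed
    then show False using sep[OF c(1,2,4)] by simp
  qed
  have "(\<Sum>c\<in>I. \<Prod>i\<in>UNIV. (cmod (\<Sum>l\<in>{0..<int M}. cis (2 * pi * (of_int l * x c $ i))))\<^sup>2)
      \<le> (\<Sum>c\<in>I. \<Prod>i\<in>UNIV. g (cell c $ i))"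
  proof (intro sum_mono prod_mono conjI)
    fix c i
    show "(cmod (\<Sum>l\<in>{0..<int M}. cis (2 * pi * (of_int l * x c $ i))))\<^sup>2 \<le> g (cell c $ i)"
      unfolding g_def by (rule dirichlet_kernel_bound[OF M]) (simp add: cell_def)
  qed simp
  also have "\<dots> = (\<Sum>v\<in>cell ` I. \<Prod>i\<in>UNIV. g (v $ i))"
    by (simp add: sum.reindex[OF inj])
  also have "\<dots> \<le> (\<Sum>v\<in>{v::nat^'k. \<forall>i. v $ i \<in> {..<M}}. \<Prod>i\<in>UNIV. g (v $ i))"
  proof (rule sum_mono2)
    show "finite {v::nat^'k. \<forall>i. v $ i \<in> {..<M}}" by (rule finite_vec_box) simp
    show "cell ` I \<subseteq> {v. \<forall>i. v $ i \<in> {..<M}}" using cell_less by auto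
    show "0 \<le> (\<Prod>i\<in>UNIV. g (v $ i))" for v :: "nat^'k" by (intro prod_nonneg ballI g0)
  qed
  also have "\<dots> = (\<Sum>j<M. g j) ^ CARD('k)"
    by (subst sum_prod_vec) auto
  also have "\<dots> \<le> (6 * (real M)\<^sup>2) ^ CARD('k)"
  proof (rule power_mono)
    have "(\<Sum>j<M. decay (M - 1 - j)) = (\<Sum>j<M. decay j)"
      using sum.nat_diff_reindex[of decay M] by (simp add: diff_diff_eq)
    then have "(\<Sum>j<M. g j) = (real M)\<^sup>2 * (2 * (\<Sum>j<M. decay j))"
      unfolding g_def sum_distrib_left[symmetric] sum.distrib by simp
    also have "\<dots> \<le> (real M)\<^sup>2 * (2 * 3)" by (intro mult_left_mono sum_decay_le) auto
    finally show "(\<Sum>j<M. g j) \<le> 6 * (real M)\<^sup>2" by simp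
  qed (simp add: sum_nonneg g0)
  finally show ?thesis .
qed

lemma double_sum_cis:
  "complex_of_real ((cmod (\<Sum>c\<in>C. cis (g c)))\<^sup>2) = (\<Sum>c\<in>C. \<Sum>c'\<in>C. cis (g c - g c'))"
proof -
  have "complex_of_real ((cmod (\<Sum>c\<in>C. cis (g c)))\<^sup>2) = (\<Sum>c\<in>C. cis (g c)) * cnj (\<Sum>c\<in>C. cis (g c))"
    by (simp only: complex_norm_square)
  also have "\<dots> = (\<Sum>c\<in>C. \<Sum>c'\<in>C. cis (g c) * cis (- g c'))"
    by (simp add: sum_product cis_cnj)
  finally show ?thesis by (simp add: cis_mult)
qed

text \<open>Expanding the squares yields one fourfold sum: the phase
  \<open>G b c - G b' c - G b c' + G b' c'\<close> can be grouped by \<open>b, b'\<close> or by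
  \<open>c, c'\<close>.\<close>

lemma bilinear_sum_duality:
  fixes G :: "'b \<Rightarrow> 'c \<Rightarrow> real"
  shows "(\<Sum>b\<in>B. \<Sum>b'\<in>B. (cmod (\<Sum>c\<in>C. cis (G b c - G b' c)))\<^sup>2)
       = (\<Sum>c\<in>C. \<Sum>c'\<in>C. (cmod (\<Sum>b\<in>B. cis (G b c - G b c')))\<^sup>2)"
proof -
  have "complex_of_real (\<Sum>b\<in>B. \<Sum>b'\<in>B. (cmod (\<Sum>c\<in>C. cis (G b c - G b' c)))\<^sup>2)
      = (\<Sum>b\<in>B. \<Sum>b'\<in>B. \<Sum>c\<in>C. \<Sum>c'\<in>C. cis ((G b c - G b' c) - (G b c' - G b' c')))"
    by (simp only: of_real_sum double_sum_cis)
  also have "\<dots> = (\<Sum>b\<in>B. \<Sum>c\<in>C. \<Sum>b'\<in>B. \<Sum>c'\<in>C. cis ((G b c - G b' c) - (G b c' - G b' c')))"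
    by (rule sum.cong[OF refl], rule sum.swap)
  also have "\<dots> = (\<Sum>c\<in>C. \<Sum>b\<in>B. \<Sum>b'\<in>B. \<Sum>c'\<in>C. cis ((G b c - G b' c) - (G b c' - G b' c')))"
    by (rule sum.swap)
  also have "\<dots> = (\<Sum>c\<in>C. \<Sum>b\<in>B. \<Sum>c'\<in>C. \<Sum>b'\<in>B. cis ((G b c - G b' c) - (G b c' - G b' c')))"
    by (intro sum.cong[OF refl], rule sum.swap)
  also have "\<dots> = (\<Sum>c\<in>C. \<Sum>c'\<in>C. \<Sum>b\<in>B. \<Sum>b'\<in>B. cis ((G b c - G b' c) - (G b c' - G b' c')))"
    by (intro sum.cong[OF refl], rule sum.swap)
  also have "\<dots> = (\<Sum>c\<in>C. \<Sum>c'\<in>C. \<Sum>b\<in>B. \<Sum>b'\<in>B. cis ((G b c - G b c') - (G b' c - G b' c')))"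
    by (intro sum.cong[OF refl] arg_cong[where f = cis]) linarith
  also have "\<dots> = complex_of_real (\<Sum>c\<in>C. \<Sum>c'\<in>C. (cmod (\<Sum>b\<in>B. cis (G b c - G b c')))\<^sup>2)"
    by (simp only: of_real_sum double_sum_cis)
  finally show ?thesis by (simp only: of_real_eq_iff)
qed

text \<open>
  With \<open>e(t) = exp (2 \<pi> i t)\<close> the sum of \<open>e((b - b') A (c - c'))\<close> over boxes of side \<open>3N\<close> for \<open>b, b'\<close> and
  \<open>L\<close> for \<open>c, c'\<close> is evaluated in two ways. Every \<open>a \<in> S\<close> is \<open>b - b'\<close> for at least \<open>N\<^sup>k\<close> pairs, and the inner sum
  over \<open>c\<close> is then large because \<open>a A\<close> is nearly integral; conversely the sums over \<open>b\<close> are products of Dirichlet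
  kernels at the separated points \<open>A (c - c')\<close>.
\<close>

lemma card_bohr_set_duality:
  fixes A :: "real^'m^'k" and N L :: nat and S :: "(int^'k) set"
  assumes N: "1 \<le> N" and L: "1 \<le> L" and fin: "finite S"
    and S: "\<And>a i. a \<in> S \<Longrightarrow> \<bar>a $ i\<bar> \<le> int N"
    and near: "\<And>a. a \<in> S \<Longrightarrow> \<exists>p. infnorm (of_int_vec a v* A - of_int_vec p) \<le> \<eta>"
    and \<eta>: "real CARD('m) * (\<eta> * (real L - 1)) \<le> 1 / 6"
    and sep: "\<And>c::int^'m. c \<noteq> 0 \<Longrightarrow> infnorm (of_int_vec c) \<le> real L \<Longrightarrow>
      1 / real (3 * N) \<le> int_dist (A *v of_int_vec c)"
  shows "real (card S) * real L ^ CARD('m) \<le> 4 * 54 ^ CARD('k) * real N ^ CARD('k)"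
proof -
  define B where "B = {b::int^'k. \<forall>i. b $ i \<in> {0..<int (3 * N)}}"
  \<comment> \<open>The middle third of \<open>B\<close> in every coordinate, so that
    \<open>a + b'\<close> stays in \<open>B\<close> for every \<open>a\<close> in \<open>S\<close>;
    this supplies the \<open>N ^ CARD('k)\<close> pairs.\<close>
  define B' where "B' = {b::int^'k. \<forall>i. b $ i \<in> {int N..<int (2 * N)}}"
  define C where "C = {c::int^'m. \<forall>j. c $ j \<in> {0..<int L}}"
  have finB: "finite B" "finite B'" "finite C" unfolding B_def B'_def C_def by (rule finite_vec_box, simp)+
  have cB': "card B' = N ^ CARD('k)" unfolding B'_def by (subst card_vec_box) auto
  have cC: "card C = L ^ CARD('m)" unfolding C_def by (subst card_vec_box) auto
  define G where "G b c = 2 * pi * (of_int_vec b \<bullet> (A *v of_int_vec c))" for b :: "int^'k" and c :: "int^'m"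
  define T where "T = (\<Sum>b\<in>B. \<Sum>b'\<in>B. (cmod (\<Sum>c\<in>C. cis (G b c - G b' c)))\<^sup>2)"
  have G1: "G b c - G b' c = G (b - b') c" for b b' c
    by (simp add: G_def of_int_vec_diff inner_diff_left algebra_simps)
  have G2: "G b c - G b c' = G b (c - c')" for b c c'
    by (simp add: G_def of_int_vec_diff matrix_vector_mult_diff_distrib inner_diff_right algebra_simps)
  have big: "(real L ^ CARD('m) / 2)\<^sup>2 \<le> (cmod (\<Sum>c\<in>C. cis (G a c)))\<^sup>2" if "a \<in> S" for a
  proof -
    obtain p where p: "infnorm (of_int_vec a v* A - of_int_vec p) \<le> \<eta>" using near[OF \<open>a \<in> S\<close>] by blast
    define u where "u = of_int_vec a v* A - of_int_vec p"
    \<comment> \<open>The coordinates of \<open>c\<close> are at most \<open>L - 1\<close>, so by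
      the hypothesis on \<open>\<eta>\<close> the phase \<open>G a c\<close> is within
      \<open>pi / 3\<close> of a multiple of \<open>2 * pi\<close>, where the cosine is at least
      \<open>1 / 2\<close>.\<close>
    have "1 / 2 \<le> Re (cis (G a c))" if c: "c \<in> C" for c
    proof -
      have *: "\<bar>u \<bullet> of_int_vec c\<bar> \<le> 1 / 6"
      proof -
        have "\<bar>u \<bullet> of_int_vec c\<bar> \<le> (\<Sum>j\<in>UNIV. \<bar>u $ j\<bar> * \<bar>of_int (c $ j)\<bar>)"
          unfolding inner_vec_def by (rule order_trans[OF sum_abs]) (simp add: abs_mult)
        also have "\<dots> \<le> (\<Sum>j\<in>(UNIV::'m set). \<eta> * (real L - 1))"
        proof (intro sum_mono mult_mono)
          fix j
          show "\<bar>u $ j\<bar> \<le> \<eta>" using p by (simp add: u_def infnorm_le_iff_cart)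
          then show "0 \<le> \<eta>" by linarith
          have "0 \<le> c $ j \<and> c $ j < int L" using c by (simp add: C_def)
          then have "\<bar>c $ j\<bar> \<le> int L - 1" by auto
          then show "\<bar>real_of_int (c $ j)\<bar> \<le> real L - 1" by linarith
        qed auto
        finally show ?thesis using \<eta> by simp
      qed
      have "of_int_vec a \<bullet> (A *v of_int_vec c) = (u + of_int_vec p) \<bullet> of_int_vec c"
        by (simp add: u_def dot_lmul_matrix)
      also have "\<dots> = u \<bullet> of_int_vec c + of_int (\<Sum>j\<in>UNIV. p $ j * c $ j)"
        by (simp add: inner_vec_def distrib_right sum.distrib)
      finally have "G a c = 2 * pi * (u \<bullet> of_int_vec c) + 2 * pi * of_int (\<Sum>j\<in>UNIV. p $ j * c $ j)"
        by (simp only: G_def distrib_left)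
      then have "cos (G a c) = cos (2 * pi * (u \<bullet> of_int_vec c))"
        by (simp only: cos_add cos_int_2pin sin_int_2pin)
      also have "\<dots> = cos (\<bar>2 * pi * (u \<bullet> of_int_vec c)\<bar>)" by simp
      also have "\<dots> \<ge> cos (pi / 3)"
      proof (rule cos_monotone_0_pi_le)
        have "\<bar>2 * pi * (u \<bullet> of_int_vec c)\<bar> = 2 * pi * \<bar>u \<bullet> of_int_vec c\<bar>" by (simp add: abs_mult)
        also have "\<dots> \<le> 2 * pi * (1 / 6)" using * by (intro mult_left_mono) auto
        finally show "\<bar>2 * pi * (u \<bullet> of_int_vec c)\<bar> \<le> pi / 3" by simp
      qed auto
      finally show ?thesis by (simp add: cos_60)
    qed
    then have "(\<Sum>c\<in>C. 1 / 2) \<le> (\<Sum>c\<in>C. Re (cis (G a c)))" by (intro sum_mono) auto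
    also have "\<dots> = Re (\<Sum>c\<in>C. cis (G a c))" by simp
    also have "\<dots> \<le> cmod (\<Sum>c\<in>C. cis (G a c))" by (rule complex_Re_le_cmod)
    finally show ?thesis by (intro power_mono) (auto simp: cC)
  qed
  have "real (card S) * real N ^ CARD('k) * (real L ^ CARD('m) / 2)\<^sup>2
      = (\<Sum>x\<in>S \<times> B'. (real L ^ CARD('m) / 2)\<^sup>2)"
    by (simp add: cB' card_cartesian_product)
  also have "\<dots> \<le> (\<Sum>(a, b')\<in>S \<times> B'. (cmod (\<Sum>c\<in>C. cis (G a c)))\<^sup>2)"
    by (rule sum_mono) (auto intro: big)
  \<comment> \<open>The map from (a, b') to (a + b', b') is injective and all terms are nonnegative,
    so the pairs may be completed to all of \<open>B \<times> B\<close>.\<close>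
  also have "\<dots> = (\<Sum>(b, b')\<in>(\<lambda>(a, b'). (a + b', b')) ` (S \<times> B'). (cmod (\<Sum>c\<in>C. cis (G b c - G b' c)))\<^sup>2)"
    by (subst sum.reindex) (auto simp: inj_on_def G1 intro!: sum.cong)
  also have "\<dots> \<le> (\<Sum>(b, b')\<in>B \<times> B. (cmod (\<Sum>c\<in>C. cis (G b c - G b' c)))\<^sup>2)"
  proof (rule sum_mono2)
    show "(\<lambda>(a, b'). (a + b', b')) ` (S \<times> B') \<subseteq> B \<times> B"
    proof clarify
      fix a b' assume ab: "a \<in> S" "b' \<in> B'"
      have "0 \<le> (a + b') $ i \<and> (a + b') $ i < int (3 * N) \<and> 0 \<le> b' $ i \<and> b' $ i < int (3 * N)" for i
      proof -
        have "\<bar>a $ i\<bar> \<le> int N" "int N \<le> b' $ i" "b' $ i < int (2 * N)"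
          using S[OF ab(1), of i] ab(2) by (auto simp: B'_def)
        then show ?thesis using N by auto
      qed
      then show "a + b' \<in> B \<and> b' \<in> B" by (simp add: B_def)
    qed
  qed (use finB in auto)
  also have "\<dots> = T" by (simp add: T_def sum.cartesian_product)
  also have "T = (\<Sum>c'\<in>C. \<Sum>c\<in>C. (cmod (\<Sum>b\<in>B. cis (G b c - G b c')))\<^sup>2)"
    unfolding T_def by (subst bilinear_sum_duality, rule sum.swap)
  also have "\<dots> \<le> (\<Sum>c'\<in>C. (6 * (real (3 * N))\<^sup>2) ^ CARD('k))"
  proof (rule sum_mono)
    fix c' assume c': "c' \<in> C"
    \<comment> \<open>With \<open>c'\<close> fixed, these points are separated by
      \<open>sep\<close>, because differences of elements of \<open>C\<close> have norm at most
      \<open>L\<close>.\<close>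
    define x where "x c = A *v of_int_vec (c - c')" for c
    have "(\<Sum>c\<in>C. (cmod (\<Sum>b\<in>B. cis (G b c - G b c')))\<^sup>2)
        = (\<Sum>c\<in>C. \<Prod>i\<in>UNIV. (cmod (\<Sum>l\<in>{0..<int (3 * N)}. cis (2 * pi * (of_int l * x c $ i))))\<^sup>2)"
    proof (rule sum.cong[OF refl])
      fix c
      have "cis (G b c - G b c') = (\<Prod>i\<in>UNIV. cis (2 * pi * (of_int (b $ i) * x c $ i)))" for b
        unfolding G2 cis_conv_exp by (simp add: G_def x_def inner_vec_def exp_sum[symmetric] sum_distrib_left)
      then have "(\<Sum>b\<in>B. cis (G b c - G b c'))
          = (\<Prod>i\<in>UNIV. \<Sum>l\<in>{0..<int (3 * N)}. cis (2 * pi * (of_int l * x c $ i)))"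
        unfolding B_def by (simp add: sum_prod_vec[of "{0..<int (3 * N)}" "\<lambda>i l. cis (2 * pi * (of_int l * x c $ i))", simplified])
      then show "(cmod (\<Sum>b\<in>B. cis (G b c - G b c')))\<^sup>2
          = (\<Prod>i\<in>UNIV. (cmod (\<Sum>l\<in>{0..<int (3 * N)}. cis (2 * pi * (of_int l * x c $ i))))\<^sup>2)"
        by (simp add: prod_norm[symmetric] prod_power_distrib)
    qed
    also have "\<dots> \<le> (6 * (real (3 * N))\<^sup>2) ^ CARD('k)"
    proof (rule sum_dirichlet_kernels_separated)
      fix c c'' assume c: "c \<in> C" "c'' \<in> C" "c \<noteq> c''"
      have "x c - x c'' = A *v of_int_vec (c - c'')"
        by (simp add: x_def matrix_vector_mult_diff_distrib[symmetric] of_int_vec_diff)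
      moreover have "infnorm (of_int_vec (c - c'')) \<le> real L"
        unfolding infnorm_le_iff_cart
      proof
        fix j
        have "0 \<le> c $ j \<and> c $ j < int L" "0 \<le> c'' $ j \<and> c'' $ j < int L"
          using c by (simp_all add: C_def)
        then have "\<bar>c $ j - c'' $ j\<bar> \<le> int L" by auto
        then show "\<bar>of_int_vec (c - c'') $ j\<bar> \<le> real L" by simp
      qed
      ultimately show "1 / real (3 * N) \<le> int_dist (x c - x c'')" using sep[of "c - c''"] c by simp
    qed (use finB N in auto)
    finally show "(\<Sum>c\<in>C. (cmod (\<Sum>b\<in>B. cis (G b c - G b c')))\<^sup>2) \<le> (6 * (real (3 * N))\<^sup>2) ^ CARD('k)" .
  qed
  also have "\<dots> = real L ^ CARD('m) * (54 ^ CARD('k) * real N ^ CARD('k) * real N ^ CARD('k))"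
  proof -
    have "6 * (real (3 * N))\<^sup>2 = 54 * real N * real N" by (simp add: power2_eq_square)
    then show ?thesis by (simp add: cC power_mult_distrib)
  qed
  \<comment> \<open>The 54 is \<open>6 * 3^2\<close>, from kernels of length \<open>3 * N\<close>;
    the 4 undoes the square of the factor \<open>1 / 2\<close> in \<open>big\<close>.\<close>
  finally have "(real (card S) * real L ^ CARD('m)) * (real N ^ CARD('k) * real L ^ CARD('m))
      \<le> (4 * 54 ^ CARD('k) * real N ^ CARD('k)) * (real N ^ CARD('k) * real L ^ CARD('m))"
    by (simp add: power2_eq_square mult_ac)
  then show ?thesis
    by (rule mult_right_le_imp_le) (use N L in auto)
qed

lemma card_bohr_set_exponent:
  fixes A :: "real^'m^'k"
  assumes w: "dioph_exponent A < ereal w" "0 < w"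
  obtains C where "0 < C"
    "\<And>R K. \<lbrakk>1 \<le> R; 1 \<le> K\<rbrakk> \<Longrightarrow>
      real (card (bohr_set A R (1 / K))) \<le> C * (R + K powr w) ^ CARD('k) * K powr (- real CARD('m))"
proof -
  obtain c where c: "0 < c" "c \<le> 1" "\<And>q. q \<noteq> 0 \<Longrightarrow>
      c * infnorm (of_int_vec q) powr (- w) \<le> int_dist (A *v of_int_vec q)"
    using dioph_exponent_lower_bound[OF w] by metis
  define m where "m = real CARD('m)"
  have m: "1 \<le> m" by (simp add: m_def Suc_le_eq)
  define C1 where "C1 = 2 powr w / c + 2"
  have C1: "0 < C1" using c by (auto simp: C1_def intro!: add_nonneg_pos)
  define C where "C = 4 * 54 ^ CARD('k) * C1 ^ CARD('k) * (6 * m) ^ CARD('m)"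
  show ?thesis
  proof (rule that)
    show "0 < C" using C1 m by (simp add: C_def)
    fix R K :: real assume R: "1 \<le> R" and K: "1 \<le> K"
    \<comment> \<open>\<open>L\<close> is as large as the width permits, with
      \<open>m * (L - 1) / K \<le> 1 / 6\<close>. \<open>N\<close> must contain the box of radius
      \<open>R\<close> and also resolve the separation \<open>c * (2 * K) powr (- w)\<close> of the
      dual points, which is the source of the sum \<open>R + K powr w\<close>.\<close>
    define L where "L = nat \<lfloor>K / (6 * m)\<rfloor> + 1"
    define N where "N = nat \<lceil>R + (2 * K) powr w / c\<rceil>"
    have Km: "0 \<le> K / (6 * m)" "K / (6 * m) \<le> K" using K m by (auto simp: field_simps)
    have L: "1 \<le> L" "real L - 1 \<le> K / (6 * m)" "K / (6 * m) \<le> real L" "real L \<le> 2 * K"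
      using Km K unfolding L_def by (auto simp: of_nat_nat; linarith)+
    have pc: "0 < (2 * K) powr w / c" using c K by auto
    have N: "R \<le> real N" "(2 * K) powr w / c \<le> real N" "real N \<le> R + (2 * K) powr w / c + 1"
      using R pc unfolding N_def by (auto simp: of_nat_nat; linarith)+
    have "real (card (bohr_set A R (1 / K))) * real L ^ CARD('m) \<le> 4 * 54 ^ CARD('k) * real N ^ CARD('k)"
    proof (rule card_bohr_set_duality)
      show "1 \<le> N" using N R by linarith
      show "1 \<le> L" by (rule L)
      fix a i assume "a \<in> bohr_set A R (1 / K)"
      then have "\<bar>real_of_int (a $ i)\<bar> \<le> real N"
        using N(1) by (auto simp: bohr_set_def infnorm_le_iff_cart intro: order_trans)
      then show "\<bar>a $ i\<bar> \<le> int N" by linarith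
    next
      fix a assume "a \<in> bohr_set A R (1 / K)"
      then show "\<exists>p. infnorm (of_int_vec a v* A - of_int_vec p) \<le> 1 / K"
        by (auto simp: bohr_set_def int_dist_less_iff intro: less_imp_le)
    next
      have "m * (1 / K * (real L - 1)) \<le> m * (1 / K * (K / (6 * m)))"
        using L m K by (intro mult_left_mono) auto
      then show "real CARD('m) * (1 / K * (real L - 1)) \<le> 1 / 6"
        using m K by (simp add: m_def[symmetric])
    next
      fix q :: "int^'m" assume q: "q \<noteq> 0" "infnorm (of_int_vec q) \<le> real L"
      have "1 / real (3 * N) \<le> 1 / ((2 * K) powr w / c)"
        using N pc by (intro divide_left_mono mult_pos_pos) auto
      also have "\<dots> = c * (2 * K) powr (- w)" by (simp add: powr_minus field_simps)
      also have "\<dots> \<le> c * infnorm (of_int_vec q) powr (- w)"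
        using c w q L infnorm_of_int_vec_ge_1[of q] by (intro mult_left_mono powr_mono2') auto
      also have "\<dots> \<le> int_dist (A *v of_int_vec q)" using q by (intro c) auto
      finally show "1 / real (3 * N) \<le> int_dist (A *v of_int_vec q)" .
    qed simp
    also have "\<dots> \<le> 4 * 54 ^ CARD('k) * (C1 * (R + K powr w)) ^ CARD('k)"
    proof (intro mult_left_mono power_mono)
      have "real N \<le> 2 * R + 2 powr w / c * K powr w"
        using N R K by (simp add: powr_mult)
      also have "\<dots> \<le> C1 * (R + K powr w)"
      proof -
        have "0 \<le> 2 powr w / c * R" "0 \<le> K powr w" using c R by auto
        then show ?thesis unfolding C1_def distrib_left distrib_right by linarith
      qed
      finally show "real N \<le> C1 * (R + K powr w)" .
    qed auto
    finally have *: "real (card (bohr_set A R (1 / K))) * real L ^ CARD('m)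
        \<le> 4 * 54 ^ CARD('k) * (C1 * (R + K powr w)) ^ CARD('k)" .
    have "real (card (bohr_set A R (1 / K))) * (K / (6 * m)) ^ CARD('m)
        \<le> real (card (bohr_set A R (1 / K))) * real L ^ CARD('m)"
      using L Km by (intro mult_left_mono power_mono) auto
    with * have "real (card (bohr_set A R (1 / K))) * (K / (6 * m)) ^ CARD('m)
        \<le> 4 * 54 ^ CARD('k) * (C1 * (R + K powr w)) ^ CARD('k)" by linarith
    then have "real (card (bohr_set A R (1 / K)))
        \<le> 4 * 54 ^ CARD('k) * (C1 * (R + K powr w)) ^ CARD('k) / (K / (6 * m)) ^ CARD('m)"
      using K m by (subst pos_le_divide_eq) auto
    also have "\<dots> = C * (R + K powr w) ^ CARD('k) * K powr (- real CARD('m))"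
    proof -
      have "(K / (6 * m)) ^ CARD('m) = K powr real CARD('m) / (6 * m) ^ CARD('m)"
        using K by (simp add: power_divide powr_realpow)
      moreover have "(C1 * (R + K powr w)) ^ CARD('k) = C1 ^ CARD('k) * (R + K powr w) ^ CARD('k)"
        by (rule power_mult_distrib)
      ultimately show ?thesis by (simp only: C_def powr_minus divide_inverse inverse_mult_distrib inverse_inverse_eq mult_ac)
    qed
    finally show "real (card (bohr_set A R (1 / K))) \<le> C * (R + K powr w) ^ CARD('k) * K powr (- real CARD('m))" .
  qed
qed

text \<open>Beyond \<open>K = R powr (1 / w)\<close> the term \<open>K powr w\<close> would exceed
  \<open>R\<close>. A smaller \<open>K\<close> only enlarges the Bohr set, so \<open>K\<close> is
  replaced by \<open>min K (R powr (1 / w))\<close>; the last summand is the level at which the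
  bound then stays.\<close>

lemma card_bohr_set_exponent':
  fixes A :: "real^'m^'k"
  assumes w: "dioph_exponent A < ereal w" "0 < w"
  obtains C where "0 < C"
    "\<And>R K. \<lbrakk>1 \<le> R; 1 \<le> K\<rbrakk> \<Longrightarrow> real (card (bohr_set A R (1 / K)))
      \<le> C * R ^ CARD('k) * (K powr (- real CARD('m)) + R powr (- real CARD('m) / w))"
proof -
  obtain C where C: "0 < C" "\<And>R K. \<lbrakk>1 \<le> R; 1 \<le> K\<rbrakk> \<Longrightarrow>
      real (card (bohr_set A R (1 / K))) \<le> C * (R + K powr w) ^ CARD('k) * K powr (- real CARD('m))"
    using card_bohr_set_exponent[OF w] by metis
  show ?thesis
  proof (rule that)
    show "0 < C * 2 ^ CARD('k)" using C by simp
    fix R K :: real assume R: "1 \<le> R" and K: "1 \<le> K"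
    define K' where "K' = min K (R powr (1 / w))"
    have K': "1 \<le> K'" "K' \<le> K" using R K w by (auto simp: K'_def ge_one_powr_ge_zero)
    have "K' powr w \<le> (R powr (1 / w)) powr w"
      using K' w by (intro powr_mono2) (auto simp: K'_def)
    also have "\<dots> = R" using w R by (simp add: powr_powr)
    finally have Kw: "K' powr w \<le> R" .
    have "real (card (bohr_set A R (1 / K))) \<le> real (card (bohr_set A R (1 / K')))"
      using K' by (intro of_nat_mono card_mono bohr_set_mono divide_left_mono) auto
    also have "\<dots> \<le> C * (R + K' powr w) ^ CARD('k) * K' powr (- real CARD('m))"
      by (rule C(2)[OF R K'(1)])
    also have "\<dots> \<le> C * (2 * R) ^ CARD('k) * (K powr (- real CARD('m)) + R powr (- real CARD('m) / w))"
    proof (intro mult_mono power_mono)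
      show "K' powr (- real CARD('m)) \<le> K powr (- real CARD('m)) + R powr (- real CARD('m) / w)"
        unfolding K'_def by (auto simp: min_def powr_powr)
    qed (use C R Kw in auto)
    finally show "real (card (bohr_set A R (1 / K)))
        \<le> C * 2 ^ CARD('k) * R ^ CARD('k) * (K powr (- real CARD('m)) + R powr (- real CARD('m) / w))"
      by (simp add: power_mult_distrib)
  qed
qed

subsection \<open>Hausdorff null sets\<close>

lemma hausdorff_measure_eq_0I:
  assumes "\<And>\<delta> e. \<lbrakk>0 < \<delta>; 0 < e\<rbrakk> \<Longrightarrow> \<exists>U :: nat \<Rightarrow> 'a::metric_space set. S \<subseteq> (\<Union>i. U i) \<and>
      (\<forall>i. bounded (U i) \<and> diameter (U i) \<le> \<delta>) \<and> (\<Sum>i. hausdorff_weight s (U i)) \<le> ennreal e"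
  shows "hausdorff_measure s S = 0"
proof -
  have "hausdorff_premeasure s \<delta> S \<le> 0" if "0 < \<delta>" for \<delta>
  proof (rule ennreal_le_epsilon)
    fix e :: real assume "0 < e"
    then obtain U where U: "S \<subseteq> (\<Union>i. U i)" "\<forall>i. bounded (U i) \<and> diameter (U i) \<le> \<delta>"
      "(\<Sum>i. hausdorff_weight s (U i)) \<le> ennreal e"
      using assms[OF \<open>0 < \<delta>\<close>] by blast
    have "hausdorff_premeasure s \<delta> S \<le> (\<Sum>i. hausdorff_weight s (U i))"
      unfolding hausdorff_premeasure_def by (rule INF_lower) (use U in auto)
    with U show "hausdorff_premeasure s \<delta> S \<le> 0 + ennreal e" by auto
  qed
  then have "hausdorff_measure s S \<le> 0"
    unfolding hausdorff_measure_def by (intro SUP_least) auto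
  then show ?thesis by simp
qed

text \<open>The convergence half of the Borel-Cantelli argument: every tail of the families covers
  \<open>E\<close>, and the tails of a convergent series are small.\<close>

lemma hausdorff_measure_limsup_eq_0:
  fixes V :: "nat \<Rightarrow> 'i \<Rightarrow> 'a::metric_space set"
  assumes s: "0 < s" and fin: "\<And>j. finite (I j)"
    and V: "\<And>j i. i \<in> I j \<Longrightarrow> bounded (V j i) \<and> diameter (V j i) \<le> r j"
    and E: "\<And>y. y \<in> E \<Longrightarrow> \<exists>\<^sub>\<infinity>j. \<exists>i\<in>I j. y \<in> V j i"
    and r: "\<And>j. 0 \<le> r j" "r \<longlonglongrightarrow> 0" and sm: "summable (\<lambda>j. real (card (I j)) * r j powr s)"
  shows "hausdorff_measure s E = 0"
proof (rule hausdorff_measure_eq_0I)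
  fix \<delta> e :: real assume \<delta>: "0 < \<delta>" and e: "0 < e"
  define c where "c j = real (card (I j)) * r j powr s" for j
  have c0: "0 \<le> c j" for j by (simp add: c_def)
  have "eventually (\<lambda>J. (\<Sum>j. c (j + J)) < e) sequentially"
    using suminf_exist_split2[OF sm] e by (auto simp: c_def dest: order_tendstoD)
  moreover have "eventually (\<lambda>J. \<forall>j\<ge>J. r j < \<delta>) sequentially"
    using order_tendstoD(2)[OF r(2) \<delta>] by (simp add: eventually_all_ge_at_top)
  ultimately have "eventually (\<lambda>J. (\<Sum>j. c (j + J)) < e \<and> (\<forall>j\<ge>J. r j < \<delta>)) sequentially"
    by (rule eventually_conj)
  then obtain J where J: "(\<Sum>j. c (j + J)) < e" "\<And>j. J \<le> j \<Longrightarrow> r j < \<delta>"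
    by (metis (mono_tags, lifting) eventually_happens trivial_limit_sequentially)
  have "\<forall>j. \<exists>g. bij_betw g {..<card (I j)} (I j)"
    using ex_bij_betw_nat_finite[OF fin] by (simp add: lessThan_atLeast0)
  then obtain g where g: "\<And>j. bij_betw (g j) {..<card (I j)} (I j)" by metis
  \<comment> \<open>A double sequence padded with empty sets, whose weight is 0 by definition, so
    that \<open>prod_decode\<close> lists all sets of the tail as one sequence.\<close>
  define W where "W p = (case p of (j, i) \<Rightarrow> if i < card (I (j + J)) then V (j + J) (g (j + J) i) else {})" for p
  have gI: "g j i \<in> I j" if "i < card (I j)" for i j
    using bij_betwE[OF g[of j]] that by auto
  define U where "U n = W (prod_decode n)" for n
  show "\<exists>U. E \<subseteq> (\<Union>i. U i) \<and> (\<forall>i. bounded (U i) \<and> diameter (U i) \<le> \<delta>) \<and>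
      (\<Sum>i. hausdorff_weight s (U i)) \<le> ennreal e"
  proof (intro exI[of _ U] conjI allI)
    show "E \<subseteq> (\<Union>i. U i)"
    proof
      fix y assume "y \<in> E"
      then obtain j i where ji: "J \<le> j" "i \<in> I j" "y \<in> V j i"
        using E[of y] unfolding INFM_nat_le by blast
      then obtain k where k: "k < card (I j)" "g j k = i"
        using g[of j] unfolding bij_betw_def by (metis imageE lessThan_iff)
      have "y \<in> W (j - J, k)" using ji k by (simp add: W_def)
      then have "y \<in> U (prod_encode (j - J, k))" by (simp add: U_def)
      then show "y \<in> (\<Union>i. U i)" by blast
    qed
    show "bounded (U n)" "diameter (U n) \<le> \<delta>" for n
    proof -
      obtain j i where ji: "prod_decode n = (j, i)" by fastforce
      show "bounded (U n)" using V gI by (auto simp: U_def W_def ji)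
      show "diameter (U n) \<le> \<delta>" using V[OF gI] \<delta> J(2)[of "j + J"]
        by (force simp: U_def W_def ji)
    qed
    have "(\<Sum>n. hausdorff_weight s (U n)) = (\<Sum>j. \<Sum>i. hausdorff_weight s (W (j, i)))"
      unfolding U_def
      by (rule suminf_ennreal_2dimen[of _ "\<lambda>p. hausdorff_weight s (W p)"]) (rule refl)
    also have "\<dots> \<le> (\<Sum>j. ennreal (c (j + J)))"
    proof (intro suminf_le summableI)
      fix j
      have "(\<Sum>i. hausdorff_weight s (W (j, i))) = (\<Sum>i<card (I (j + J)). hausdorff_weight s (W (j, i)))"
        by (rule suminf_finite) (auto simp: W_def hausdorff_weight_def)
      also have "\<dots> \<le> (\<Sum>i<card (I (j + J)). ennreal (r (j + J) powr s))"
      proof (rule sum_mono)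
        fix i assume "i \<in> {..<card (I (j + J))}"
        then have "bounded (W (j, i))" "diameter (W (j, i)) \<le> r (j + J)"
          using V gI by (auto simp: W_def)
        then show "hausdorff_weight s (W (j, i)) \<le> ennreal (r (j + J) powr s)"
          using s by (auto simp: hausdorff_weight_def intro!: ennreal_leI powr_mono2 diameter_ge_0)
      qed
      also have "\<dots> = ennreal (c (j + J))"
        by (simp add: c_def ennreal_mult ennreal_of_nat_eq_real_of_nat)
      finally show "(\<Sum>i. hausdorff_weight s (W (j, i))) \<le> ennreal (c (j + J))" .
    qed
    also have "\<dots> = ennreal (\<Sum>j. c (j + J))"
      using sm by (intro suminf_ennreal2) (auto simp: c0 c_def[symmetric] summable_iff_shift)
    also have "\<dots> \<le> ennreal e" using J by (intro ennreal_leI) auto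
    finally show "(\<Sum>n. hausdorff_weight s (U n)) \<le> ennreal e" .
  qed
qed

lemma hausdorff_dim_leI:
  assumes "0 \<le> b" "\<And>s. b < s \<Longrightarrow> hausdorff_measure s S = 0"
  shows "hausdorff_dim S \<le> ereal b"
proof (rule ereal_le_epsilon2)
  fix e :: real assume "0 < e"
  have "hausdorff_dim S \<le> ereal (b + e)"
    unfolding hausdorff_dim_def
    by (rule INF_lower2[of "b + e"]) (use assms \<open>0 < e\<close> in auto)
  then show "hausdorff_dim S \<le> ereal b + ereal e" by simp
qed

subsection \<open>The parametrisation of the affine subspace\<close>

text \<open>The leading entry is 1 for points of the parameter space, the denominator
  \<open>q\<close> for integer vectors, and 0 for differences, on which \<open>A\<close> acts
  linearly.\<close>

definition opt_vec :: "'a \<Rightarrow> 'a ^ 'd::finite \<Rightarrow> 'a ^ 'd option" where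
  "opt_vec t v = (\<chi> k. case k of None \<Rightarrow> t | Some i \<Rightarrow> v $ i)"

lemma opt_vec_nth [simp]: "opt_vec t v $ None = t" "opt_vec t v $ Some i = v $ i"
  by (simp_all add: opt_vec_def)

lemma vec_eq_iff_option: "u = v \<longleftrightarrow> u $ None = v $ None \<and> (\<forall>i. u $ Some i = v $ Some i)"
  unfolding vec_eq_iff by (metis not_None_eq)

lemma extend_one_eq: "extend_one x = opt_vec 1 x"
  by (simp add: extend_one_def opt_vec_def)

lemma join_vec_nth [simp]: "join_vec x y $ Inl i = x $ i" "join_vec x y $ Inr j = y $ j"
  by (simp_all add: join_vec_def)

lemma vec_eq_iff_sum: "u = v \<longleftrightarrow> (\<forall>i. u $ Inl i = v $ Inl i) \<and> (\<forall>j. u $ Inr j = v $ Inr j)"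
  unfolding vec_eq_iff by (metis sum.exhaust)

lemma infnorm_less_iff_sum:
  "infnorm (u :: real^('d::finite + 'm::finite)) < t \<longleftrightarrow> (\<forall>i. \<bar>u $ Inl i\<bar> < t) \<and> (\<forall>j. \<bar>u $ Inr j\<bar> < t)"
  unfolding infnorm_less_iff_cart by (metis sum.exhaust)

definition affine_param :: "real ^ 'm::finite ^ ('d::finite) option \<Rightarrow> real ^ 'd \<Rightarrow> real ^ ('d + 'm)" where
  "affine_param A x = join_vec x (extend_one x v* A)"

lemma affine_subspace_eq: "affine_subspace A = range (affine_param A)"
  by (auto simp: affine_subspace_def affine_param_def)

lemma linear_infnorm_bound:
  fixes f :: "real^'a \<Rightarrow> real^'b"
  assumes "linear f"
  obtains B where "0 < B" "\<And>x. infnorm (f x) \<le> B * infnorm x"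
proof -
  obtain B where B: "0 < B" "\<And>x. norm (f x) \<le> B * norm x"
    using linear_bounded_pos[OF assms] by blast
  show ?thesis
  proof (rule that)
    show "0 < B * real CARD('a)" using B by simp
    fix x
    have "infnorm (f x) \<le> norm (f x)" by (rule infnorm_le_norm)
    also have "\<dots> \<le> B * norm x" by (rule B)
    also have "\<dots> \<le> B * (real CARD('a) * infnorm x)"
      using B by (intro mult_left_mono norm_le_card_infnorm) auto
    finally show "infnorm (f x) \<le> B * real CARD('a) * infnorm x" by (simp add: mult.assoc)
  qed
qed

lemma linear_opt_vec_0: "linear (\<lambda>v::real^'d. opt_vec 0 v v* (A :: real^'m^'d option))"
proof (rule linearI)
  fix x y :: "real^'d" and c :: real
  have "opt_vec 0 (x + y) = opt_vec 0 x + opt_vec 0 y" "opt_vec 0 (c *\<^sub>R x) = c *\<^sub>R opt_vec 0 x"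
    by (simp_all add: vec_eq_iff_option)
  then show "opt_vec 0 (x + y) v* A = opt_vec 0 x v* A + opt_vec 0 y v* A"
    "opt_vec 0 (c *\<^sub>R x) v* A = c *\<^sub>R (opt_vec 0 x v* A)"
    by (simp_all add: vector_matrix_left_distrib scaleR_vector_matrix_assoc)
qed

lemma affine_param_diff:
  "affine_param A x - affine_param A x' = join_vec (x - x') (opt_vec 0 (x - x') v* A)"
proof -
  have "extend_one x - extend_one x' = opt_vec 0 (x - x')"
    by (simp add: vec_eq_iff_option extend_one_eq)
  then have "extend_one x v* A - extend_one x' v* A = opt_vec 0 (x - x') v* A"
    by (simp add: vector_matrix_mult_diff_distrib[symmetric])
  then show ?thesis
    by (simp add: vec_eq_iff_sum affine_param_def vec_eq_iff[of "_ - _" "opt_vec _ _ v* A"])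
qed

lemma affine_param_lipschitz:
  fixes A :: "real^'m::finite^('d::finite) option"
  obtains B where "0 < B" "\<And>x x'. dist (affine_param A x) (affine_param A x') \<le> B * infnorm (x - x')"
proof -
  have "linear (\<lambda>v. join_vec v (opt_vec 0 v v* A))"
    using linear_opt_vec_0[of A] by (auto simp: linear_iff vec_eq_iff_sum)
  then obtain B where B: "0 < B" "\<And>v. norm (join_vec v (opt_vec 0 v v* A)) \<le> B * norm v"
    using linear_bounded_pos by blast
  show ?thesis
  proof (rule that)
    show "0 < B * real CARD('d)" using B by simp
    fix x x'
    have "dist (affine_param A x) (affine_param A x') \<le> B * norm (x - x')"
      unfolding dist_norm affine_param_diff by (rule B)
    also have "\<dots> \<le> B * (real CARD('d) * infnorm (x - x'))"
      using B by (intro mult_left_mono) (auto simp: norm_le_card_infnorm)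
    finally show "dist (affine_param A x) (affine_param A x') \<le> B * real CARD('d) * infnorm (x - x')"
      by (simp add: mult.assoc)
  qed
qed

text \<open>Forgetting the last coordinates does not increase distances. In the lower bound this
  pulls a cover of the subspace back to the parameter space without increasing diameters.\<close>

lemma affine_param_dist_ge: "dist x x' \<le> dist (affine_param A x) (affine_param A x')"
proof -
  have "norm (x - x') \<le> norm (join_vec (x - x') (opt_vec 0 (x - x') v* A))"
    unfolding norm_vec_def L2_set_def
    by (simp add: sum.Plus UNIV_Plus_UNIV[symmetric] sum_nonneg del: UNIV_Plus_UNIV)
  then show ?thesis by (simp add: dist_norm affine_param_diff)
qed

text \<open>Subtract one fixed element \<open>b\<close> of \<open>S\<close> from all of them: the
  shift \<open>\<beta>\<close> cancels, and the halves of \<open>R\<close> and \<open>\<psi>\<close>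
  add up.\<close>

lemma card_inhomogeneous_bohr_le:
  fixes A :: "real^'m^'k"
  assumes S_def: "S = {a. infnorm (of_int_vec a) \<le> R / 2 \<and> int_dist (of_int_vec a v* A - \<beta>) < \<psi> / 2}"
  shows "finite S" and "card S \<le> card (bohr_set A R \<psi>)"
proof -
  show fin: "finite S" unfolding S_def
    by (rule finite_subset[OF _ finite_int_vec_ball[of "R / 2"]]) auto
  show "card S \<le> card (bohr_set A R \<psi>)"
  proof (cases "S = {}")
    case False
    then obtain b where b: "b \<in> S" by blast
    show ?thesis
    proof (rule card_inj_on_le[of "\<lambda>a. a - b"])
      show "(\<lambda>a. a - b) ` S \<subseteq> bohr_set A R \<psi>"
      proof clarify
        fix a assume a: "a \<in> S"
        have "infnorm (of_int_vec a + - of_int_vec b) \<le> infnorm (of_int_vec a) + infnorm (- of_int_vec b)"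
          by (rule infnorm_triangle)
        then have "infnorm (of_int_vec (a - b)) \<le> R"
          using a b by (simp add: infnorm_neg S_def of_int_vec_diff)
        moreover have "of_int_vec (a - b) v* A = (of_int_vec a v* A - \<beta>) - (of_int_vec b v* A - \<beta>)"
          by (simp add: of_int_vec_diff vector_matrix_mult_diff_distrib)
        then have "int_dist (of_int_vec (a - b) v* A) < \<psi>"
          using int_dist_diff[of "of_int_vec a v* A - \<beta>" "of_int_vec b v* A - \<beta>"] a b by (simp add: S_def)
        ultimately show "a - b \<in> bohr_set A R \<psi>" by (simp add: bohr_set_def)
      qed
    qed (auto simp: inj_on_def)
  qed simp
qed

subsection \<open>Covering the approximable points\<close>

lemma int_dist_affine_param_less:
  assumes "int_dist (real q *\<^sub>R affine_param A x - \<theta>) < t"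
  obtains p r where
    "\<And>i. \<bar>real q * x $ i - \<theta> $ Inl i - of_int (p $ i)\<bar> < t"
    "\<And>j. \<bar>real q * (extend_one x v* A) $ j - \<theta> $ Inr j - of_int (r $ j)\<bar> < t"
proof -
  obtain P where P: "infnorm (real q *\<^sub>R affine_param A x - \<theta> - of_int_vec P) < t"
    using assms unfolding int_dist_less_iff by blast
  show ?thesis
    by (rule that[of "\<chi> i. P $ Inl i" "\<chi> j. P $ Inr j"])
       (use P in \<open>simp_all add: infnorm_less_iff_sum affine_param_def\<close>)
qed

lemma eventually_le_power:
  fixes a c :: real
  assumes "1 < a"
  shows "eventually (\<lambda>j. c \<le> a ^ j) sequentially"
proof -
  obtain n where n: "c < a ^ n" using real_arch_pow[OF assms] by blast
  show ?thesis
  proof (rule eventually_sequentiallyI)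
    fix j assume "n \<le> j"
    then have "a ^ n \<le> a ^ j" using assms by (intro power_increasing) auto
    with n show "c \<le> a ^ j" by simp
  qed
qed

text \<open>Sort the denominators \<open>q\<close> by powers of 2. For \<open>q\<close> near
  \<open>2 ^ j\<close> there are at most about \<open>R j powr e\<close> vectors \<open>a\<close>,
  each accounting for a set of diameter about \<open>2 powr (- (1 + \<tau>) * j)\<close>, so the
  \<open>s\<close>-sums are dominated by a convergent geometric series. The slack in
  \<open>\<tau>' < \<tau>\<close> and in \<open>e < s * (1 + \<tau>)\<close> pays for constants,
  some of which depend on the point being covered.\<close>

lemma hausdorff_measure_approximable_eq_0:
  fixes A :: "real^'m::finite^('d::finite) option" and \<theta> :: "real^('d + 'm)"
  assumes \<tau>: "0 \<le> \<tau>" "\<tau>' < \<tau>" and s: "0 < s" "e < s * (1 + \<tau>)"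
    and C: "0 < C" "\<And>R. 1 \<le> R \<Longrightarrow> real (card (bohr_set A R (R powr (- \<tau>')))) \<le> C * R powr e"
  shows "hausdorff_measure s (approximable \<tau> \<theta> \<inter> affine_subspace A) = 0"
proof -
  have "eventually (\<lambda>\<epsilon>::real. (1 + \<epsilon>) * e < s * (1 + \<tau>)) (at_right 0)"
    by (rule order_tendstoD(2)[where y = "(1 + 0) * e"]) (auto intro!: tendsto_eq_intros simp: s)
  moreover have "eventually (\<lambda>\<epsilon>::real. (1 + \<epsilon>) * \<tau>' < \<tau>) (at_right 0)"
    by (rule order_tendstoD(2)[where y = "(1 + 0) * \<tau>'"]) (auto intro!: tendsto_eq_intros simp: \<tau>)
  moreover have "eventually (\<lambda>\<epsilon>::real. 0 < \<epsilon>) (at_right 0)" by (rule eventually_at_right_less)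
  ultimately have "eventually (\<lambda>\<epsilon>::real. (1 + \<epsilon>) * e < s * (1 + \<tau>) \<and> (1 + \<epsilon>) * \<tau>' < \<tau> \<and> 0 < \<epsilon>) (at_right 0)"
    by (intro eventually_conj)
  then obtain \<epsilon> :: real where \<epsilon>: "(1 + \<epsilon>) * e < s * (1 + \<tau>)" "(1 + \<epsilon>) * \<tau>' < \<tau>" "0 < \<epsilon>"
    using eventually_happens'[OF trivial_limit_at_right_real] by blast
  obtain \<Lambda> where \<Lambda>: "0 < \<Lambda>" "\<And>v::real^'d. infnorm (opt_vec 0 v v* A) \<le> \<Lambda> * infnorm v"
    using linear_infnorm_bound[OF linear_opt_vec_0] by blast
  obtain B where B: "0 < B" "\<And>x x'. dist (affine_param A x) (affine_param A x') \<le> B * infnorm (x - x')"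
    using affine_param_lipschitz[where A = A] by blast
  define \<theta>1 where "\<theta>1 = (\<chi> i. \<theta> $ Inl i)"
  define \<theta>2 where "\<theta>2 = (\<chi> j. \<theta> $ Inr j)"
  \<comment> \<open>The target of \<open>a v* A\<close>: the vector \<open>p\<close> approximates
    \<open>q x - \<theta>1\<close>, and the last coordinates of \<open>q y\<close> are to be near
    \<open>\<theta>2\<close> modulo 1, so the part of \<open>\<theta>\<close> seen through
    \<open>A\<close> is subtracted.\<close>
  define \<beta> where "\<beta> = \<theta>2 - opt_vec 0 \<theta>1 v* A"
  \<comment> \<open>The exponent \<open>1 + \<epsilon>\<close> in place of 1 lets \<open>R j\<close>
    outgrow every fixed multiple of \<open>2 ^ j\<close>, so the whole unbounded subspace is covered
    at once.\<close>
  define R where "R j = 2 powr ((1 + \<epsilon>) * real j)" for j :: nat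
  have R1: "1 \<le> R j" for j using \<epsilon> by (simp add: R_def ge_one_powr_ge_zero)
  define I where "I j = {a. infnorm (of_int_vec a) \<le> R j / 2 \<and>
    int_dist (of_int_vec a v* A - \<beta>) < R j powr (- \<tau>') / 2}" for j
  define V where "V j a = {y. \<exists>q x. y = affine_param A x \<and> 2 ^ j \<le> q \<and> int q = a $ None \<and>
    (\<forall>i. \<bar>real q * x $ i - \<theta> $ Inl i - of_int (a $ Some i)\<bar> < real q powr (- \<tau>))}"
    for j :: nat and a
  define r where "r j = B * (2 * 2 powr (- (1 + \<tau>) * real j))" for j :: nat
  have fin: "finite (I j)" and card: "real (card (I j)) \<le> C * R j powr e" for j
  proof -
    show "finite (I j)" unfolding I_def by (rule card_inhomogeneous_bohr_le(1)[OF refl])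
    have "card (I j) \<le> card (bohr_set A (R j) (R j powr (- \<tau>')))"
      unfolding I_def by (rule card_inhomogeneous_bohr_le(2)[OF refl])
    then show "real (card (I j)) \<le> C * R j powr e" using C(2)[OF R1[of j]] by linarith
  qed
  show ?thesis
  proof (rule hausdorff_measure_limsup_eq_0[where V = V and I = I and r = r])
    show "0 < s" by (rule s)
    show "finite (I j)" for j by (rule fin)
    show "0 \<le> r j" for j using B by (simp add: r_def)
    show "bounded (V j a) \<and> diameter (V j a) \<le> r j" if "a \<in> I j" for j a
    proof -
      have d: "dist y y' \<le> r j" if y: "y \<in> V j a" "y' \<in> V j a" for y y'
      proof -
        from y obtain q q' x x' where q: "y = affine_param A x" "y' = affine_param A x'"
          "2 ^ j \<le> q" "int q = a $ None" "int q' = a $ None"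
          "\<And>i. \<bar>real q * x $ i - \<theta> $ Inl i - of_int (a $ Some i)\<bar> < real q powr (- \<tau>)"
          "\<And>i. \<bar>real q' * x' $ i - \<theta> $ Inl i - of_int (a $ Some i)\<bar> < real q' powr (- \<tau>)"
          unfolding V_def by blast
        have q': "q' = q" using q by simp
        have q0: "2 ^ j \<le> real q" using q(3) by (metis of_nat_le_iff of_nat_numeral of_nat_power)
        then have q1: "0 < real q" by (smt (verit) zero_less_power)
        have "infnorm (x - x') \<le> 2 * real q powr (- (1 + \<tau>))"
          unfolding infnorm_le_iff_cart
        proof
          fix i
          have "\<bar>real q * x $ i - real q * x' $ i\<bar> \<le> 2 * real q powr (- \<tau>)"
            using q(6)[of i] q(7)[of i] unfolding q' by linarith
          then have "\<bar>real q * (x $ i - x' $ i)\<bar> \<le> 2 * real q powr (- \<tau>)"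
            by (simp only: right_diff_distrib)
          then have "\<bar>x $ i - x' $ i\<bar> * real q \<le> 2 * real q powr (- \<tau>)"
            by (simp add: abs_mult mult.commute)
          then have "\<bar>x $ i - x' $ i\<bar> \<le> 2 * real q powr (- \<tau>) / real q"
            using q1 by (simp add: pos_le_divide_eq)
          also have "\<dots> = 2 * real q powr (- (1 + \<tau>))"
          proof -
            have "- (1 + \<tau>) = - \<tau> - 1" by simp
            then show ?thesis using q1 by (simp only: powr_diff) simp
          qed
          finally show "\<bar>(x - x') $ i\<bar> \<le> 2 * real q powr (- (1 + \<tau>))" by simp
        qed
        also have "\<dots> \<le> 2 * (2 ^ j) powr (- (1 + \<tau>))"
          using q0 \<tau> by (intro mult_left_mono powr_mono2') auto
        also have "(2 ^ j) powr (- (1 + \<tau>)) = 2 powr (- (1 + \<tau>) * real j)"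
          by (simp add: powr_powr mult.commute flip: powr_realpow)
        finally have "B * infnorm (x - x') \<le> r j"
          unfolding r_def using B by (intro mult_left_mono) auto
        then show ?thesis using B(2)[of x x'] unfolding q(1,2) by linarith
      qed
      show ?thesis
      proof (cases "V j a = {}")
        case True
        then show ?thesis using B by (simp add: r_def)
      next
        case False
        then obtain y where "y \<in> V j a" by blast
        then have "bounded (V j a)" using d by (auto simp: bounded_def)
        moreover have "diameter (V j a) \<le> r j" using False d by (intro diameter_le) (auto simp: dist_norm)
        ultimately show ?thesis by simp
      qed
    qed
    have "r \<longlonglongrightarrow> B * (2 * 0)"
      unfolding r_def
    proof (intro tendsto_mult tendsto_const)
      have "2 powr (- (1 + \<tau>)) < (1::real)" using \<tau> by (simp add: powr_less_one)
      then have "(\<lambda>j. (2 powr (- (1 + \<tau>))) ^ j) \<longlonglongrightarrow> (0::real)" by (intro LIMSEQ_power_zero) auto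
      then show "(\<lambda>j. 2 powr (- (1 + \<tau>) * real j)) \<longlonglongrightarrow> (0::real)"
        by (simp add: powr_powr flip: powr_realpow)
    qed
    then show "r \<longlonglongrightarrow> 0" by simp
    show "summable (\<lambda>j. real (card (I j)) * r j powr s)"
    proof (rule summable_comparison_test')
      define \<kappa> where "\<kappa> = 2 powr ((1 + \<epsilon>) * e - s * (1 + \<tau>))"
      have "0 < \<kappa>" "\<kappa> < 1" using \<epsilon> unfolding \<kappa>_def by (auto intro!: powr_less_one)
      then show "summable (\<lambda>j. C * (2 * B) powr s * \<kappa> ^ j)"
        by (intro summable_mult summable_geometric) auto
      fix j :: nat
      have "real (card (I j)) * r j powr s \<le> (C * R j powr e) * r j powr s"
        by (intro mult_right_mono card) auto
      also have "\<dots> = C * (2 * B) powr s * (2 powr ((1 + \<epsilon>) * real j * e) * 2 powr (- (1 + \<tau>) * real j * s))"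
        using B by (simp add: R_def r_def powr_mult powr_powr mult_ac)
      also have "\<dots> = C * (2 * B) powr s * \<kappa> ^ j"
        by (simp add: \<kappa>_def powr_powr algebra_simps flip: powr_realpow powr_add)
      finally show "norm (real (card (I j)) * r j powr s) \<le> C * (2 * B) powr s * \<kappa> ^ j" by simp
    qed
    fix y assume y: "y \<in> approximable \<tau> \<theta> \<inter> affine_subspace A"
    then obtain x where x: "y = affine_param A x" by (auto simp: affine_subspace_eq)
    define Q where "Q = {q::nat. 0 < q \<and> int_dist (real q *\<^sub>R y - \<theta>) < real q powr (- \<tau>)}"
    have Q: "infinite Q" using y by (simp add: Q_def approximable_def)
    \<comment> \<open>Bounds the entries of \<open>a\<close> in units of \<open>2 ^ j\<close>. It
      may depend on \<open>x\<close>, because \<open>y\<close> has to be covered only for infinitely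
      many \<open>j\<close>.\<close>
    define X where "X = 2 * (1 + infnorm x + infnorm \<theta>) + 2"
    have X: "1 \<le> X" using infnorm_pos_le[of x] infnorm_pos_le[of \<theta>] by (simp add: X_def)
    have "eventually (\<lambda>j. X * 2 ^ j \<le> R j / 2) sequentially"
    proof -
      have "eventually (\<lambda>j. 2 * X \<le> (2 powr \<epsilon>) ^ j) sequentially"
        using \<epsilon> by (intro eventually_le_power gr_one_powr) auto
      then show ?thesis
      proof eventually_elim
        case (elim j)
        have "2 * X * 2 ^ j \<le> (2 powr \<epsilon>) ^ j * 2 ^ j" using elim by (intro mult_right_mono) auto
        also have "\<dots> = R j" by (simp add: R_def powr_powr algebra_simps flip: powr_realpow powr_add)
        finally show ?case by simp
      qed
    qed
    moreover have "eventually (\<lambda>j. (2 + \<Lambda>) * 2 powr (- \<tau> * real j) \<le> R j powr (- \<tau>') / 2) sequentially"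
    proof -
      have "1 < 2 powr (\<tau> - (1 + \<epsilon>) * \<tau>')" using \<epsilon> by (intro gr_one_powr) auto
      then have "eventually (\<lambda>j. 2 * (2 + \<Lambda>) \<le> (2 powr (\<tau> - (1 + \<epsilon>) * \<tau>')) ^ j) sequentially"
        by (rule eventually_le_power)
      then show ?thesis
      proof eventually_elim
        case (elim j)
        have "2 * (2 + \<Lambda>) * 2 powr (- \<tau> * real j)
            \<le> (2 powr (\<tau> - (1 + \<epsilon>) * \<tau>')) ^ j * 2 powr (- \<tau> * real j)"
          using elim by (intro mult_right_mono) auto
        also have "\<dots> = R j powr (- \<tau>')" by (simp add: R_def powr_powr algebra_simps flip: powr_realpow powr_add)
        finally show ?case by (simp add: algebra_simps)
      qed
    qed
    ultimately have "eventually (\<lambda>j. X * 2 ^ j \<le> R j / 2 \<and>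
        (2 + \<Lambda>) * 2 powr (- \<tau> * real j) \<le> R j powr (- \<tau>') / 2) sequentially"
      by (rule eventually_conj)
    then obtain J where J: "\<And>j. J \<le> j \<Longrightarrow> X * 2 ^ j \<le> R j / 2"
      "\<And>j. J \<le> j \<Longrightarrow> (2 + \<Lambda>) * 2 powr (- \<tau> * real j) \<le> R j powr (- \<tau>') / 2"
      unfolding eventually_sequentially by blast
    show "\<exists>\<^sub>\<infinity>j. \<exists>a\<in>I j. y \<in> V j a"
      unfolding INFM_nat_le
    proof
      fix N :: nat
      obtain q where q: "q \<in> Q" "2 ^ (N + J) \<le> q"
        using Q unfolding infinite_nat_iff_unbounded_le by blast
      have q0: "0 < q" using q(1) by (simp add: Q_def)
      obtain j where j: "2 ^ j \<le> q" "q < 2 ^ (j + 1)"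
        using ex_power_ivl1[of 2 q] q0 by (auto simp: Suc_le_eq)
      have jN: "N + J \<le> j"
      proof -
        have "(2::nat) ^ (N + J) < 2 ^ (j + 1)" using q(2) j(2) by linarith
        then have "N + J < j + 1" by (rule power_less_imp_less_exp[rotated]) simp
        then show ?thesis by simp
      qed
      define t where "t = real q powr (- \<tau>)"
      have t1: "0 < t" "t \<le> 1" using q0 \<tau> powr_mono2'[of "- \<tau>" 1 "real q"] by (auto simp: t_def)
      have t2: "t \<le> 2 powr (- \<tau> * real j)"
      proof -
        have "2 ^ j \<le> real q" using j by (metis of_nat_le_iff of_nat_numeral of_nat_power)
        then have "t \<le> (2 ^ j) powr (- \<tau>)" unfolding t_def using \<tau> by (intro powr_mono2') auto
        also have "\<dots> = 2 powr (- \<tau> * real j)"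
          by (simp add: powr_powr mult.commute flip: powr_realpow)
        finally show ?thesis .
      qed
      obtain p u where p: "\<And>i. \<bar>real q * x $ i - \<theta> $ Inl i - of_int (p $ i)\<bar> < t"
        and u: "\<And>j. \<bar>real q * (extend_one x v* A) $ j - \<theta> $ Inr j - of_int (u $ j)\<bar> < t"
        using int_dist_affine_param_less[of q A x \<theta> t] q(1) by (auto simp: Q_def x t_def)
      define a where "a = opt_vec (int q) p"
      have "infnorm (of_int_vec a) \<le> X * 2 ^ j"
        unfolding infnorm_le_iff_cart
      proof
        fix k
        have qr: "real q \<le> 2 * 2 ^ j" using j(2) by (simp add: nat_less_real_le) 
        have q1: "1 \<le> real q" using q0 by simp
        show "\<bar>of_int_vec a $ k\<bar> \<le> X * 2 ^ j"
        proof (cases k)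
          case None
          have "2 * 2 ^ j \<le> X * 2 ^ j" using infnorm_pos_le[of x] infnorm_pos_le[of \<theta>]
            by (intro mult_right_mono) (auto simp: X_def)
          moreover have "\<bar>of_int_vec a $ k\<bar> = real q" by (simp add: None a_def)
          ultimately show ?thesis using qr by linarith
        next
          case (Some i)
          have "\<bar>of_int (p $ i)\<bar> \<le> real q * \<bar>x $ i\<bar> + \<bar>\<theta> $ Inl i\<bar> + 1"
            using p[of i] t1 by (auto simp: abs_mult[of "real q", simplified, symmetric])
          also have "\<dots> \<le> real q * infnorm x + real q * infnorm \<theta> + real q * 1"
          proof (intro add_mono mult_left_mono)
            have "\<bar>\<theta> $ Inl i\<bar> \<le> 1 * infnorm \<theta>" by (simp add: component_le_infnorm_cart)
            also have "\<dots> \<le> real q * infnorm \<theta>" using q1 by (intro mult_right_mono infnorm_pos_le)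
            finally show "\<bar>\<theta> $ Inl i\<bar> \<le> real q * infnorm \<theta>" .
          qed (use q1 in \<open>auto simp: component_le_infnorm_cart\<close>)
          also have "\<dots> = real q * (1 + infnorm x + infnorm \<theta>)" by (simp add: algebra_simps)
          also have "\<dots> \<le> (2 * 2 ^ j) * (1 + infnorm x + infnorm \<theta>)"
            using qr infnorm_pos_le[of x] infnorm_pos_le[of \<theta>] by (intro mult_right_mono) auto
          also have "\<dots> \<le> X * 2 ^ j" by (simp add: X_def algebra_simps)
          finally show ?thesis by (simp add: Some a_def)
        qed
      qed
      also have "\<dots> \<le> R j / 2" using jN by (intro J) simp
      finally have a1: "infnorm (of_int_vec a) \<le> R j / 2" .
      have "int_dist (of_int_vec a v* A - \<beta>) \<le> infnorm (of_int_vec a v* A - \<beta> - of_int_vec u)"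
        by (rule int_dist_le)
      also have "of_int_vec a v* A - \<beta> - of_int_vec u =
          (real q *\<^sub>R (extend_one x v* A) - \<theta>2 - of_int_vec u) +
          (opt_vec 0 (of_int_vec p - real q *\<^sub>R x + \<theta>1) v* A)"
      proof -
        \<comment> \<open>Splits \<open>a\<close> into \<open>q (1, x)\<close>, an error of size at
          most \<open>t\<close>, and the fixed shift by \<open>\<theta>1\<close>; the error reaches
          the last coordinates enlarged by at most \<open>\<Lambda>\<close>.\<close>
        have "of_int_vec a = real q *\<^sub>R extend_one x + opt_vec 0 (of_int_vec p - real q *\<^sub>R x + \<theta>1) - opt_vec 0 \<theta>1"
          by (simp add: vec_eq_iff_option a_def extend_one_eq)
        then have "of_int_vec a v* A = real q *\<^sub>R (extend_one x v* A)
            + opt_vec 0 (of_int_vec p - real q *\<^sub>R x + \<theta>1) v* A - opt_vec 0 \<theta>1 v* A"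
          by (simp only: vector_matrix_left_distrib vector_matrix_mult_diff_distrib scaleR_vector_matrix_assoc)
        then show ?thesis by (simp add: \<beta>_def)
      qed
      also have "infnorm \<dots> \<le> infnorm (real q *\<^sub>R (extend_one x v* A) - \<theta>2 - of_int_vec u)
          + infnorm (opt_vec 0 (of_int_vec p - real q *\<^sub>R x + \<theta>1) v* A)"
        by (rule infnorm_triangle)
      also have "\<dots> \<le> t + \<Lambda> * t"
      proof (rule add_mono)
        show "infnorm (real q *\<^sub>R (extend_one x v* A) - \<theta>2 - of_int_vec u) \<le> t"
          unfolding infnorm_le_iff_cart using u by (simp add: \<theta>2_def less_imp_le)
        have "infnorm (of_int_vec p - real q *\<^sub>R x + \<theta>1) \<le> t"
          unfolding infnorm_le_iff_cart
        proof
          fix i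
          show "\<bar>(of_int_vec p - real q *\<^sub>R x + \<theta>1) $ i\<bar> \<le> t"
            using p[of i] by (simp add: \<theta>1_def)
        qed
        then have "\<Lambda> * infnorm (of_int_vec p - real q *\<^sub>R x + \<theta>1) \<le> \<Lambda> * t"
          using \<Lambda> by (intro mult_left_mono) auto
        then show "infnorm (opt_vec 0 (of_int_vec p - real q *\<^sub>R x + \<theta>1) v* A) \<le> \<Lambda> * t"
          using \<Lambda>(2) by (rule order_trans[rotated])
      qed
      also have "\<dots> < (2 + \<Lambda>) * t" using t1 by (simp add: algebra_simps)
      also have "\<dots> \<le> (2 + \<Lambda>) * 2 powr (- \<tau> * real j)" using \<Lambda> t2 by (intro mult_left_mono) auto
      also have "\<dots> \<le> R j powr (- \<tau>') / 2" using jN by (intro J) simp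
      finally have "a \<in> I j" using a1 by (simp add: I_def)
      moreover have "y \<in> V j a"
        unfolding V_def using x j p by (auto simp: a_def t_def intro!: exI[of _ q] exI[of _ x])
      ultimately show "\<exists>j\<ge>N. \<exists>a\<in>I j. y \<in> V j a" using jN by (intro exI[of _ j]) auto
    qed
  qed
qed

subsection \<open>Points avoiding a cover\<close>

lemma sum_le_card_mult_imp_ex_le:
  fixes f :: "'a \<Rightarrow> real"
  assumes "finite P" "P \<noteq> {}" "(\<Sum>p\<in>P. f p) \<le> real (card P) * b"
  shows "\<exists>p\<in>P. f p \<le> b"
proof (rule ccontr)
  assume "\<not> ?thesis"
  then have "(\<Sum>p\<in>P. b) < (\<Sum>p\<in>P. f p)" using assms by (intro sum_strict_mono) auto
  with assms show False by simp
qed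

text \<open>
  \<open>min 1 (C * (t / r) powr s)\<close> plays the role of the mass, relative to a ball of radius \<open>r\<close>, that a set
  of diameter \<open>t\<close> can carry; the last hypothesis says that passing to a random subball
  centred in \<open>P\<close> does not increase it on average. No limit measure is needed.
\<close>

lemma nested_balls_escape:
  fixes W :: "nat \<Rightarrow> 'a::heine_borel set" and \<rho> :: "nat \<Rightarrow> real" and x0 :: 'a and G :: "nat \<Rightarrow> 'a set"
  assumes s: "0 < s" and C: "1 \<le> C" and \<rho>: "\<And>i. 0 < \<rho> i"
    and W: "\<And>i x y. \<lbrakk>x \<in> W i; y \<in> W i\<rbrakk> \<Longrightarrow> dist x y \<le> \<rho> i"
    and sm: "summable (\<lambda>i. \<rho> i powr s)" and less: "C * (\<Sum>i. \<rho> i powr s) < 1"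
    and step: "\<And>x r k. \<lbrakk>0 < r; r \<le> 1\<rbrakk> \<Longrightarrow> \<exists>P r'. finite P \<and> P \<noteq> {} \<and> 0 < r' \<and> r' \<le> r / 2 \<and>
      (\<forall>p\<in>P. cball p r' \<subseteq> cball x r \<inter> G k) \<and>
      (\<forall>U t. 0 < t \<longrightarrow> (\<forall>x\<in>U. \<forall>y\<in>U. dist x y \<le> t) \<longrightarrow>
        real (card {p\<in>P. U \<inter> cball p r' \<noteq> {}}) * min 1 (C * (t / r') powr s)
          \<le> real (card P) * min 1 (C * (t / r) powr s))"
  shows "\<exists>x. x \<notin> (\<Union>i. W i) \<and> (\<forall>k. x \<in> G k)"
proof -
  define h where "h b i = (if W i \<inter> cball (fst b) (snd b) \<noteq> {} then min 1 (C * (\<rho> i / snd b) powr s) else 0)"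
    for b :: "'a \<times> real" and i
  have h0: "0 \<le> h b i" for b i using C by (simp add: h_def)
  have hle: "h b i \<le> C * snd b powr (- s) * \<rho> i powr s" if "0 < snd b" for b i
    using that C \<rho>[of i] by (auto simp: h_def powr_divide powr_minus min_def field_simps)
  have hsm: "summable (h b)" if "0 < snd b" for b
    by (rule summable_comparison_test'[OF summable_mult[OF sm, of "C * snd b powr (- s)"]])
       (use hle[OF that] h0 in auto)
  \<comment> \<open>A total weight below 1 is what passes from ball to ball; it excludes that any
    single set has weight 1.\<close>
  define Inv where "Inv b \<longleftrightarrow> 0 < snd b \<and> snd b \<le> 1 \<and> (\<Sum>i. h b i) < 1" for b :: "'a \<times> real"
  have "\<exists>f. \<forall>k. Inv (f k) \<and> (snd (f (Suc k)) \<le> snd (f k) / 2 \<and>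
      cball (fst (f (Suc k))) (snd (f (Suc k))) \<subseteq> cball (fst (f k)) (snd (f k)) \<inter> G k)"
  proof (rule dependent_nat_choice)
    have "(\<Sum>i. h (x0, 1) i) \<le> (\<Sum>i. C * \<rho> i powr s)"
      using hle[of "(x0, 1)"] by (intro suminf_le hsm summable_mult sm) auto
    also have "\<dots> = C * (\<Sum>i. \<rho> i powr s)" by (rule suminf_mult[OF sm])
    finally show "\<exists>b. Inv b" using less by (intro exI[of _ "(x0, 1)"]) (simp add: Inv_def)
  next
    fix b :: "'a \<times> real" and k assume b: "Inv b"
    obtain x r where xr: "b = (x, r)" by fastforce
    have r: "0 < r" "r \<le> 1" "(\<Sum>i. h b i) < 1" using b by (auto simp: Inv_def xr)
    obtain P r' where P: "finite P" "P \<noteq> {}" "0 < r'" "r' \<le> r / 2"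
      "\<And>p. p \<in> P \<Longrightarrow> cball p r' \<subseteq> cball x r \<inter> G k"
      "\<And>U t. \<lbrakk>0 < t; \<forall>x\<in>U. \<forall>y\<in>U. dist x y \<le> t\<rbrakk> \<Longrightarrow>
        real (card {p\<in>P. U \<inter> cball p r' \<noteq> {}}) * min 1 (C * (t / r') powr s)
          \<le> real (card P) * min 1 (C * (t / r) powr s)"
      using step[OF r(1,2), of x k] by blast
    have avg: "(\<Sum>p\<in>P. h (p, r') i) \<le> real (card P) * h b i" for i
    proof -
      have "(\<Sum>p\<in>P. h (p, r') i) = (\<Sum>p\<in>{p\<in>P. W i \<inter> cball p r' \<noteq> {}}. min 1 (C * (\<rho> i / r') powr s))"
        using P(1) by (intro sum.mono_neutral_cong_right) (auto simp: h_def)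
      also have "\<dots> = real (card {p\<in>P. W i \<inter> cball p r' \<noteq> {}}) * min 1 (C * (\<rho> i / r') powr s)" by simp
      also have "\<dots> \<le> real (card P) * h b i"
      proof (cases "W i \<inter> cball x r = {}")
        case True
        then have "{p\<in>P. W i \<inter> cball p r' \<noteq> {}} = {}" using P(5) by blast
        then show ?thesis using h0 by (simp only: card.empty) simp
      next
        case False
        then show ?thesis using P(6)[of "\<rho> i" "W i"] \<rho> W by (simp add: h_def xr)
      qed
      finally show ?thesis .
    qed
    have "(\<Sum>p\<in>P. \<Sum>i. h (p, r') i) = (\<Sum>i. \<Sum>p\<in>P. h (p, r') i)"
      by (rule suminf_sum[symmetric]) (use hsm P in auto)
    also have "\<dots> \<le> (\<Sum>i. real (card P) * h b i)"
      using P r by (intro suminf_le avg summable_sum hsm summable_mult) (auto simp: xr)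
    also have "\<dots> = real (card P) * (\<Sum>i. h b i)"
      using r by (intro suminf_mult hsm) (simp add: xr)
    finally obtain p where p: "p \<in> P" "(\<Sum>i. h (p, r') i) \<le> (\<Sum>i. h b i)"
      using sum_le_card_mult_imp_ex_le[OF P(1,2)] by blast
    show "\<exists>b'. Inv b' \<and> (snd b' \<le> snd b / 2 \<and> cball (fst b') (snd b') \<subseteq> cball (fst b) (snd b) \<inter> G k)"
      using p P(3,4) P(5)[OF p(1)] r by (intro exI[of _ "(p, r')"]) (auto simp: Inv_def xr)
  qed
  then obtain f where f: "\<And>k. Inv (f k)" "\<And>k. snd (f (Suc k)) \<le> snd (f k) / 2"
    "\<And>k. cball (fst (f (Suc k))) (snd (f (Suc k))) \<subseteq> cball (fst (f k)) (snd (f k)) \<inter> G k" by blast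
  define B where "B k = cball (fst (f k)) (snd (f k))" for k
  have "\<Inter> (range B) \<noteq> {}"
  proof (rule compact_nest)
    show "compact (B n)" "B n \<noteq> {}" for n using f(1)[of n] by (auto simp: B_def Inv_def less_imp_le)
    show "B n \<subseteq> B m" if "m \<le> n" for m n
      by (rule lift_Suc_antimono_le[OF _ that]) (use f(3) in \<open>auto simp: B_def\<close>)
  qed
  then obtain x where x: "\<And>k. x \<in> B k" by auto
  have rk: "snd (f k) \<le> 1 / 2 ^ k" for k
  proof (induction k)
    case 0
    show ?case using f(1)[of 0] by (simp add: Inv_def)
  next
    case (Suc k)
    then show ?case using f(2)[of k] by simp
  qed
  have "x \<notin> W i" for i
  proof
    assume xi: "x \<in> W i"
    \<comment> \<open>Once the radius is at most \<open>\<rho> i\<close>, the truncation at 1 makes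
      the weight of a set that meets the ball exactly 1, against the invariant.\<close>
    obtain k where k: "1 / 2 ^ k < \<rho> i"
      using real_arch_pow_inv[OF \<rho>[of i], of "1 / 2"] by (auto simp: power_one_over)
    have r: "0 < snd (f k)" "snd (f k) \<le> \<rho> i" using f(1)[of k] rk[of k] k by (auto simp: Inv_def)
    have "1 \<le> (\<rho> i / snd (f k)) powr s" using r s by (intro ge_one_powr_ge_zero) auto
    then have "1 * 1 \<le> C * (\<rho> i / snd (f k)) powr s" using C by (intro mult_mono) auto
    then have "h (f k) i = 1" using x[of k] xi by (auto simp: h_def B_def)
    moreover have "h (f k) i \<le> (\<Sum>i. h (f k) i)"
      using sum_le_suminf[OF hsm[of "f k"], of "{i}"] r h0 by auto
    ultimately show False using f(1)[of k] by (simp add: Inv_def)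
  qed
  moreover have "x \<in> G k" for k using x[of "Suc k"] f(3)[of k] by (auto simp: B_def)
  ultimately show ?thesis by blast
qed

section \<open>Separated nets, volumes of cubes and the pigeonhole principle\<close>

text \<open>Greedy selection. The result is separated and at the same time a net of
  \<open>Z\<close>, so a volume argument can bound its size from below.\<close>

lemma ex_maximal_separated_subset:
  fixes Z :: "(real^'d) set"
  assumes "finite Z"
  obtains P where "P \<subseteq> Z" "\<And>p p'. \<lbrakk>p \<in> P; p' \<in> P; p \<noteq> p'\<rbrakk> \<Longrightarrow> t \<le> infnorm (p - p')"
    "\<And>z. z \<in> Z \<Longrightarrow> z \<in> P \<or> (\<exists>p\<in>P. infnorm (z - p) < t)"
  using assms
proof (induction Z arbitrary: thesis rule: finite_induct)
  case empty
  show ?case by (rule empty[of "{}"]) auto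
next
  case (insert z Z)
  obtain P where P: "P \<subseteq> Z" "\<And>p p'. \<lbrakk>p \<in> P; p' \<in> P; p \<noteq> p'\<rbrakk> \<Longrightarrow> t \<le> infnorm (p - p')"
    "\<And>z. z \<in> Z \<Longrightarrow> z \<in> P \<or> (\<exists>p\<in>P. infnorm (z - p) < t)"
    using insert.IH by blast
  show ?case
  proof (cases "\<exists>p\<in>P. infnorm (z - p) < t")
    case True
    show ?thesis by (rule insert.prems[of P]) (use P True in auto)
  next
    case False
    have "t \<le> infnorm (p - p')" if "p \<in> insert z P" "p' \<in> insert z P" "p \<noteq> p'" for p p'
      using that P(2) False infnorm_sub[of p p'] by (auto simp: not_less)
    then show ?thesis by (intro insert.prems[of "insert z P"]) (use P in auto)
  qed
qed

lemma cube_eq_cbox: "{x::real^'d. infnorm (x - c) \<le> t} = cbox (\<chi> i. c $ i - t) (\<chi> i. c $ i + t)"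
  by (auto simp: infnorm_le_iff_cart mem_box_cart abs_le_iff algebra_simps)

lemma measure_cube:
  assumes "0 \<le> t"
  shows "measure lborel {x::real^'d. infnorm (x - c) \<le> t} = (2 * t) ^ CARD('d)"
  unfolding cube_eq_cbox using assms
  by (subst content_cbox_cart) (auto simp: interval_ne_empty_cart)

lemma cube_cover_volume:
  fixes c :: "'i \<Rightarrow> real^'d"
  assumes fin: "finite I" and t: "\<And>i. i \<in> I \<Longrightarrow> 0 \<le> t i" and a: "0 \<le> a"
    and cov: "\<And>x. infnorm (x - x0) \<le> a \<Longrightarrow> \<exists>i\<in>I. infnorm (x - c i) \<le> t i"
  shows "a ^ CARD('d) \<le> (\<Sum>i\<in>I. t i ^ CARD('d))"
proof -
  have cube: "{x::real^'d. infnorm (x - z) \<le> u} \<in> fmeasurable lborel" for z u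
    unfolding cube_eq_cbox by simp
  have "(2 * a) ^ CARD('d) = measure lborel {x. infnorm (x - x0) \<le> a}" by (simp add: measure_cube[OF a])
  also have "\<dots> \<le> measure lborel (\<Union>i\<in>I. {x. infnorm (x - c i) \<le> t i})"
  proof (rule measure_mono_fmeasurable)
    show "{x. infnorm (x - x0) \<le> a} \<subseteq> (\<Union>i\<in>I. {x. infnorm (x - c i) \<le> t i})" using cov by auto
    show "{x. infnorm (x - x0) \<le> a} \<in> sets lborel" using cube by (rule fmeasurableD)
    show "(\<Union>i\<in>I. {x. infnorm (x - c i) \<le> t i}) \<in> fmeasurable lborel"
      by (intro fmeasurable.finite_UN fin cube)
  qed
  also have "\<dots> \<le> (\<Sum>i\<in>I. measure lborel {x. infnorm (x - c i) \<le> t i})"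
    by (rule measure_UNION_le[OF fin fmeasurableD[OF cube]])
  also have "\<dots> = (\<Sum>i\<in>I. (2 * t i) ^ CARD('d))"
    by (intro sum.cong refl measure_cube t)
  finally have "2 ^ CARD('d) * a ^ CARD('d) \<le> 2 ^ CARD('d) * (\<Sum>i\<in>I. t i ^ CARD('d))"
    by (simp add: power_mult_distrib sum_distrib_left)
  then show ?thesis by simp
qed

text \<open>The \<open>Q + 1\<close> values \<open>0, ..., Q\<close> compete for at most
  \<open>Q\<close> cells, which record \<open>q x\<close> modulo 1 in steps of \<open>1 / E\<close>
  and the image under \<open>A\<close> of \<open>q\<close> joined with the rounded
  \<open>q x\<close> in steps of \<open>1 / K\<close>. Two values in one cell are
  subtracted.\<close>

lemma dirichlet_near_affine_subspace:
  fixes A :: "real^'m^('d::finite) option" and x :: "real^'d"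
  assumes EK: "1 \<le> E" "1 \<le> K" and Q: "E ^ CARD('d) * K ^ CARD('m) \<le> Q"
  obtains q p where "1 \<le> q" "q \<le> Q" "\<And>i. \<bar>real q * x $ i - of_int (p $ i)\<bar> < 1 / real E"
    "int_dist (of_int_vec (opt_vec (int q) p) v* A) < 1 / real K"
proof -
  \<comment> \<open>Rounding \<open>q x\<close> before applying \<open>A\<close> keeps the error in \<open>q x\<close>, which is much larger than
    \<open>1 / K\<close>, out of the second family of conditions.\<close>
  define P where "P q = (\<chi> i. \<lfloor>real q * x $ i\<rfloor>)" for q :: nat
  define v where "v q = of_int_vec (opt_vec (int q) (P q)) v* A" for q
  define f where "f q = (\<chi> i. nat \<lfloor>real E * frac (real q * x $ i)\<rfloor>, \<chi> j. nat \<lfloor>real K * frac (v q $ j)\<rfloor>)" for q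
  define T where "T = {u::nat^'d. \<forall>i. u $ i \<in> {..<E}} \<times> {u::nat^'m. \<forall>i. u $ i \<in> {..<K}}"
  have cell: "nat \<lfloor>real M * frac y\<rfloor> < M" if "1 \<le> M" for M y
  proof -
    have "real M * frac y < real M * 1" using that by (intro mult_strict_left_mono frac_lt_1) auto
    then have "\<lfloor>real M * frac y\<rfloor> < int M" by (simp add: floor_less_iff)
    then show ?thesis using that by (simp add: nat_less_iff)
  qed
  have same: "\<bar>frac y - frac y'\<bar> < 1 / real M"
    if "1 \<le> M" "nat \<lfloor>real M * frac y\<rfloor> = nat \<lfloor>real M * frac y'\<rfloor>" for M y y'
  proof -
    have "0 \<le> \<lfloor>real M * frac y\<rfloor>" "0 \<le> \<lfloor>real M * frac y'\<rfloor>" by auto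
    with that have "\<lfloor>real M * frac y\<rfloor> = \<lfloor>real M * frac y'\<rfloor>" by linarith
    then have "\<bar>real M * frac y - real M * frac y'\<bar> < 1" by linarith
    then have "\<bar>real M * (frac y - frac y')\<bar> < 1" by (simp only: right_diff_distrib)
    then show ?thesis
      using that by (simp add: abs_mult pos_less_divide_eq mult.commute del: right_diff_distrib)
  qed
  have finT: "finite T" unfolding T_def by (intro finite_cartesian_product finite_vec_box) auto
  have "card T = E ^ CARD('d) * K ^ CARD('m)"
    unfolding T_def card_cartesian_product by (subst card_vec_box card_vec_box, simp)+ simp
  moreover have "f ` {0..Q} \<subseteq> T" using cell EK by (auto simp: f_def T_def)
  then have "card (f ` {0..Q}) \<le> card T" by (rule card_mono[OF finT])
  ultimately have "card (f ` {0..Q}) < card {0..Q}" using Q by simp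
  then have "\<not> inj_on f {0..Q}" by (rule pigeonhole)
  then obtain a b where ab: "a < b" "b \<le> Q" "f a = f b"
    unfolding inj_on_def by (metis atLeastAtMost_iff linorder_neqE_nat)
  show ?thesis
  proof (rule that[of "b - a" "P b - P a"])
    show "1 \<le> b - a" "b - a \<le> Q" using ab by auto
    show "\<bar>real (b - a) * x $ i - of_int ((P b - P a) $ i)\<bar> < 1 / real E" for i
    proof -
      have "\<bar>frac (real b * x $ i) - frac (real a * x $ i)\<bar> < 1 / real E"
        using ab(3) EK by (intro same) (auto simp: f_def vec_eq_iff)
      then show ?thesis using ab by (simp add: P_def frac_def of_nat_diff algebra_simps)
    qed
    have "of_int_vec (opt_vec (int (b - a)) (P b - P a)) v* A = v b - v a"
    proof -
      have "opt_vec (int (b - a)) (P b - P a) = opt_vec (int b) (P b) - opt_vec (int a) (P a)"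
        using ab by (simp add: vec_eq_iff_option of_nat_diff)
      then show ?thesis by (simp add: v_def of_int_vec_diff vector_matrix_mult_diff_distrib)
    qed
    moreover have "int_dist (v b - v a) < 1 / real K"
      unfolding int_dist_less_iff infnorm_less_iff_cart
    proof (intro exI[of _ "\<chi> j. \<lfloor>v b $ j\<rfloor> - \<lfloor>v a $ j\<rfloor>"] allI)
      fix j
      have "\<bar>frac (v b $ j) - frac (v a $ j)\<bar> < 1 / real K"
        using ab(3) EK by (intro same) (auto simp: f_def vec_eq_iff)
      then show "\<bar>(v b - v a - of_int_vec (\<chi> j. \<lfloor>v b $ j\<rfloor> - \<lfloor>v a $ j\<rfloor>)) $ j\<bar> < 1 / real K"
        by (simp add: frac_def algebra_simps)
    qed
    ultimately show "int_dist (of_int_vec (opt_vec (int (b - a)) (P b - P a)) v* A) < 1 / real K" by simp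
  qed
qed

subsection \<open>Rational points near the affine subspace\<close>

text \<open>Three sizes of \<open>U\<close>. If \<open>C * (t / r) powr s \<ge> 1\<close>, the
  right-hand side is \<open>card P\<close>. If \<open>t \<le> b\<close>, at most
  \<open>5 ^ CARD('d)\<close> balls are hit and \<open>N2\<close> applies. In between, at most
  \<open>(5 * t / b) ^ CARD('d)\<close> are hit, which \<open>N1\<close> compares with
  \<open>card P\<close>, and \<open>(t / r) ^ CARD('d) \<le> (t / r) powr s\<close> as
  \<open>t < r\<close>. In \<open>C\<close>, 30 is the product of this 5 and the 6 of
  \<open>N1\<close>, and the 2 undoes the halving in \<open>N1\<close>.\<close>

lemma card_separated_hits:
  fixes P :: "(real^'d) set"
  assumes fin: "finite P" and sep: "\<And>p p'. \<lbrakk>p \<in> P; p' \<in> P; p \<noteq> p'\<rbrakk> \<Longrightarrow> 2 * b \<le> infnorm (p - p')"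
    and b: "0 < b" and r': "0 < r'" "r' \<le> b" and r: "0 < r" and s: "0 < s" "s \<le> real CARD('d)"
    and N1: "(r / (6 * real CARD('d) * b)) ^ CARD('d) / 2 \<le> real (card P)"
    and N2: "5 ^ CARD('d) * (r / r') powr s \<le> real (card P)"
    and t: "0 < t" and U: "\<And>x y. \<lbrakk>x \<in> U; y \<in> U\<rbrakk> \<Longrightarrow> dist x y \<le> t"
  defines "C \<equiv> 2 * (30 * real CARD('d)) ^ CARD('d)"
  shows "real (card {p\<in>P. U \<inter> cball p r' \<noteq> {}}) * min 1 (C * (t / r') powr s)
    \<le> real (card P) * min 1 (C * (t / r) powr s)"
proof -
  define d where "d = real CARD('d)"
  have d: "1 \<le> d" by (simp add: d_def Suc_le_eq)
  have C1: "1 \<le> C"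
  proof -
    have "1 \<le> (30 * d) ^ CARD('d)" using d by (intro one_le_power) auto
    then show ?thesis by (simp add: C_def d_def)
  qed
  define H where "H = {p\<in>P. U \<inter> cball p r' \<noteq> {}}"
  have HP: "card H \<le> card P" unfolding H_def by (rule card_mono[OF fin]) auto
  have H: "real (card H) \<le> (t / b + 4) ^ CARD('d)"
  proof (cases "H = {}")
    case False
    then obtain p0 where p0: "p0 \<in> H" by blast
    have near: "infnorm (p - p0) \<le> t + 2 * r'" if "p \<in> H" for p
    proof -
      from that p0 obtain u v where u: "u \<in> U" "dist p u \<le> r'" and v: "v \<in> U" "dist p0 v \<le> r'"
        by (auto simp: H_def)
      have "dist p p0 \<le> dist p u + dist u v + dist v p0"
        by (smt (verit) dist_triangle)
      also have "\<dots> \<le> t + 2 * r'" using u v U[of u v] by (simp add: dist_commute)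
      finally show ?thesis using infnorm_le_norm[of "p - p0"] by (simp add: dist_norm)
    qed
    have "real (card H) \<le> (2 * (t + 2 * r') / (2 * b) + 2) ^ CARD('d)"
    proof (rule card_separated_le(2)[where z = p0])
      show "infnorm (p - p0) \<le> t + 2 * r'" if "p \<in> H" for p using near[OF that] .
      show "2 * b \<le> infnorm (p - p')" if "p \<in> H" "p' \<in> H" "p \<noteq> p'" for p p'
        using that by (intro sep) (auto simp: H_def)
    qed (use b t r' in auto)
    also have "\<dots> \<le> (t / b + 4) ^ CARD('d)"
    proof (rule power_mono)
      have "r' / b \<le> 1" using r' b by simp
      then show "2 * (t + 2 * r') / (2 * b) + 2 \<le> t / b + 4"
        by (simp add: add_divide_distrib)
    qed (use b t r' in auto)
    finally show ?thesis .
  qed (use b t in simp)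
  have "real (card H) * min 1 (C * (t / r') powr s) \<le> real (card P) * min 1 (C * (t / r) powr s)"
  proof (cases "1 \<le> C * (t / r) powr s")
    case True
    have "real (card H) * min 1 (C * (t / r') powr s) \<le> real (card P) * 1"
      using HP C1 by (intro mult_mono) auto
    then show ?thesis using True by simp
  next
    case False
    have tr: "0 < t / r" "t / r < 1"
    proof -
      show "0 < t / r" using t r by simp
      show "t / r < 1"
      proof (rule ccontr)
        assume "\<not> ?thesis"
        then have "1 \<le> (t / r) powr s" using s by (intro ge_one_powr_ge_zero) auto
        then have "1 * 1 \<le> C * (t / r) powr s" using C1 by (intro mult_mono) auto
        with False show False by simp
      qed
    qed
    show ?thesis
    proof (cases "t \<le> b")
      case True
      have "real (card H) \<le> 5 ^ CARD('d)"
        by (rule order_trans[OF H power_mono]) (use True b t in auto)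
      then have "real (card H) * min 1 (C * (t / r') powr s) \<le> 5 ^ CARD('d) * (C * (t / r') powr s)"
        using C1 by (intro mult_mono) auto
      also have "\<dots> = (5 ^ CARD('d) * (r / r') powr s) * (C * (t / r) powr s)"
      proof -
        have "t / r' = (r / r') * (t / r)" using r by simp
        then have "(t / r') powr s = (r / r') powr s * (t / r) powr s"
          by (simp only: powr_mult)
        then show ?thesis by simp
      qed
      also have "\<dots> \<le> real (card P) * (C * (t / r) powr s)"
        using N2 C1 by (intro mult_right_mono) auto
      finally show ?thesis using False by simp
    next
      case False': False
      have "real (card H) \<le> (5 * t / b) ^ CARD('d)"
      proof (rule order_trans[OF H power_mono])
        show "t / b + 4 \<le> 5 * t / b" using False' b by (simp add: field_simps)
      qed (use b t in auto)
      then have "real (card H) * min 1 (C * (t / r') powr s) \<le> (5 * t / b) ^ CARD('d) * 1"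
        using C1 by (intro mult_mono) auto
      also have "\<dots> = ((r / (6 * d * b)) ^ CARD('d) / 2) * (C * (t / r) ^ CARD('d))"
      proof -
        have eq: "5 * t / b = (r / (6 * d * b)) * ((30 * d) * (t / r))" using r d by (simp add: field_simps)
        have "(5 * t / b) ^ CARD('d) = (r / (6 * d * b)) ^ CARD('d) * ((30 * d) ^ CARD('d) * (t / r) ^ CARD('d))"
          by (simp only: eq power_mult_distrib)
        then show ?thesis unfolding C_def d_def[symmetric] by simp
      qed
      also have "\<dots> \<le> real (card P) * (C * (t / r) powr s)"
      proof (intro mult_mono mult_left_mono)
        show "(t / r) ^ CARD('d) \<le> (t / r) powr s"
        proof -
          have "(t / r) powr d \<le> (t / r) powr s" using tr s by (intro powr_mono') (auto simp: d_def)
          then show ?thesis using tr by (simp add: d_def powr_realpow)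
        qed
      qed (use N1 C1 tr in \<open>auto simp: d_def\<close>)
      finally show ?thesis using False by simp
    qed
  qed
  then show ?thesis by (simp add: H_def)
qed

text \<open>The vectors that the pigeonhole argument may return with a denominator \<open>q\<close>
  below \<open>q0\<close>. Their balls of radius \<open>1 / (E * q)\<close> are larger than the
  spacing aimed at, so they are controlled through their total volume.\<close>

definition small_set :: "real^'m^('d::finite) option \<Rightarrow> real \<Rightarrow> real \<Rightarrow> nat \<Rightarrow> (int^'d option) set" where
  "small_set A X q0 K = {a. 1 \<le> a $ None \<and> of_int (a $ None) < q0 \<and>
     (\<forall>i. \<bar>of_int (a $ Some i)\<bar> \<le> X * of_int (a $ None)) \<and> int_dist (of_int_vec a v* A) < 1 / real K}"

lemma finite_small_set:
  assumes "1 \<le> X"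
  shows "finite (small_set A X q0 K)"
proof (rule finite_subset[OF _ finite_int_vec_ball[of "X * q0"]], rule subsetI)
  fix a assume a: "a \<in> small_set A X q0 K"
  then have q: "1 \<le> real_of_int (a $ None)" "real_of_int (a $ None) \<le> q0" by (auto simp: small_set_def)
  have "\<bar>of_int_vec a $ k\<bar> \<le> X * q0" for k
  proof (cases k)
    case None
    have "1 * real_of_int (a $ None) \<le> X * q0" using q assms by (intro mult_mono) auto
    then show ?thesis using q by (simp add: None)
  next
    case (Some i)
    have "\<bar>of_int (a $ Some i)\<bar> \<le> X * of_int (a $ None)" using a by (auto simp: small_set_def)
    also have "\<dots> \<le> X * q0" using q assms by (intro mult_left_mono) auto
    finally show ?thesis by (simp add: Some)
  qed
  then show "a \<in> {a. infnorm (of_int_vec a) \<le> X * q0}" by (simp add: infnorm_le_iff_cart)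
qed

text \<open>The hypotheses on \<open>E\<close> and \<open>K\<close> are met by the integers chosen in \<open>ex_good_subballs\<close>:
  \<open>K\<close> of order \<open>Q powr \<tau>\<close>, and \<open>E\<close> of order \<open>(Q / K\<^sup>m) powr (1 / d)\<close> as the pigeonhole argument permits.\<close>

lemma small_denominators_negligible:
  fixes A :: "real^'m^('d::finite) option"
  assumes w: "dioph_exponent A < ereal w" "real CARD('m) < w" and \<tau>: "0 \<le> \<tau>" "\<tau> * w < 1"
    and \<delta>: "0 < \<delta>" and X: "1 \<le> X" and \<epsilon>: "0 < \<epsilon>"
  shows "\<forall>\<^sub>F Q in sequentially. \<forall>E K :: nat. 1 \<le> E \<longrightarrow> 1 \<le> K \<longrightarrow> real K \<le> 5 * real Q powr \<tau> \<longrightarrow>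
     real Q \<le> (2 * real E) ^ CARD('d) * real K ^ CARD('m) \<longrightarrow>
     (\<Sum>a\<in>small_set A X (real Q powr (1 - \<delta>)) K. (1 / (real E * of_int (a $ None))) ^ CARD('d)) \<le> \<epsilon>"
proof -
  define m where "m = real CARD('m)"
  have m: "1 \<le> m" by (simp add: m_def Suc_le_eq)
  have w0: "0 < w" using w m by (simp add: m_def)
  obtain C where C: "0 < C" "\<And>R K. \<lbrakk>1 \<le> R; 1 \<le> K\<rbrakk> \<Longrightarrow> real (card (bohr_set A R (1 / K)))
      \<le> C * R ^ CARD('d option) * (K powr (- m) + R powr (- m / w))"
    using card_bohr_set_exponent'[OF w(1) w0] unfolding m_def by metis
  define D where "D = C * (2 * X) ^ CARD('d option) * 2 ^ CARD('d)"
  have D: "0 < D" using C X by (simp add: D_def)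
  \<comment> \<open>The second summand of the count ends up with the exponent
    \<open>(1 - m / w) + \<tau> * m - 1 = - \<eta>\<close>, negative because
    \<open>\<tau> * w < 1\<close>.\<close>
  define \<eta> where "\<eta> = m * (1 / w - \<tau>)"
  have \<eta>: "0 < \<eta>" using m w0 \<tau> by (simp add: \<eta>_def field_simps)
  have lim: "(\<lambda>Q::nat. (log 2 (real Q) + 1) * real Q powr (- x)) \<longlonglongrightarrow> 0" if "0 < x" for x
    using that by real_asymp
  have "(\<lambda>Q::nat. D * ((log 2 (real Q) + 1) * real Q powr (- \<delta>)) +
      (D * 5 powr m) * ((log 2 (real Q) + 1) * real Q powr (- \<eta>))) \<longlonglongrightarrow> D * 0 + (D * 5 powr m) * 0"
    by (intro tendsto_add tendsto_mult tendsto_const lim \<delta> \<eta>)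
  then have "(\<lambda>Q::nat. (log 2 (real Q) + 1) * (D * (real Q powr (- \<delta>) + 5 powr m * real Q powr (- \<eta>)))) \<longlonglongrightarrow> 0"
    by (simp add: algebra_simps)
  then have "\<forall>\<^sub>F Q in sequentially. (log 2 (real Q) + 1) * (D * (real Q powr (- \<delta>) + 5 powr m * real Q powr (- \<eta>))) < \<epsilon>"
    using \<epsilon> by (rule order_tendstoD)
  then show ?thesis
    using eventually_ge_at_top[of 1]
  proof eventually_elim
    case (elim Q)
    show ?case
    proof (intro allI impI)
      fix E K :: nat
      assume E: "1 \<le> E" and K: "1 \<le> K" "real K \<le> 5 * real Q powr \<tau>"
        and Q: "real Q \<le> (2 * real E) ^ CARD('d) * real K ^ CARD('m)"
      have Q1: "1 \<le> real Q" using elim by simp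
      define S where "S = small_set A X (real Q powr (1 - \<delta>)) K"
      have finS: "finite S" unfolding S_def by (rule finite_small_set[OF X])
      \<comment> \<open>Group by the dyadic size of the denominator. There are at most
        \<open>log 2 Q + 1\<close> groups, and the powers with exponents \<open>- \<delta>\<close>
        and \<open>- \<eta>\<close> absorb this logarithm.\<close>
      have "\<forall>a\<in>S. \<exists>j. 2 ^ j \<le> nat (a $ None) \<and> nat (a $ None) < 2 ^ (j + 1)"
        by (intro ballI ex_power_ivl1) (auto simp: S_def small_set_def)
      then obtain jf where jf: "\<And>a. a \<in> S \<Longrightarrow> 2 ^ jf a \<le> nat (a $ None) \<and> nat (a $ None) < 2 ^ (jf a + 1)"
        by metis
      have jf1: "2 ^ jf a \<le> real_of_int (a $ None)" "real_of_int (a $ None) \<le> 2 * 2 ^ jf a" if "a \<in> S" for a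
      proof -
        have "1 \<le> a $ None" using that by (simp add: S_def small_set_def)
        then have "real (nat (a $ None)) = real_of_int (a $ None)" by simp
        moreover have "real (2 ^ jf a) \<le> real (nat (a $ None))" "real (nat (a $ None)) \<le> real (2 ^ (jf a + 1))"
          using jf[OF that] by (simp_all only: of_nat_le_iff less_imp_le)
        ultimately show "2 ^ jf a \<le> real_of_int (a $ None)" "real_of_int (a $ None) \<le> 2 * 2 ^ jf a" by simp_all
      qed
      define T where "T = jf ` S"
      define g where "g a = (1 / (real E * of_int (a $ None))) ^ CARD('d)" for a :: "int^'d option"
      have y: "1 \<le> (2::real) ^ j" "2 ^ j \<le> real Q powr (1 - \<delta>)" "2 ^ j \<le> real Q" if "j \<in> T" for j
      proof -
        show "1 \<le> (2::real) ^ j" by simp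
        from that obtain a where a: "a \<in> S" "j = jf a" by (auto simp: T_def)
        have "of_int (a $ None) < real Q powr (1 - \<delta>)" using a by (simp add: S_def small_set_def)
        then show le: "2 ^ j \<le> real Q powr (1 - \<delta>)"
          using jf1(1)[OF a(1)] unfolding a(2) by linarith
        have "real Q powr (1 - \<delta>) \<le> real Q powr 1" using Q1 \<delta> by (intro powr_mono) auto
        moreover have "real Q powr 1 = real Q" by simp
        ultimately show "2 ^ j \<le> real Q" using le by linarith
      qed
      have T: "T \<subseteq> {..nat \<lfloor>log 2 (real Q)\<rfloor>}"
      proof
        fix j assume "j \<in> T"
        then have "2 powr real j \<le> real Q" using y by (simp add: powr_realpow)
        then have "real j \<le> log 2 (real Q)" using Q1 by (simp add: le_log_iff)
        then show "j \<in> {..nat \<lfloor>log 2 (real Q)\<rfloor>}" by (simp add: le_nat_floor)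
      qed
      have cardT: "real (card T) \<le> log 2 (real Q) + 1"
      proof -
        have "card T \<le> nat \<lfloor>log 2 (real Q)\<rfloor> + 1" using card_mono[OF _ T] by simp
        moreover have "0 \<le> log 2 (real Q)" using Q1 by simp
        ultimately show ?thesis by linarith
      qed
      have dyadic: "(\<Sum>a\<in>{a\<in>S. jf a = j}. g a) \<le> D * (real Q powr (- \<delta>) + 5 powr m * real Q powr (- \<eta>))" if j: "j \<in> T" for j
      proof -
        define y where "y = (2::real) ^ j"
        have y: "1 \<le> y" "y \<le> real Q powr (1 - \<delta>)" "y \<le> real Q" using y[OF j] by (auto simp: y_def)
        have sub: "{a\<in>S. jf a = j} \<subseteq> bohr_set A (2 * X * y) (1 / real K)"
        proof
          fix a assume "a \<in> {a\<in>S. jf a = j}"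
          then have a: "a \<in> S" "jf a = j" by auto
          have aN: "1 \<le> real_of_int (a $ None)" using a by (simp add: S_def small_set_def)
          have "\<bar>of_int_vec a $ k\<bar> \<le> X * of_int (a $ None)" for k
          proof (cases k)
            case None
            then show ?thesis using X aN by simp
          next
            case (Some i)
            then show ?thesis using a by (simp add: S_def small_set_def)
          qed
          moreover have "X * of_int (a $ None) \<le> 2 * X * y"
            using jf1[OF a(1)] X a(2) by (simp add: y_def)
          ultimately have "infnorm (of_int_vec a) \<le> 2 * X * y"
            unfolding infnorm_le_iff_cart by (meson order_trans)
          then show "a \<in> bohr_set A (2 * X * y) (1 / real K)"
            using a by (simp add: bohr_set_def S_def small_set_def)
        qed
        have "(\<Sum>a\<in>{a\<in>S. jf a = j}. g a) \<le> (\<Sum>a\<in>{a\<in>S. jf a = j}. (1 / (real E * y)) ^ CARD('d))"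
        proof (rule sum_mono)
          fix a assume a: "a \<in> {a\<in>S. jf a = j}"
          have "1 \<le> a $ None" using a by (simp add: S_def small_set_def)
          then show "g a \<le> (1 / (real E * y)) ^ CARD('d)"
            unfolding g_def using jf1(1)[of a] a y E
            by (intro power_mono divide_left_mono mult_left_mono mult_pos_pos) (auto simp: y_def)
        qed
        also have "\<dots> = real (card {a\<in>S. jf a = j}) * (1 / (real E * y)) ^ CARD('d)" by simp
        also have "\<dots> \<le> (C * (2 * X * y) ^ CARD('d option) * (real K powr (- m) + y powr (- m / w)))
            * (1 / (real E * y)) ^ CARD('d)"
        proof (rule mult_right_mono)
          have "1 * 1 \<le> 2 * X * y" using X y by (intro mult_mono) auto
          then have "real (card {a\<in>S. jf a = j})
              \<le> C * (2 * X * y) ^ CARD('d option) * (real K powr (- m) + (2 * X * y) powr (- m / w))"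
            using card_mono[OF finite_bohr_set sub] C(2)[of "2 * X * y" "real K"] K by linarith
          also have "\<dots> \<le> C * (2 * X * y) ^ CARD('d option) * (real K powr (- m) + y powr (- m / w))"
          proof (intro mult_left_mono add_left_mono)
            have "1 * y \<le> 2 * X * y" using X y by (intro mult_right_mono) auto
            then show "(2 * X * y) powr (- m / w) \<le> y powr (- m / w)"
              using y m w0 by (intro powr_mono2') auto
          qed (use C X y in auto)
          finally show "real (card {a\<in>S. jf a = j})
              \<le> C * (2 * X * y) ^ CARD('d option) * (real K powr (- m) + y powr (- m / w))" .
        qed (use y in auto)
        also have "\<dots> = C * (2 * X) ^ CARD('d option) * (y * (real K powr (- m) + y powr (- m / w))) * (1 / real E) ^ CARD('d)"
          using y by (simp add: power_mult_distrib power_divide)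
        \<comment> \<open>The hypothesis on \<open>Q\<close> bounds \<open>E\<close> from below; the
          factor \<open>K ^ m / Q\<close> that it brings in turns the first summand into a multiple
          of \<open>y / Q\<close>.\<close>
        also have "\<dots> \<le> C * (2 * X) ^ CARD('d option) * (y * (real K powr (- m) + y powr (- m / w)))
            * (2 ^ CARD('d) * real K ^ CARD('m) / real Q)"
        proof (rule mult_left_mono)
          have "0 < real E ^ CARD('d)" using E by simp
          then show "(1 / real E) ^ CARD('d) \<le> 2 ^ CARD('d) * real K ^ CARD('m) / real Q"
            using Q Q1 E by (simp add: power_divide power_mult_distrib field_simps)
        qed (use C X y in auto)
        also have "real K ^ CARD('m) = real K powr m" using K by (simp add: m_def powr_realpow)
        also have "C * (2 * X) ^ CARD('d option) * (y * (real K powr (- m) + y powr (- m / w)))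
            * (2 ^ CARD('d) * real K powr m / real Q)
          = D * (y / real Q * (real K powr (- m) * real K powr m) + y * y powr (- m / w) * real K powr m / real Q)"
          by (simp add: D_def algebra_simps add_divide_distrib)
        also have "real K powr (- m) * real K powr m = 1" using K by (simp flip: powr_add)
        also have "D * (y / real Q * 1 + y * y powr (- m / w) * real K powr m / real Q)
            \<le> D * (real Q powr (- \<delta>) + 5 powr m * real Q powr (- \<eta>))"
        proof (intro mult_left_mono add_mono)
          have "y / real Q \<le> real Q powr (1 - \<delta>) / real Q" using y Q1 by (intro divide_right_mono) auto
          also have "\<dots> = real Q powr (- \<delta>)" using Q1 by (simp add: powr_diff powr_minus field_simps)
          finally show "y / real Q * 1 \<le> real Q powr (- \<delta>)" by simp
          \<comment> \<open>As \<open>w > m\<close>, the exponent \<open>1 - m / w\<close> is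
            positive, so \<open>y = Q\<close> is the worst case here; the other summand uses the
            sharper bound \<open>y \<le> Q powr (1 - \<delta>)\<close>.\<close>
          have "y * y powr (- m / w) = y powr (1 - m / w)"
            using y by (simp add: powr_diff powr_minus field_simps)
          also have "\<dots> \<le> real Q powr (1 - m / w)"
            using y w m by (intro powr_mono2) (auto simp: m_def field_simps)
          finally have 1: "y * y powr (- m / w) \<le> real Q powr (1 - m / w)" .
          have "real K powr m \<le> (5 * real Q powr \<tau>) powr m" using K m by (intro powr_mono2) auto
          also have "\<dots> = 5 powr m * real Q powr (\<tau> * m)" by (simp add: powr_mult powr_powr)
          finally have 2: "real K powr m \<le> 5 powr m * real Q powr (\<tau> * m)" .
          have "y * y powr (- m / w) * real K powr m / real Q
              \<le> real Q powr (1 - m / w) * (5 powr m * real Q powr (\<tau> * m)) / real Q"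
            using 1 2 Q1 by (intro divide_right_mono mult_mono) auto
          also have "\<dots> = 5 powr m * (real Q powr (1 - m / w) * real Q powr (\<tau> * m) * real Q powr (- 1))"
            using Q1 by (simp add: powr_minus field_simps)
          also have "real Q powr (1 - m / w) * real Q powr (\<tau> * m) * real Q powr (- 1)
              = real Q powr ((1 - m / w) + \<tau> * m + - 1)" by (simp only: powr_add)
          also have "(1 - m / w) + \<tau> * m + - 1 = - \<eta>" by (simp add: \<eta>_def algebra_simps)
          finally show "y * y powr (- m / w) * real K powr m / real Q \<le> 5 powr m * real Q powr (- \<eta>)" .
        qed (use D in auto)
        finally show ?thesis .
      qed
      have "(\<Sum>a\<in>S. g a) = (\<Sum>j\<in>T. \<Sum>a\<in>{a\<in>S. jf a = j}. g a)"
        by (rule sum.group[symmetric]) (use finS in \<open>auto simp: T_def\<close>)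
      also have "\<dots> \<le> (\<Sum>j\<in>T. D * (real Q powr (- \<delta>) + 5 powr m * real Q powr (- \<eta>)))"
        by (intro sum_mono dyadic)
      also have "\<dots> = real (card T) * (D * (real Q powr (- \<delta>) + 5 powr m * real Q powr (- \<eta>)))" by simp
      also have "\<dots> \<le> (log 2 (real Q) + 1) * (D * (real Q powr (- \<delta>) + 5 powr m * real Q powr (- \<eta>)))"
        using cardT D by (intro mult_right_mono) auto
      also have "\<dots> \<le> \<epsilon>" using elim by simp
      finally show "(\<Sum>a\<in>small_set A X (real Q powr (1 - \<delta>)) K. (1 / (real E * of_int (a $ None))) ^ CARD('d)) \<le> \<epsilon>"
        by (simp add: S_def g_def)
    qed
  qed
qed

text \<open>The pigeonhole argument covers the cube of radius \<open>a\<close> by cubes of radius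
  \<open>1 / (E * q)\<close> about points \<open>v / q\<close>. By \<open>small\<close>, those with
  \<open>q < q0\<close> make up at most half of its volume. The others have radius at most
  \<open>b\<close>, and radius \<open>3 * b\<close> lets a maximal \<open>2 * b\<close>-separated
  set \<open>P\<close> of their centres serve for all of them. Comparing volumes bounds
  \<open>card P\<close>.\<close>

lemma ex_separated_rational_centres:
  fixes A :: "real^'m^('d::finite) option" and x0 :: "real^'d"
  assumes EK: "1 \<le> E" "1 \<le> K" and Q: "E ^ CARD('d) * K ^ CARD('m) \<le> Q"
    and a: "0 < a" and q0: "1 \<le> q0" and X: "infnorm x0 + a + 1 \<le> X"
    and b: "b = 1 / (real E * q0)"
    and small: "(\<Sum>a\<in>small_set A X q0 K. (1 / (real E * of_int (a $ None))) ^ CARD('d)) \<le> a ^ CARD('d) / 2"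
  obtains P where "finite P" "\<And>p p'. \<lbrakk>p \<in> P; p' \<in> P; p \<noteq> p'\<rbrakk> \<Longrightarrow> 2 * b \<le> infnorm (p - p')"
    "(a / (3 * b)) ^ CARD('d) / 2 \<le> real (card P)"
    "\<And>p. p \<in> P \<Longrightarrow> infnorm (p - x0) \<le> a + b"
    "\<And>p. p \<in> P \<Longrightarrow> \<exists>q v. q0 \<le> real q \<and> q \<le> Q \<and> (\<forall>i. real q * p $ i = of_int (v $ i)) \<and>
      int_dist (of_int_vec (opt_vec (int q) v) v* A) < 1 / real K"
proof -
  have b0: "0 < b" using EK q0 by (simp add: b)
  have X1: "1 \<le> X" using X a infnorm_pos_le[of x0] by linarith
  define good where "good = (\<lambda>(q, v). q0 \<le> real q \<and> q \<le> Q \<and> int_dist (of_int_vec (opt_vec (int q) v) v* A) < 1 / real K)"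
  define cen where "cen = (\<lambda>(q, v). (\<chi> i. of_int (v $ i) / real q) :: real^'d)"
  define Y where "Y = real Q * (infnorm x0 + a + b)"
  define Z where "Z = {z \<in> cen ` {qv. good qv}. infnorm (z - x0) \<le> a + b}"
  have "finite Z"
  proof (rule finite_subset)
    show "finite (cen ` ({..Q} \<times> {v. infnorm (of_int_vec v) \<le> Y}))"
      by (intro finite_imageI finite_cartesian_product finite_int_vec_ball) simp
    show "Z \<subseteq> cen ` ({..Q} \<times> {v. infnorm (of_int_vec v) \<le> Y})"
    proof
      fix z assume "z \<in> Z"
      then obtain q v where z: "z = cen (q, v)" "good (q, v)" "infnorm (z - x0) \<le> a + b" by (auto simp: Z_def)
      have q: "1 \<le> real q" "real q \<le> real Q" using z(2) q0 by (auto simp: good_def)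
      have "infnorm (of_int_vec v) \<le> Y" unfolding infnorm_le_iff_cart
      proof
        fix i
        have "\<bar>z $ i - x0 $ i\<bar> \<le> a + b" using z(3) by (simp add: infnorm_le_iff_cart)
        then have zi: "\<bar>z $ i\<bar> \<le> infnorm x0 + a + b" using component_le_infnorm_cart[of x0 i] by linarith
        have "of_int_vec v $ i = real q * z $ i" using q by (simp add: z(1) cen_def)
        then have "\<bar>of_int_vec v $ i\<bar> = real q * \<bar>z $ i\<bar>" by (simp add: abs_mult)
        also have "\<dots> \<le> Y" unfolding Y_def using q zi by (intro mult_mono) auto
        finally show "\<bar>of_int_vec v $ i\<bar> \<le> Y" .
      qed
      then show "z \<in> cen ` ({..Q} \<times> {v. infnorm (of_int_vec v) \<le> Y})"
        using z q by auto
    qed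
  qed
  then obtain P where P: "P \<subseteq> Z" "\<And>p p'. \<lbrakk>p \<in> P; p' \<in> P; p \<noteq> p'\<rbrakk> \<Longrightarrow> 2 * b \<le> infnorm (p - p')"
    "\<And>z. z \<in> Z \<Longrightarrow> z \<in> P \<or> (\<exists>p\<in>P. infnorm (z - p) < 2 * b)"
    using ex_maximal_separated_subset by metis
  have finP: "finite P" using P(1) \<open>finite Z\<close> by (rule finite_subset)
  define S where "S = small_set A X q0 K"
  have finS: "finite S" unfolding S_def by (rule finite_small_set[OF X1])
  define c where "c = case_sum (\<lambda>a::int^'d option. (\<chi> i. of_int (a $ Some i) / of_int (a $ None)) :: real^'d) (\<lambda>p. p)"
  define t where "t = case_sum (\<lambda>a::int^'d option. 1 / (real E * of_int (a $ None))) (\<lambda>p::real^'d. 3 * b)"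
  have "a ^ CARD('d) \<le> (\<Sum>i\<in>S <+> P. t i ^ CARD('d))"
  proof (rule cube_cover_volume[where c = c])
    show "finite (S <+> P)" using finS finP by simp
    show "0 \<le> t i" if "i \<in> S <+> P" for i
      using that b0 by (auto simp: t_def S_def small_set_def)
    show "0 \<le> a" using a by simp
    fix x :: "real^'d" assume x: "infnorm (x - x0) \<le> a"
    obtain q v where qv: "1 \<le> q" "q \<le> Q" "\<And>i. \<bar>real q * x $ i - of_int (v $ i)\<bar> < 1 / real E"
      "int_dist (of_int_vec (opt_vec (int q) v) v* A) < 1 / real K"
      using dirichlet_near_affine_subspace[OF EK Q, of x A] by metis
    have q1: "1 \<le> real q" using qv by simp
    have close: "\<bar>x $ i - of_int (v $ i) / real q\<bar> \<le> 1 / (real E * real q)" for i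
    proof -
      have "\<bar>x $ i - of_int (v $ i) / real q\<bar> = \<bar>real q * x $ i - of_int (v $ i)\<bar> / real q"
      proof -
        have "x $ i - of_int (v $ i) / real q = (real q * x $ i - of_int (v $ i)) / real q"
          using q1 by (simp add: field_simps)
        then show ?thesis by (simp add: abs_divide)
      qed
      also have "\<dots> \<le> (1 / real E) / real q" using qv(3)[of i] q1 by (intro divide_right_mono) auto
      finally show ?thesis by simp
    qed
    show "\<exists>i\<in>S <+> P. infnorm (x - c i) \<le> t i"
    proof (cases "real q < q0")
      case True
      have "opt_vec (int q) v \<in> S"
        unfolding S_def small_set_def
      proof (intro CollectI conjI allI)
        fix i
        \<comment> \<open>The summand 1 in the bound for \<open>X\<close> makes room for the
          distance from \<open>x\<close> to its centre \<open>v / q\<close>.\<close>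
        have "1 / (real E * real q) \<le> 1"
        proof -
          have "1 * 1 \<le> real E * real q" using EK q1 by (intro mult_mono) auto
          then show ?thesis by (simp add: divide_le_eq)
        qed
        moreover have "\<bar>x $ i - x0 $ i\<bar> \<le> a" using x by (simp add: infnorm_le_iff_cart)
        ultimately have "\<bar>of_int (v $ i) / real q\<bar> \<le> X"
          using close[of i] component_le_infnorm_cart[of x0 i] X by linarith
        then show "\<bar>real_of_int (opt_vec (int q) v $ Some i)\<bar> \<le> X * real_of_int (opt_vec (int q) v $ None)"
          using q1 by (simp add: abs_divide pos_divide_le_eq)
      qed (use True qv in auto)
      moreover have "infnorm (x - c (Inl (opt_vec (int q) v))) \<le> t (Inl (opt_vec (int q) v))"
        using close by (simp add: infnorm_le_iff_cart c_def t_def)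
      ultimately show ?thesis by blast
    next
      case False
      define z where "z = cen (q, v)"
      have xz: "infnorm (x - z) \<le> b"
        unfolding infnorm_le_iff_cart
      proof
        fix i
        have "1 / (real E * real q) \<le> b" unfolding b using False EK q0
          by (intro divide_left_mono mult_left_mono mult_pos_pos) auto
        then show "\<bar>(x - z) $ i\<bar> \<le> b" using close[of i] by (simp add: z_def cen_def)
      qed
      have "infnorm (z - x0) \<le> infnorm (z - x) + infnorm (x - x0)"
        using infnorm_triangle[of "z - x" "x - x0"] by simp
      then have "z \<in> Z" using xz x False qv by (auto simp: Z_def z_def good_def infnorm_sub[of _ x])
      then consider "z \<in> P" | p where "p \<in> P" "infnorm (z - p) < 2 * b" using P(3) by blast
      then obtain p where p: "p \<in> P" "infnorm (z - p) \<le> 2 * b"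
        by cases (use b0 in \<open>auto simp: infnorm_0 less_imp_le\<close>)
      have "infnorm (x - p) \<le> infnorm (x - z) + infnorm (z - p)"
        using infnorm_triangle[of "x - z" "z - p"] by simp
      then have "infnorm (x - c (Inr p)) \<le> t (Inr p)" using xz p by (simp add: c_def t_def)
      then show ?thesis using p by blast
    qed
  qed
  also have "\<dots> = (\<Sum>a\<in>S. (1 / (real E * of_int (a $ None))) ^ CARD('d)) + real (card P) * (3 * b) ^ CARD('d)"
    using finS finP by (simp add: sum.Plus t_def)
  finally have "a ^ CARD('d) / 2 \<le> real (card P) * (3 * b) ^ CARD('d)" using small by (simp add: S_def)
  then have cardP: "(a / (3 * b)) ^ CARD('d) / 2 \<le> real (card P)"
    using b0 by (simp add: power_divide divide_le_eq)
  show ?thesis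
  proof (rule that[of P])
    show "finite P" by (rule finP)
    show "2 * b \<le> infnorm (p - p')" if "p \<in> P" "p' \<in> P" "p \<noteq> p'" for p p' using P(2) that .
    show "(a / (3 * b)) ^ CARD('d) / 2 \<le> real (card P)" by (rule cardP)
    fix p assume "p \<in> P"
    then have "p \<in> Z" using P(1) by blast
    then show "infnorm (p - x0) \<le> a + b" by (simp add: Z_def)
    from \<open>p \<in> Z\<close> obtain q v where "p = cen (q, v)" "good (q, v)" by (auto simp: Z_def)
    then show "\<exists>q v. q0 \<le> real q \<and> q \<le> Q \<and> (\<forall>i. real q * p $ i = of_int (v $ i)) \<and>
        int_dist (of_int_vec (opt_vec (int q) v) v* A) < 1 / real K"
      using q0 by (intro exI[of _ q] exI[of _ v]) (auto simp: good_def cen_def)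
  qed
qed

lemma eventually_powr_dominated:
  fixes x y c :: real
  assumes "x < y"
  shows "\<forall>\<^sub>F Q::nat in sequentially. c * real Q powr x \<le> real Q powr y"
proof -
  have "filterlim (\<lambda>Q::nat. real Q powr (y - x)) at_top sequentially"
    using assms by real_asymp
  then have "\<forall>\<^sub>F Q::nat in sequentially. c \<le> real Q powr (y - x)"
    by (simp add: filterlim_at_top)
  then show ?thesis
  proof eventually_elim
    case (elim Q)
    then have "c * real Q powr x \<le> real Q powr (y - x) * real Q powr x" by (intro mult_right_mono) auto
    then show ?case by (simp flip: powr_add)
  qed
qed

text \<open>Moving \<open>x\<close> away from the centre \<open>v / q\<close> so that
  \<open>q x\<close> changes by \<open>u\<close> costs \<open>u\<close> in the first coordinates and
  at most \<open>\<Lambda> * u\<close> in those produced by \<open>A\<close>.\<close>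

lemma int_dist_affine_param_lessI:
  fixes A :: "real^'m::finite^('d::finite) option"
  assumes \<Lambda>: "\<And>v::real^'d. infnorm (opt_vec 0 v v* A) \<le> \<Lambda> * infnorm v" "0 \<le> \<Lambda>"
    and v: "infnorm (real q *\<^sub>R x - of_int_vec v) \<le> u"
    and A: "int_dist (of_int_vec (opt_vec (int q) v) v* A) < t"
  shows "int_dist (real q *\<^sub>R affine_param A x) < t + (1 + \<Lambda>) * u"
proof -
  obtain p where p: "infnorm (of_int_vec (opt_vec (int q) v) v* A - of_int_vec p) < t"
    using A unfolding int_dist_less_iff by blast
  have t: "0 < t" using p infnorm_pos_le[of "of_int_vec (opt_vec (int q) v) v* A - of_int_vec p"] by linarith
  have u: "0 \<le> u" using v infnorm_pos_le[of "real q *\<^sub>R x - of_int_vec v"] by linarith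
  have \<Lambda>u: "0 \<le> \<Lambda> * u" using \<Lambda>(2) u by simp
  define P :: "int^('d + 'm)" where "P = (\<chi> k. case k of Inl i \<Rightarrow> v $ i | Inr j \<Rightarrow> p $ j)"
  have "infnorm (real q *\<^sub>R affine_param A x - of_int_vec P) < t + (1 + \<Lambda>) * u"
    unfolding infnorm_less_iff_sum
  proof (intro conjI allI)
    fix i
    have "\<bar>(real q *\<^sub>R x - of_int_vec v) $ i\<bar> \<le> u" using v unfolding infnorm_le_iff_cart by blast
    then show "\<bar>(real q *\<^sub>R affine_param A x - of_int_vec P) $ Inl i\<bar> < t + (1 + \<Lambda>) * u"
      using t \<Lambda>u by (simp add: affine_param_def P_def algebra_simps)
  next
    fix j
    have "real q *\<^sub>R extend_one x = of_int_vec (opt_vec (int q) v) + opt_vec 0 (real q *\<^sub>R x - of_int_vec v)"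
      by (simp add: vec_eq_iff_option extend_one_eq)
    then have "real q *\<^sub>R (extend_one x v* A) =
        of_int_vec (opt_vec (int q) v) v* A + opt_vec 0 (real q *\<^sub>R x - of_int_vec v) v* A"
      by (simp only: vector_matrix_left_distrib scaleR_vector_matrix_assoc[symmetric])
    then have "real q * (extend_one x v* A) $ j =
        (of_int_vec (opt_vec (int q) v) v* A) $ j + (opt_vec 0 (real q *\<^sub>R x - of_int_vec v) v* A) $ j"
      by (metis vector_add_component vector_scaleR_component real_scaleR_def)
    moreover have "\<bar>(of_int_vec (opt_vec (int q) v) v* A) $ j - of_int (p $ j)\<bar> < t"
      using p unfolding infnorm_less_iff_cart by simp
    moreover have "\<bar>(opt_vec 0 (real q *\<^sub>R x - of_int_vec v) v* A) $ j\<bar> \<le> \<Lambda> * u"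
    proof -
      have "\<bar>(opt_vec 0 (real q *\<^sub>R x - of_int_vec v) v* A) $ j\<bar> \<le> \<Lambda> * infnorm (real q *\<^sub>R x - of_int_vec v)"
        using \<Lambda>(1) component_le_infnorm_cart order_trans by blast
      also have "\<dots> \<le> \<Lambda> * u" using v \<Lambda>(2) by (rule mult_left_mono)
      finally show ?thesis .
    qed
    ultimately show "\<bar>(real q *\<^sub>R affine_param A x - of_int_vec P) $ Inr j\<bar> < t + (1 + \<Lambda>) * u"
      using u by (simp add: affine_param_def P_def algebra_simps)
  qed
  then show ?thesis unfolding int_dist_less_iff by blast
qed

text \<open>Up to constants, with \<open>y = Q\<close> large: \<open>K\<close> is
  \<open>y powr \<tau>\<close>, \<open>E\<close> is \<open>y powr ((1 - m * \<tau>) / d)\<close>,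
  denominators are at least \<open>q0 = y powr (1 - \<delta>)\<close>, centres are
  \<open>2 * b\<close> apart with \<open>b = 1 / (E * q0)\<close>, and the subballs have radius
  \<open>y powr (- 1 - \<tau>)\<close>. This yields
  \<open>y powr (1 - m * \<tau> + d * (1 - \<delta>))\<close> centres, while
  \<open>y powr (s * (1 + \<tau>))\<close> are required for small sets \<open>U\<close>. The second
  hypothesis on \<open>s\<close> allows this once \<open>d * \<delta>\<close> is below
  \<open>gap\<close>.\<close>

lemma ex_good_subballs:
  fixes A :: "real^'m::finite^('d::finite) option" and x0 :: "real^'d"
  defines "d \<equiv> real CARD('d)" and "m \<equiv> real CARD('m)"
  assumes w: "dioph_exponent A < ereal w" "m < w" and \<tau>: "0 < \<tau>" "\<tau> * w < 1" "1 \<le> (d + m) * \<tau>"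
    and s: "0 < s" "s * (1 + \<tau>) < d + 1 - m * \<tau>" and r: "0 < r" "r \<le> 1"
  shows "\<exists>P r'. finite P \<and> P \<noteq> {} \<and> 0 < r' \<and> r' \<le> r / 2 \<and>
      (\<forall>p\<in>P. cball p r' \<subseteq> cball x0 r \<inter>
        {x. \<exists>q\<ge>k. 0 < q \<and> int_dist (real q *\<^sub>R affine_param A x) < real q powr (- \<tau>)}) \<and>
      (\<forall>U t. 0 < t \<longrightarrow> (\<forall>x\<in>U. \<forall>y\<in>U. dist x y \<le> t) \<longrightarrow>
        real (card {p\<in>P. U \<inter> cball p r' \<noteq> {}}) * min 1 (2 * (30 * d) ^ CARD('d) * (t / r') powr s)
          \<le> real (card P) * min 1 (2 * (30 * d) ^ CARD('d) * (t / r) powr s))"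
proof -
  have d: "1 \<le> d" and m: "1 \<le> m" by (simp_all add: d_def m_def Suc_le_eq)
  have m\<tau>: "m * \<tau> < 1"
    using mult_strict_left_mono[OF w(2) \<tau>(1)] \<tau>(2) unfolding mult.commute[of m] by linarith
  \<comment> \<open>From \<open>1 \<le> (d + m) * \<tau>\<close> one has
    \<open>d + 1 - m * \<tau> \<le> d * (1 + \<tau>)\<close>.\<close>
  have sd: "s < d"
  proof -
    have "s * (1 + \<tau>) < d * (1 + \<tau>)" using s \<tau> by (simp add: algebra_simps)
    then show ?thesis using \<tau> by simp
  qed
  define gap where "gap = d + 1 - m * \<tau> - s * (1 + \<tau>)"
  define \<delta> where "\<delta> = min (1 / 2) (gap / (2 * d))"
  have gap: "0 < gap" using s by (simp add: gap_def)
  have \<delta>: "0 < \<delta>" "\<delta> < 1" using gap d by (auto simp: \<delta>_def)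
  have d\<delta>: "d * \<delta> < gap"
  proof -
    have "d * \<delta> \<le> d * (gap / (2 * d))" using d by (intro mult_left_mono) (auto simp: \<delta>_def)
    also have "\<dots> < gap" using d gap by simp
    finally show ?thesis .
  qed
  \<comment> \<open>A cube of radius \<open>a\<close> lies in the Euclidean ball of radius
    \<open>r / 2\<close>, which leaves \<open>r / 2\<close> for \<open>(d + 1) * b\<close>: the
    overhang of the centres and the radius \<open>r'\<close>.\<close>
  define a where "a = r / (2 * d)"
  have a: "0 < a" using r d by (simp add: a_def)
  define X where "X = infnorm x0 + a + 1"
  have X1: "1 \<le> X" using a infnorm_pos_le[of x0] by (simp add: X_def)
  obtain \<Lambda> where \<Lambda>: "0 < \<Lambda>" "\<And>v::real^'d. infnorm (opt_vec 0 v v* A) \<le> \<Lambda> * infnorm v"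
    using linear_infnorm_bound[OF linear_opt_vec_0[of A]] by blast
  \<comment> \<open>Half of the permitted distance goes to moving within a subball;
    \<open>K \<ge> 4 * y powr \<tau>\<close> spends a quarter on the centre itself.\<close>
  define \<gamma> where "\<gamma> = 1 / (2 * (1 + \<Lambda>))"
  have \<gamma>: "0 < \<gamma>" "\<gamma> \<le> 1" "(1 + \<Lambda>) * \<gamma> = 1 / 2" using \<Lambda> by (auto simp: \<gamma>_def field_simps)
  \<comment> \<open>Collects the constants of \<open>N2\<close> and of the lower bound for
    \<open>card P\<close>, so that one comparison of powers of \<open>Q\<close> suffices.\<close>
  define c where "c = 5 ^ CARD('d) * (r / \<gamma>) powr s * 2 * (6 * d / r) ^ CARD('d) * 2 ^ CARD('d) * 5 ^ CARD('m)"
  have "\<forall>\<^sub>F Q::nat in sequentially. \<forall>E K :: nat. 1 \<le> E \<longrightarrow> 1 \<le> K \<longrightarrow> real K \<le> 5 * real Q powr \<tau> \<longrightarrow>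
     real Q \<le> (2 * real E) ^ CARD('d) * real K ^ CARD('m) \<longrightarrow>
     (\<Sum>a\<in>small_set A X (real Q powr (1 - \<delta>)) K. (1 / (real E * of_int (a $ None))) ^ CARD('d)) \<le> a ^ CARD('d) / 2"
    using w \<tau> \<delta> X1 a by (intro small_denominators_negligible) (auto simp: m_def)
  moreover have "\<forall>\<^sub>F Q::nat in sequentially. 5 ^ CARD('m) * real Q powr (m * \<tau>) \<le> real Q powr 1"
    using m\<tau> by (rule eventually_powr_dominated)
  moreover have "\<forall>\<^sub>F Q::nat in sequentially. (real k + 1) * real Q powr 0 \<le> real Q powr (1 - \<delta>)"
    using \<delta> by (intro eventually_powr_dominated) auto
  moreover have "\<forall>\<^sub>F Q::nat in sequentially. (2 * (d + 1) / r) * real Q powr 0 \<le> real Q powr (1 - \<delta>)"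
    using \<delta> by (intro eventually_powr_dominated) auto
  moreover have "\<forall>\<^sub>F Q::nat in sequentially. c * real Q powr (s * (1 + \<tau>)) \<le> real Q powr (1 - m * \<tau> + d * (1 - \<delta>))"
    using d\<delta> by (intro eventually_powr_dominated) (simp add: gap_def algebra_simps)
  moreover have "\<forall>\<^sub>F Q::nat in sequentially. 1 \<le> Q" by (rule eventually_ge_at_top)
  ultimately have "\<forall>\<^sub>F Q::nat in sequentially. (\<forall>E K :: nat. 1 \<le> E \<longrightarrow> 1 \<le> K \<longrightarrow> real K \<le> 5 * real Q powr \<tau> \<longrightarrow>
     real Q \<le> (2 * real E) ^ CARD('d) * real K ^ CARD('m) \<longrightarrow>
     (\<Sum>a\<in>small_set A X (real Q powr (1 - \<delta>)) K. (1 / (real E * of_int (a $ None))) ^ CARD('d)) \<le> a ^ CARD('d) / 2) \<and>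
     5 ^ CARD('m) * real Q powr (m * \<tau>) \<le> real Q powr 1 \<and>
     (real k + 1) * real Q powr 0 \<le> real Q powr (1 - \<delta>) \<and>
     (2 * (d + 1) / r) * real Q powr 0 \<le> real Q powr (1 - \<delta>) \<and>
     c * real Q powr (s * (1 + \<tau>)) \<le> real Q powr (1 - m * \<tau> + d * (1 - \<delta>)) \<and> 1 \<le> Q"
    by (intro eventually_conj)
  then obtain Q :: nat where Qsmall: "\<And>E K :: nat. \<lbrakk>1 \<le> E; 1 \<le> K; real K \<le> 5 * real Q powr \<tau>;
     real Q \<le> (2 * real E) ^ CARD('d) * real K ^ CARD('m)\<rbrakk> \<Longrightarrow>
     (\<Sum>a\<in>small_set A X (real Q powr (1 - \<delta>)) K. (1 / (real E * of_int (a $ None))) ^ CARD('d)) \<le> a ^ CARD('d) / 2"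
     and Q5: "5 ^ CARD('m) * real Q powr (m * \<tau>) \<le> real Q powr 1"
     and Qk: "(real k + 1) * real Q powr 0 \<le> real Q powr (1 - \<delta>)"
     and Qr: "(2 * (d + 1) / r) * real Q powr 0 \<le> real Q powr (1 - \<delta>)"
     and Qc: "c * real Q powr (s * (1 + \<tau>)) \<le> real Q powr (1 - m * \<tau> + d * (1 - \<delta>))" and Q1: "1 \<le> Q"
    using eventually_happens'[OF sequentially_bot] by blast
  define y where "y = real Q"
  have y: "1 \<le> y" using Q1 by (simp add: y_def)
  define q0 where "q0 = y powr (1 - \<delta>)"
  have q0: "real k + 1 \<le> q0" "2 * (d + 1) / r \<le> q0" using Qk Qr y by (auto simp: q0_def y_def)
  have q01: "1 \<le> q0" using q0 by linarith
  define K where "K = nat \<lceil>4 * y powr \<tau>\<rceil>"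
  have y\<tau>: "1 \<le> y powr \<tau>" using y \<tau> by (simp add: ge_one_powr_ge_zero)
  have K: "4 * y powr \<tau> \<le> real K" "real K \<le> 5 * y powr \<tau>" "1 \<le> K"
  proof -
    show 1: "4 * y powr \<tau> \<le> real K" using y\<tau> unfolding K_def by linarith
    show "real K \<le> 5 * y powr \<tau>" using y\<tau> unfolding K_def by linarith
    show "1 \<le> K" using 1 y\<tau> by linarith
  qed
  define Km where "Km = real K ^ CARD('m)"
  have Km0: "0 < Km" using K by (simp add: Km_def)
  have Km1: "Km \<le> 5 ^ CARD('m) * y powr (m * \<tau>)"
  proof -
    have "Km \<le> (5 * y powr \<tau>) ^ CARD('m)" unfolding Km_def by (rule power_mono[OF K(2)]) simp
    also have "\<dots> = 5 ^ CARD('m) * y powr (m * \<tau>)"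
      using y by (simp add: power_mult_distrib m_def powr_powr mult.commute flip: powr_realpow)
    finally show ?thesis .
  qed
  have Km2: "y powr (m * \<tau>) \<le> Km"
  proof -
    have "(y powr \<tau>) ^ CARD('m) \<le> Km" unfolding Km_def using K(1) y\<tau> by (intro power_mono) auto
    then show ?thesis using y by (simp add: m_def powr_powr mult.commute flip: powr_realpow)
  qed
  \<comment> \<open>The number of cells left for the first \<open>d\<close> coordinates after the
    \<open>K ^ m\<close> cells of the others are paid for.\<close>
  define V where "V = y / Km"
  have V1: "1 \<le> V" using Km1 Q5 Km0 y by (simp add: V_def y_def)
  define E where "E = nat \<lfloor>V powr (1 / d)\<rfloor>"
  have Vd1: "1 \<le> V powr (1 / d)" using V1 d by (simp add: ge_one_powr_ge_zero)
  have E: "1 \<le> E" "real E \<le> V powr (1 / d)" "V powr (1 / d) \<le> 2 * real E"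
  proof -
    show 1: "1 \<le> E" unfolding E_def using Vd1 by linarith
    show "real E \<le> V powr (1 / d)" unfolding E_def using Vd1 by linarith
    have "V powr (1 / d) \<le> real E + 1" unfolding E_def using Vd1 by linarith
    then show "V powr (1 / d) \<le> 2 * real E" using 1 by linarith
  qed
  have Vd: "(V powr (1 / d)) ^ CARD('d) = V"
    using V1 d by (simp add: d_def powr_powr flip: powr_realpow)
  have EKQ: "E ^ CARD('d) * K ^ CARD('m) \<le> Q"
  proof -
    have "real E ^ CARD('d) \<le> V" using power_mono[OF E(2), of "CARD('d)"] Vd by simp
    then have "real E ^ CARD('d) * Km \<le> y" using Km0 by (simp add: V_def pos_le_divide_eq)
    then have "real (E ^ CARD('d) * K ^ CARD('m)) \<le> real Q" by (simp add: Km_def y_def)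
    then show ?thesis by (simp only: of_nat_le_iff)
  qed
  have VE: "V \<le> (2 * real E) ^ CARD('d)" using power_mono[OF E(3), of "CARD('d)"] Vd by simp
  have QEK: "real Q \<le> (2 * real E) ^ CARD('d) * real K ^ CARD('m)"
    using VE Km0 by (simp add: V_def pos_divide_le_eq Km_def y_def)
  \<comment> \<open>Here \<open>1 \<le> (d + m) * \<tau>\<close> gives
    \<open>(1 - m * \<tau>) / d \<le> \<tau>\<close>; the bound for \<open>E\<close> then yields
    \<open>r' \<le> b\<close>.\<close>
  have Ey: "real E \<le> y powr \<tau>"
  proof -
    have "V \<le> y / y powr (m * \<tau>)" unfolding V_def using Km2 Km0 y by (intro divide_left_mono mult_pos_pos) auto
    also have "\<dots> = y powr (1 - m * \<tau>)" using y by (simp add: powr_diff)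
    finally have "V powr (1 / d) \<le> (y powr (1 - m * \<tau>)) powr (1 / d)"
      using V1 d by (intro powr_mono2) auto
    also have "\<dots> = y powr ((1 - m * \<tau>) / d)" by (simp add: powr_powr)
    also have "\<dots> \<le> y powr \<tau>"
      using y d \<tau> by (intro powr_mono) (auto simp: field_simps)
    finally show ?thesis using E by linarith
  qed
  define b where "b = 1 / (real E * q0)"
  have Eq0: "1 \<le> real E * q0" using E q01 mult_mono[of 1 "real E" 1 q0] by simp
  have b0: "0 < b" using Eq0 by (simp add: b_def)
  have br: "(d + 1) * b \<le> r / 2"
  proof -
    have "1 * q0 \<le> real E * q0" using E q01 by (intro mult_right_mono) auto
    then have "2 * (d + 1) / r \<le> real E * q0" using q0 by linarith
    then have "2 * (d + 1) \<le> r * (real E * q0)" using r by (simp add: pos_divide_le_eq mult.commute)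
    then show ?thesis using Eq0 by (simp add: b_def field_simps)
  qed
  define r' where "r' = \<gamma> * y powr (- (1 + \<tau>))"
  have r'0: "0 < r'" using \<gamma> y by (simp add: r'_def)
  have r'b: "r' \<le> b"
  proof -
    have "r' * (real E * q0) \<le> (1 * y powr (- (1 + \<tau>))) * (y powr \<tau> * y powr 1)"
      unfolding r'_def q0_def using \<gamma> Ey y \<delta> by (intro mult_mono powr_mono) auto
    also have "\<dots> = 1" using y unfolding mult_1 powr_add[symmetric] by simp
    finally show ?thesis using Eq0 by (simp add: b_def pos_le_divide_eq)
  qed
  obtain P where P: "finite P" "\<And>p p'. \<lbrakk>p \<in> P; p' \<in> P; p \<noteq> p'\<rbrakk> \<Longrightarrow> 2 * b \<le> infnorm (p - p')"
    "(a / (3 * b)) ^ CARD('d) / 2 \<le> real (card P)"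
    "\<And>p. p \<in> P \<Longrightarrow> infnorm (p - x0) \<le> a + b"
    "\<And>p. p \<in> P \<Longrightarrow> \<exists>q v. q0 \<le> real q \<and> q \<le> Q \<and> (\<forall>i. real q * p $ i = of_int (v $ i)) \<and>
      int_dist (of_int_vec (opt_vec (int q) v) v* A) < 1 / real K"
  proof (rule ex_separated_rational_centres[OF E(1) K(3) EKQ a q01 _ b_def])
    show "infnorm x0 + a + 1 \<le> X" by (simp add: X_def)
    show "(\<Sum>a\<in>small_set A X q0 K. (1 / (real E * of_int (a $ None))) ^ CARD('d)) \<le> a ^ CARD('d) / 2"
      unfolding q0_def y_def using E(1) K(3) K(2)[unfolded y_def] QEK by (rule Qsmall)
  qed blast
  have N1: "(r / (6 * real CARD('d) * b)) ^ CARD('d) / 2 \<le> real (card P)"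
    using P(3) by (simp add: a_def d_def mult_ac)
  have N2: "5 ^ CARD('d) * (r / r') powr s \<le> real (card P)"
  proof -
    have eq: "5 ^ CARD('d) * (r / r') powr s = 5 ^ CARD('d) * (r / \<gamma>) powr s * y powr (s * (1 + \<tau>))"
    proof -
      have "r / r' = (r / \<gamma>) * y powr (1 + \<tau>)" 
        unfolding r'_def powr_minus[of y "1 + \<tau>"] by (simp add: divide_inverse)
      then have "(r / r') powr s = (r / \<gamma>) powr s * (y powr (1 + \<tau>)) powr s" by (simp only: powr_mult)
      then show ?thesis by (simp add: powr_powr mult.commute)
    qed
    have "c * y powr (s * (1 + \<tau>)) \<le> (2 ^ CARD('d) * 5 ^ CARD('m)) * (1 / b) ^ CARD('d)"
    proof -
      have "y powr (1 - m * \<tau> + d * (1 - \<delta>)) = y / y powr (m * \<tau>) * q0 ^ CARD('d)"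
      proof -
        have "q0 ^ CARD('d) = q0 powr d" using q01 by (simp add: d_def powr_realpow)
        also have "\<dots> = y powr (d * (1 - \<delta>))" unfolding q0_def powr_powr by (simp only: mult.commute)
        finally have "q0 ^ CARD('d) = y powr (d * (1 - \<delta>))" .
        moreover have "y powr (1 - m * \<tau>) = y / y powr (m * \<tau>)" using y by (simp add: powr_diff)
        ultimately show ?thesis by (simp only: powr_add)
      qed
      also have "\<dots> \<le> (5 ^ CARD('m) * V) * q0 ^ CARD('d)"
      proof (rule mult_right_mono)
        have "y / y powr (m * \<tau>) \<le> y / (Km / 5 ^ CARD('m))"
          using Km1 Km0 y by (intro divide_left_mono mult_pos_pos) (auto simp: pos_divide_le_eq mult.commute)
        then show "y / y powr (m * \<tau>) \<le> 5 ^ CARD('m) * V" by (simp add: V_def mult.commute)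
      qed (use q01 in auto)
      also have "\<dots> \<le> (5 ^ CARD('m) * (2 * real E) ^ CARD('d)) * q0 ^ CARD('d)"
        using VE q01 by (intro mult_right_mono mult_left_mono) auto
      also have "\<dots> = (2 ^ CARD('d) * 5 ^ CARD('m)) * (1 / b) ^ CARD('d)"
        by (simp add: b_def power_mult_distrib mult_ac)
      finally show ?thesis using Qc by (simp add: y_def)
    qed
    then have "5 ^ CARD('d) * (r / \<gamma>) powr s * y powr (s * (1 + \<tau>)) * (2 * (6 * d / r) ^ CARD('d)) * (2 ^ CARD('d) * 5 ^ CARD('m))
        \<le> (1 / b) ^ CARD('d) * (2 ^ CARD('d) * 5 ^ CARD('m))" by (simp add: c_def mult_ac)
    then have "5 ^ CARD('d) * (r / \<gamma>) powr s * y powr (s * (1 + \<tau>)) * (2 * (6 * d / r) ^ CARD('d))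
        \<le> (1 / b) ^ CARD('d)" by (rule mult_right_le_imp_le) simp
    then have "5 ^ CARD('d) * (r / \<gamma>) powr s * y powr (s * (1 + \<tau>)) \<le> (1 / b) ^ CARD('d) / (2 * (6 * d / r) ^ CARD('d))"
      using d r by (subst pos_le_divide_eq) auto
    also have "\<dots> = (r / (6 * real CARD('d) * b)) ^ CARD('d) / 2"
    proof -
      have "1 / b = (r / (6 * d * b)) * (6 * d / r)" using d r by simp
      then have "(1 / b) ^ CARD('d) = (r / (6 * d * b)) ^ CARD('d) * (6 * d / r) ^ CARD('d)"
        by (metis power_mult_distrib)
      moreover have "0 < (6 * d / r) ^ CARD('d)" using d r by simp
      ultimately show ?thesis unfolding d_def[symmetric] by simp
    qed
    also have "\<dots> \<le> real (card P)" by (rule N1)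
    finally have "5 ^ CARD('d) * (r / \<gamma>) powr s * y powr (s * (1 + \<tau>)) \<le> real (card P)" .
    then show ?thesis by (simp only: eq)
  qed
  show ?thesis
  proof (intro exI[of _ P] exI[of _ r'] conjI ballI allI impI)
    show "finite P" by (rule P)
    show "P \<noteq> {}"
    proof
      assume "P = {}"
      moreover have "0 < (a / (3 * b)) ^ CARD('d) / 2" using a b0 by simp
      ultimately show False using P(3) by simp
    qed
    show "0 < r'" by (rule r'0)
    have "1 * b \<le> (d + 1) * b" using d b0 by (intro mult_right_mono) auto
    then show "r' \<le> r / 2" using r'b br by linarith
    fix p assume p: "p \<in> P"
    have "dist p x0 \<le> d * (a + b)"
      using norm_le_card_infnorm[of "p - x0"] P(4)[OF p] d unfolding dist_norm d_def
      by (smt (verit) mult_left_mono)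
    also have "\<dots> = r / 2 + d * b" using d by (simp add: a_def algebra_simps)
    finally have "dist p x0 + r' \<le> r" using r'b br by (simp add: algebra_simps)
    moreover have "cball p r' \<subseteq> {x. \<exists>q\<ge>k. 0 < q \<and> int_dist (real q *\<^sub>R affine_param A x) < real q powr (- \<tau>)}"
    proof (intro subsetI CollectI)
      fix x assume x: "x \<in> cball p r'"
      obtain q v where qv: "q0 \<le> real q" "q \<le> Q" "\<And>i. real q * p $ i = of_int (v $ i)"
        "int_dist (of_int_vec (opt_vec (int q) v) v* A) < 1 / real K" using P(5)[OF p] by blast
      have q: "real k + 1 \<le> real q" "real q \<le> y" "0 < real q" using qv q0 by (auto simp: y_def)
      have "real q *\<^sub>R x - of_int_vec v = real q *\<^sub>R (x - p)"
        using qv(3) by (simp add: vec_eq_iff algebra_simps)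
      then have "infnorm (real q *\<^sub>R x - of_int_vec v) = real q * infnorm (x - p)"
        by (simp add: infnorm_mul)
      also have "\<dots> \<le> y * r'"
        using q x infnorm_le_norm[of "x - p"] r'0 infnorm_pos_le[of "x - p"]
        by (intro mult_mono) (auto simp: dist_norm norm_minus_commute)
      also have "\<dots> = \<gamma> * y powr (- \<tau>)"
      proof -
        have "y powr 1 * y powr (- (1 + \<tau>)) = y powr (- \<tau>)" unfolding powr_add[symmetric] by simp
        moreover have "y powr 1 = y" using y by simp
        ultimately show ?thesis by (simp only: r'_def mult.left_commute)
      qed
      finally have "int_dist (real q *\<^sub>R affine_param A x) < 1 / real K + (1 + \<Lambda>) * (\<gamma> * y powr (- \<tau>))"
        using \<Lambda> qv(4) by (intro int_dist_affine_param_lessI[OF \<Lambda>(2)]) auto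
      also have "(1 + \<Lambda>) * (\<gamma> * y powr (- \<tau>)) = 1 / 2 * y powr (- \<tau>)"
        using \<gamma>(3) by (simp only: mult.assoc[symmetric])
      also have "1 / real K \<le> 1 / (4 * y powr \<tau>)"
        using K y by (intro divide_left_mono mult_pos_pos) auto
      also have "1 / (4 * y powr \<tau>) = 1 / 4 * y powr (- \<tau>)" by (simp add: powr_minus field_simps)
      also have "1 / 4 * y powr (- \<tau>) + 1 / 2 * y powr (- \<tau>) \<le> y powr (- \<tau>)" using y by simp
      also have "y powr (- \<tau>) \<le> real q powr (- \<tau>)" using q \<tau> by (intro powr_mono2') auto
      finally have "int_dist (real q *\<^sub>R affine_param A x) < real q powr (- \<tau>)" by simp
      then show "\<exists>q\<ge>k. 0 < q \<and> int_dist (real q *\<^sub>R affine_param A x) < real q powr (- \<tau>)"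
        using q by (intro exI[of _ q]) auto
    qed
    ultimately show "cball p r' \<subseteq> cball x0 r \<inter>
        {x. \<exists>q\<ge>k. 0 < q \<and> int_dist (real q *\<^sub>R affine_param A x) < real q powr (- \<tau>)}"
      by (simp add: cball_subset_cball_iff)
  next
    fix U :: "(real^'d) set" and t :: real
    assume t: "0 < t" "\<forall>x\<in>U. \<forall>y\<in>U. dist x y \<le> t"
    show "real (card {p\<in>P. U \<inter> cball p r' \<noteq> {}}) * min 1 (2 * (30 * d) ^ CARD('d) * (t / r') powr s)
          \<le> real (card P) * min 1 (2 * (30 * d) ^ CARD('d) * (t / r) powr s)"
      unfolding d_def using sd t
      by (intro card_separated_hits[OF P(1,2) b0 r'0 r'b r(1) s(1) _ N1 N2 t(1)]) (auto simp: d_def)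
  qed
qed

subsection \<open>Bounds for the dimension\<close>

lemma hausdorff_dim_approximable_ge:
  fixes A :: "real^'m::finite^('d::finite) option"
  defines "d \<equiv> real CARD('d)" and "m \<equiv> real CARD('m)"
  assumes w: "dioph_exponent A < ereal w" "m < w" and \<tau>: "0 < \<tau>" "\<tau> * w < 1" "1 \<le> (d + m) * \<tau>"
  shows "ereal ((d + 1 - m * \<tau>) / (1 + \<tau>)) \<le> hausdorff_dim (approximable \<tau> 0 \<inter> affine_subspace A)"
  unfolding hausdorff_dim_def
proof (rule INF_greatest, rule ccontr)
  fix s assume s: "s \<in> {s. 0 \<le> s \<and> hausdorff_measure s (approximable \<tau> 0 \<inter> affine_subspace A) = 0}"
    and less: "\<not> ereal ((d + 1 - m * \<tau>) / (1 + \<tau>)) \<le> ereal s"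
  define b where "b = (d + 1 - m * \<tau>) / (1 + \<tau>)"
  \<comment> \<open>The nested balls require a positive exponent. Raising \<open>s\<close> only
    lowers the sums, since all diameters are at most 1.\<close>
  define s' where "s' = max s (b / 2)"
  have "0 \<le> s" "s < b" using s less by (simp_all add: b_def)
  then have s': "0 < s'" "s \<le> s'" "s' < b" by (auto simp: s'_def)
  then have s'b: "s' * (1 + \<tau>) < d + 1 - m * \<tau>" using \<tau> by (simp add: b_def pos_less_divide_eq)
  define C where "C = 2 * (30 * d) ^ CARD('d)"
  have C1: "1 \<le> C"
  proof -
    have "1 \<le> d" by (simp add: d_def Suc_le_eq)
    then have "1 \<le> (30 * d) ^ CARD('d)" by (intro one_le_power) simp
    then show ?thesis by (simp add: C_def)
  qed
  \<comment> \<open>The cover costs less than \<open>e\<close>, the padding below adds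
    \<open>e\<close>, and \<open>C * (2 * e) = 1\<close>.\<close>
  define e where "e = 1 / (2 * C)"
  have e0: "0 < e" using C1 by (simp add: e_def)
  define S where "S = approximable \<tau> (0 :: real^('d + 'm)) \<inter> affine_subspace A"
  have "hausdorff_premeasure s 1 S \<le> hausdorff_measure s S"
    unfolding hausdorff_measure_def by (rule SUP_upper) simp
  also have "\<dots> < ennreal e" using s e0 by (simp add: S_def)
  finally obtain U where U: "S \<subseteq> (\<Union>i. U i)" "\<And>i. bounded (U i)" "\<And>i. diameter (U i) \<le> 1"
    "(\<Sum>i. hausdorff_weight s (U i)) < ennreal e"
    unfolding hausdorff_premeasure_def INF_less_iff by blast
  have diam0: "0 \<le> diameter (U i)" for i using U(2) by (rule diameter_ge_0)
  define f where "f i = diameter (U i) powr s'" for i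
  have fw: "ennreal (f i) \<le> hausdorff_weight s (U i)" for i
  proof (cases "U i = {}")
    case True
    then show ?thesis using s' by (simp add: f_def)
  next
    case False
    have "f i \<le> 1" unfolding f_def using powr_mono2[of s' "diameter (U i)" 1] s' U(3)[of i] diam0[of i] by simp
    moreover have "f i \<le> diameter (U i) powr s"
      unfolding f_def using s' U(3)[of i] diam0[of i] by (intro powr_mono') auto
    ultimately show ?thesis using False by (auto simp: hausdorff_weight_def intro: ennreal_leI)
  qed
  have f0: "0 \<le> f i" for i by (simp add: f_def)
  have "(\<Sum>i. ennreal (f i)) \<le> (\<Sum>i. hausdorff_weight s (U i))"
    by (intro suminf_le fw summableI)
  then have sume: "(\<Sum>i. ennreal (f i)) < ennreal e" using U(4) by (rule order_le_less_trans)
  then have smf: "summable f"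
    by (intro summable_suminf_not_top f0) (auto simp: top_unique)
  have fe: "(\<Sum>i. f i) < e"
    using sume suminf_ennreal2[OF f0 smf] e0 by (simp add: ennreal_less_iff suminf_nonneg smf f0)
  \<comment> \<open>A set of diameter 0 has no scale at which the descent could exclude it; the
    geometric padding gives every set a positive radius.\<close>
  define g where "g i = f i + e * (1 / 2) ^ Suc i" for i
  have geo: "(\<lambda>i. e * (1 / 2) ^ Suc i) sums (e * 1)" by (intro sums_mult power_half_series)
  have "g sums ((\<Sum>i. f i) + e * 1)"
    unfolding g_def by (intro sums_add summable_sums smf geo)
  then have g: "summable g" "(\<Sum>i. g i) < 2 * e"
    using fe by (auto dest: sums_summable sums_unique[symmetric])
  have g0: "0 < g i" for i using f0[of i] e0 by (simp add: g_def add_nonneg_pos)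
  define \<rho> where "\<rho> i = g i powr (1 / s')" for i
  have \<rho>s: "\<rho> i powr s' = g i" for i using s' g0[of i] by (simp add: \<rho>_def powr_powr)
  have \<rho>d: "diameter (U i) \<le> \<rho> i" for i
  proof -
    have "f i powr (1 / s') \<le> \<rho> i"
      unfolding \<rho>_def using s' f0[of i] e0 by (intro powr_mono2) (auto simp: g_def)
    then show ?thesis using s' diam0[of i] by (simp add: f_def powr_powr)
  qed
  define G where "G k = {x. \<exists>q\<ge>k. 0 < q \<and> int_dist (real q *\<^sub>R affine_param A x) < real q powr (- \<tau>)}" for k :: nat
  define W where "W i = {x. affine_param A x \<in> U i}" for i
  have "\<exists>x. x \<notin> (\<Union>i. W i) \<and> (\<forall>k. x \<in> G k)"
  proof (rule nested_balls_escape[where \<rho> = \<rho> and s = s' and C = C])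
    show "0 < \<rho> i" for i using g0[of i] by (simp add: \<rho>_def)
    show "summable (\<lambda>i. \<rho> i powr s')" using g by (simp add: \<rho>s)
    show "C * (\<Sum>i. \<rho> i powr s') < 1"
      using mult_strict_left_mono[OF g(2), of C] C1 by (simp add: \<rho>s e_def)
    fix i x x' assume "x \<in> W i" "x' \<in> W i"
    then have "dist (affine_param A x) (affine_param A x') \<le> diameter (U i)"
      by (intro diameter_bounded_bound U) (auto simp: W_def)
    then show "dist x x' \<le> \<rho> i" using affine_param_dist_ge[of x x' A] \<rho>d[of i] by linarith
  next
    fix x :: "real^'d" and r :: real and k :: nat assume r: "0 < r" "r \<le> 1"
    show "\<exists>P r'. finite P \<and> P \<noteq> {} \<and> 0 < r' \<and> r' \<le> r / 2 \<and> (\<forall>p\<in>P. cball p r' \<subseteq> cball x r \<inter> G k) \<and>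
      (\<forall>U t. 0 < t \<longrightarrow> (\<forall>x\<in>U. \<forall>y\<in>U. dist x y \<le> t) \<longrightarrow>
        real (card {p\<in>P. U \<inter> cball p r' \<noteq> {}}) * min 1 (C * (t / r') powr s')
          \<le> real (card P) * min 1 (C * (t / r) powr s'))"
      unfolding G_def C_def d_def
      by (rule ex_good_subballs) (use w \<tau> s' s'b r in \<open>simp_all add: d_def m_def\<close>)
  qed (use s' C1 in auto)
  then obtain x where x: "\<And>i. affine_param A x \<notin> U i" "\<And>k. x \<in> G k" by (auto simp: W_def)
  have "affine_param A x \<in> S"
    using x(2) by (auto simp: S_def affine_subspace_eq approximable_def infinite_nat_iff_unbounded_le G_def)
  then show False using U(1) x(1) by blast
qed

text \<open>An exponent \<open>e\<close> for the number of vectors becomes the dimension bound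
  \<open>e / (1 + \<tau>)\<close>. The width exponent \<open>\<tau>'\<close> may depend on
  \<open>e'\<close>, so counts of slightly wider Bohr sets suffice, at the price of a slightly
  larger exponent.\<close>

lemma hausdorff_dim_approximable_le:
  fixes A :: "real^'m::finite^('d::finite) option" and \<theta> :: "real^('d + 'm)"
  assumes \<tau>: "0 \<le> \<tau>"
    and count: "\<And>e'. e < e' \<Longrightarrow> \<exists>\<tau>' C. \<tau>' < \<tau> \<and> 0 < C \<and>
      (\<forall>R\<ge>1. real (card (bohr_set A R (R powr (- \<tau>')))) \<le> C * R powr e')"
  shows "hausdorff_dim (approximable \<tau> \<theta> \<inter> affine_subspace A) \<le> ereal (e / (1 + \<tau>))"
proof (rule hausdorff_dim_leI)
  \<comment> \<open>The count always includes \<open>0\<close>, so the exponent \<open>e\<close> cannot be negative.\<close>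
  have "0 \<le> e'" if e': "e < e'" for e'
  proof (rule ccontr)
    assume "\<not> 0 \<le> e'"
    then have "0 < - e'" by simp
    obtain \<tau>' C where C: "0 < C" "\<And>R. 1 \<le> R \<Longrightarrow> real (card (bohr_set A R (R powr (- \<tau>')))) \<le> C * R powr e'"
      using count[OF e'] by blast
    have "\<forall>\<^sub>F Q::nat in sequentially. (2 * C) * real Q powr 0 \<le> real Q powr (- e')"
      using \<open>0 < - e'\<close> by (rule eventually_powr_dominated)
    then have "\<forall>\<^sub>F Q::nat in sequentially. (2 * C) * real Q powr 0 \<le> real Q powr (- e') \<and> 1 \<le> Q"
      using eventually_ge_at_top by (rule eventually_conj)
    then obtain Q :: nat where Q: "2 * C * real Q powr 0 \<le> real Q powr (- e')" "1 \<le> Q"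
      using eventually_happens'[OF sequentially_bot] by blast
    have "int_dist (0::real^'m) = 0"
      using int_dist_le[of "0::real^'m" 0] int_dist_nonneg[of "0::real^'m"] by (simp add: infnorm_0)
    then have "0 \<in> bohr_set A (real Q) (real Q powr (- \<tau>'))"
      using Q by (simp add: bohr_set_def infnorm_0)
    then have "1 \<le> real (card (bohr_set A (real Q) (real Q powr (- \<tau>'))))"
      by (simp add: Suc_le_eq card_gt_0_iff) blast
    also have "\<dots> \<le> C * real Q powr e'" using Q by (intro C) simp
    finally have "real Q powr (- e') \<le> C * real Q powr e' * real Q powr (- e')"
      using mult_right_mono[of 1 _ "real Q powr (- e')"] by simp
    also have "\<dots> = C" using Q by (simp add: mult.assoc flip: powr_add)
    finally show False using Q C by simp
  qed
  then have "0 \<le> e" by (rule dense_ge)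
  then show "0 \<le> e / (1 + \<tau>)" using \<tau> by simp
  fix s assume s: "e / (1 + \<tau>) < s"
  then have es: "e < s * (1 + \<tau>)" using \<tau> by (simp add: pos_divide_less_eq)
  then obtain e' where e': "e < e'" "e' < s * (1 + \<tau>)" using dense by blast
  obtain \<tau>' C where C: "\<tau>' < \<tau>" "0 < C" "\<And>R. 1 \<le> R \<Longrightarrow> real (card (bohr_set A R (R powr (- \<tau>')))) \<le> C * R powr e'"
    using count[OF e'(1)] by blast
  show "hausdorff_measure s (approximable \<tau> \<theta> \<inter> affine_subspace A) = 0"
  proof (rule hausdorff_measure_approximable_eq_0[OF \<tau> C(1) _ e'(2) C(2,3)])
    show "0 < s" using s \<open>0 \<le> e / (1 + \<tau>)\<close> by linarith
  qed
qed

section \<open>Bohr sets of width \<open>R powr (- \<tau>)\<close> and the resulting upper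
  bounds\<close>

text \<open>For \<open>\<tau> * w \<le> 1\<close> the level \<open>R powr (- m / w)\<close> is at
  most \<open>R powr (- m * \<tau>)\<close>, so the main term wins.\<close>

lemma card_bohr_set_powr_exponent:
  fixes A :: "real^'m^('d::finite) option"
  assumes w: "dioph_exponent A < ereal w" "0 < w" and \<tau>: "0 \<le> \<tau>" "\<tau> * w \<le> 1"
  shows "\<exists>C>0. \<forall>R\<ge>1. real (card (bohr_set A R (R powr (- \<tau>)))) \<le> C * R powr (real CARD('d) + 1 - real CARD('m) * \<tau>)"
proof -
  define m where "m = real CARD('m)"
  obtain C where C: "0 < C" "\<And>R K. \<lbrakk>1 \<le> R; 1 \<le> K\<rbrakk> \<Longrightarrow> real (card (bohr_set A R (1 / K)))
      \<le> C * R ^ CARD('d option) * (K powr (- m) + R powr (- m / w))"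
    using card_bohr_set_exponent'[OF w] unfolding m_def by metis
  show ?thesis
  proof (intro exI[of _ "2 * C"] conjI allI impI)
    show "0 < 2 * C" using C by simp
    fix R :: real assume R: "1 \<le> R"
    have R\<tau>: "1 \<le> R powr \<tau>" using R \<tau> by (simp add: ge_one_powr_ge_zero)
    have "R powr (- \<tau>) = 1 / R powr \<tau>" by (simp add: powr_minus field_simps)
    then have "real (card (bohr_set A R (R powr (- \<tau>))))
        \<le> C * R ^ CARD('d option) * ((R powr \<tau>) powr (- m) + R powr (- m / w))"
      using C(2)[OF R R\<tau>] by simp
    also have "\<dots> \<le> C * R ^ CARD('d option) * (R powr (- m * \<tau>) + R powr (- m * \<tau>))"
    proof (intro mult_left_mono add_mono)
      show "(R powr \<tau>) powr (- m) \<le> R powr (- m * \<tau>)" by (simp add: powr_powr mult.commute)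
      have "m * \<tau> \<le> m / w" using \<tau> w by (simp add: m_def pos_le_divide_eq)
      then show "R powr (- m / w) \<le> R powr (- m * \<tau>)" using R by (intro powr_mono) auto
    qed (use C R in auto)
    also have "R ^ CARD('d option) = R powr (real CARD('d) + 1)"
    proof -
      have "real CARD('d) + 1 = real CARD('d option)" by simp
      then show ?thesis using R by (simp only: powr_realpow)
    qed
    also have "C * R powr (real CARD('d) + 1) * (R powr (- m * \<tau>) + R powr (- m * \<tau>))
        = 2 * C * (R powr (real CARD('d) + 1) * R powr (- m * \<tau>))" by simp
    also have "\<dots> = 2 * C * R powr (real CARD('d) + 1 - m * \<tau>)" by (simp flip: powr_add)
    finally show "real (card (bohr_set A R (R powr (- \<tau>)))) \<le> 2 * C * R powr (real CARD('d) + 1 - real CARD('m) * \<tau>)"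
      by (simp add: m_def)
  qed
qed

text \<open>For \<open>\<tau> \<le> w\<close> the term \<open>\<psi> * R powr w\<close> is at least
  1 and absorbs the summand 1.\<close>

lemma card_bohr_set_powr_separation:
  fixes A :: "real^'m^'k"
  assumes w: "dioph_exponent (transpose A) < ereal w" "0 < w" and \<tau>: "\<tau> \<le> w"
  shows "\<exists>C>0. \<forall>R\<ge>1. real (card (bohr_set A R (R powr (- \<tau>)))) \<le> C * R powr (real CARD('m) * (w - \<tau>))"
proof -
  obtain C where C: "0 < C" "\<And>R \<psi>. \<lbrakk>1 \<le> R; 0 < \<psi>\<rbrakk> \<Longrightarrow>
      real (card (bohr_set A R \<psi>)) \<le> C * (1 + \<psi> * R powr w) ^ CARD('m)"
    using card_bohr_set_separation[OF w] by metis
  show ?thesis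
  proof (intro exI[of _ "C * 2 ^ CARD('m)"] conjI allI impI)
    show "0 < C * 2 ^ CARD('m)" using C by simp
    fix R :: real assume R: "1 \<le> R"
    have eq: "R powr (- \<tau>) * R powr w = R powr (w - \<tau>)" by (simp add: add.commute flip: powr_add)
    have "1 \<le> R powr (w - \<tau>)" using R \<tau> by (intro ge_one_powr_ge_zero) auto
    then have "C * (1 + R powr (- \<tau>) * R powr w) ^ CARD('m) \<le> C * (2 * R powr (w - \<tau>)) ^ CARD('m)"
      using C unfolding eq by (intro mult_left_mono power_mono) auto
    also have "\<dots> = C * 2 ^ CARD('m) * R powr (real CARD('m) * (w - \<tau>))"
      using R by (simp add: power_mult_distrib powr_powr mult.commute flip: powr_realpow)
    finally show "real (card (bohr_set A R (R powr (- \<tau>)))) \<le> C * 2 ^ CARD('m) * R powr (real CARD('m) * (w - \<tau>))"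
      using C(2)[of R "R powr (- \<tau>)"] R by simp
  qed
qed

text \<open>Dirichlet's bound read off from counting: with width \<open>R powr (- 0) = 1\<close> the
  Bohr set is the whole box, of at least \<open>Q powr k\<close> elements, whereas an exponent bound
  \<open>w\<close> would allow only about \<open>Q powr (m * w)\<close>. It keeps
  \<open>\<tau>\<close> nonnegative in the last two cases of the theorem.\<close>

lemma dioph_exponent_transpose_ge:
  fixes A :: "real^'m^'k"
  shows "ereal (real CARD('k) / real CARD('m)) \<le> dioph_exponent (transpose A)"
proof (rule ccontr)
  assume less: "\<not> ?thesis"
  define k where "k = real CARD('k)"
  define m where "m = real CARD('m)"
  have m: "0 < m" by (simp add: m_def)
  have "dioph_exponent (transpose A) < ereal (k / m)" using less by (simp add: k_def m_def)
  then obtain z where z: "dioph_exponent (transpose A) < z" "z < ereal (k / m)" using dense by blast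
  then obtain w where w: "z = ereal w"
    using dioph_exponent_nonneg[of "transpose A"] by (cases z) auto
  have w0: "0 < w" "w < k / m"
    using z dioph_exponent_nonneg[of "transpose A"] by (auto simp: w dest: order_le_less_trans)
  obtain C where C: "0 < C" "\<And>R. 1 \<le> R \<Longrightarrow> real (card (bohr_set A R (R powr (- 0)))) \<le> C * R powr (m * (w - 0))"
    using card_bohr_set_powr_separation[of A w 0] z w0 unfolding w m_def by auto
  have "m * w < k" using w0 m by (simp add: pos_less_divide_eq mult.commute)
  then have "\<forall>\<^sub>F Q::nat in sequentially. (C + 1) * real Q powr (m * w) \<le> real Q powr k"
    by (rule eventually_powr_dominated)
  then have "\<forall>\<^sub>F Q::nat in sequentially. (C + 1) * real Q powr (m * w) \<le> real Q powr k \<and> 1 \<le> Q"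
    using eventually_ge_at_top by (rule eventually_conj)
  then obtain Q :: nat where Q: "(C + 1) * real Q powr (m * w) \<le> real Q powr k" "1 \<le> Q"
    using eventually_happens'[OF sequentially_bot] by blast
  have "bohr_set A (real Q) (real Q powr (- 0)) = {a. infnorm (of_int_vec a) \<le> real Q}"
    using Q int_dist_less_1 by (auto simp: bohr_set_def)
  also have "\<dots> = {a. \<forall>i. a $ i \<in> {- int Q..int Q}}"
    using int_vec_ball_eq_box[of "real Q"] by simp
  finally have "card (bohr_set A (real Q) (real Q powr (- 0))) = card {- int Q..int Q} ^ CARD('k)"
    by (simp only: card_vec_box[OF finite_atLeastAtMost_int])
  moreover have "Q ^ CARD('k) \<le> card {- int Q..int Q} ^ CARD('k)" by (rule power_mono) auto
  ultimately have "Q ^ CARD('k) \<le> card (bohr_set A (real Q) (real Q powr (- 0)))" by simp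
  then have "real Q ^ CARD('k) \<le> real (card (bohr_set A (real Q) (real Q powr (- 0))))"
    by (metis of_nat_le_iff of_nat_power)
  also have "\<dots> \<le> C * real Q powr (m * w)" using C(2)[of "real Q"] Q by simp
  finally have "real Q powr k \<le> C * real Q powr (m * w)"
    using Q by (simp add: k_def powr_realpow)
  moreover have "0 < real Q powr (m * w)" using Q by simp
  ultimately show False using Q(1) unfolding distrib_right by linarith
qed

text \<open>One bound for two cases: \<open>t = \<tau>\<close> for the first, and
  \<open>t = 1 / \<omega>\<close> for the second, where Bohr sets wider than
  \<open>R powr (- \<tau>)\<close> may be counted. At \<open>t = 1 / \<omega>\<close> no
  \<open>w\<close> above \<open>\<omega>\<close> satisfies \<open>t * w \<le> 1\<close>, so the
  hypothesis speaks of all smaller \<open>t'\<close>.\<close>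

lemma hausdorff_dim_approximable_le_exponent:
  fixes A :: "real^'m::finite^('d::finite) option" and \<theta> :: "real^('d + 'm)"
  assumes t: "0 < t" "t \<le> \<tau>"
    and w: "\<And>t'. \<lbrakk>0 \<le> t'; t' < t\<rbrakk> \<Longrightarrow> \<exists>w>0. dioph_exponent A < ereal w \<and> t' * w \<le> 1"
  shows "hausdorff_dim (approximable \<tau> \<theta> \<inter> affine_subspace A)
    \<le> ereal ((real CARD('d) + 1 - real CARD('m) * t) / (1 + \<tau>))"
proof (rule hausdorff_dim_approximable_le)
  show "0 \<le> \<tau>" using t by simp
  fix e' assume e': "real CARD('d) + 1 - real CARD('m) * t < e'"
  define m where "m = real CARD('m)"
  have m: "0 < m" by (simp add: m_def)
  \<comment> \<open>Lowering \<open>t\<close> by this quotient raises the exponent exactly to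
    \<open>e'\<close>; the maximum keeps \<open>t'\<close> nonnegative.\<close>
  define t' where "t' = max 0 (t - (e' - (real CARD('d) + 1 - m * t)) / m)"
  have t': "0 \<le> t'" "t' < t" using e' t m by (auto simp: t'_def m_def)
  obtain w where w': "0 < w" "dioph_exponent A < ereal w" "t' * w \<le> 1" using w[OF t'] by blast
  obtain C where C: "0 < C" "\<And>R. 1 \<le> R \<Longrightarrow> real (card (bohr_set A R (R powr (- t')))) \<le> C * R powr (real CARD('d) + 1 - m * t')"
    using card_bohr_set_powr_exponent[OF w'(2,1) t'(1) w'(3)] unfolding m_def by blast
  have "m * (t - (e' - (real CARD('d) + 1 - m * t)) / m) \<le> m * t'" using m by (intro mult_left_mono) (auto simp: t'_def)
  moreover have "m * (t - y / m) = m * t - y" for y using m by (simp add: right_diff_distrib)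
  ultimately have le: "real CARD('d) + 1 - m * t' \<le> e'" by simp
  show "\<exists>\<tau>' C. \<tau>' < \<tau> \<and> 0 < C \<and> (\<forall>R\<ge>1. real (card (bohr_set A R (R powr (- \<tau>')))) \<le> C * R powr e')"
  proof (rule exI[of _ t'], rule exI[of _ C], intro conjI allI impI)
    fix R :: real assume R: "1 \<le> R"
    have "C * R powr (real CARD('d) + 1 - m * t') \<le> C * R powr e'"
      using C le R by (intro mult_left_mono powr_mono) auto
    then show "real (card (bohr_set A R (R powr (- t')))) \<le> C * R powr e'" using C(2)[OF R] by linarith
  qed (use t t' C in auto)
qed

text \<open>Serves \<open>\<omega> = \<infinity>\<close>, where duality gives nothing and the whole
  box is counted.\<close>

lemma hausdorff_dim_approximable_le_trivial:
  fixes A :: "real^'m::finite^('d::finite) option" and \<theta> :: "real^('d + 'm)"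
  assumes \<tau>: "0 \<le> \<tau>"
  shows "hausdorff_dim (approximable \<tau> \<theta> \<inter> affine_subspace A) \<le> ereal ((real CARD('d) + 1) / (1 + \<tau>))"
proof (rule hausdorff_dim_approximable_le[OF \<tau>])
  fix e' assume e': "real CARD('d) + 1 < e'"
  show "\<exists>\<tau>' C. \<tau>' < \<tau> \<and> 0 < C \<and> (\<forall>R\<ge>1. real (card (bohr_set A R (R powr (- \<tau>')))) \<le> C * R powr e')"
  proof (rule exI[of _ "\<tau> - 1"], rule exI[of _ "3 ^ CARD('d option)"], intro conjI allI impI)
    fix R :: real assume R: "1 \<le> R"
    have "real (card (bohr_set A R (R powr (- (\<tau> - 1))))) \<le> 3 ^ CARD('d option) * R powr real CARD('d option)"
      using card_bohr_set_trivial[OF R, of A] R by (simp only: power_mult_distrib powr_realpow)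
    also have "\<dots> \<le> 3 ^ CARD('d option) * R powr e'"
      using e' R by (intro mult_left_mono powr_mono) auto
    finally show "real (card (bohr_set A R (R powr (- (\<tau> - 1))))) \<le> 3 ^ CARD('d option) * R powr e'" .
  qed auto
qed

text \<open>\<open>z\<close> may be any upper bound for the exponent: \<open>z = \<sigma>\<close>
  gives the third case and \<open>z = \<tau>\<close> the fourth.\<close>

lemma hausdorff_dim_approximable_le_separation:
  fixes A :: "real^'m::finite^('d::finite) option" and \<theta> :: "real^('d + 'm)"
  assumes \<sigma>: "dioph_exponent (transpose A) \<le> ereal z" "0 \<le> z" and \<tau>: "0 \<le> \<tau>" "\<tau> \<le> z"
  shows "hausdorff_dim (approximable \<tau> \<theta> \<inter> affine_subspace A) \<le> ereal (real CARD('m) * (z - \<tau>) / (1 + \<tau>))"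
proof (rule hausdorff_dim_approximable_le[OF \<tau>(1)])
  define m where "m = real CARD('m)"
  have m: "0 < m" by (simp add: m_def)
  fix e' assume e': "real CARD('m) * (z - \<tau>) < e'"
  \<comment> \<open>Raising \<open>z\<close> and lowering \<open>\<tau>\<close> by
    \<open>\<epsilon>\<close> adds \<open>2 * m * \<epsilon>\<close> to the exponent.\<close>
  define \<epsilon> where "\<epsilon> = (e' - m * (z - \<tau>)) / (2 * m)"
  have \<epsilon>: "0 < \<epsilon>" using e' m by (simp add: \<epsilon>_def m_def)
  have "dioph_exponent (transpose A) < ereal (z + \<epsilon>)" using \<sigma> \<epsilon> by (simp add: order_le_less_trans)
  then obtain C where C: "0 < C" "\<And>R. 1 \<le> R \<Longrightarrow>
      real (card (bohr_set A R (R powr (- (\<tau> - \<epsilon>))))) \<le> C * R powr (m * ((z + \<epsilon>) - (\<tau> - \<epsilon>)))"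
    using card_bohr_set_powr_separation[of A "z + \<epsilon>" "\<tau> - \<epsilon>"] \<sigma> \<epsilon> \<tau> unfolding m_def by auto
  have "m * ((z + \<epsilon>) - (\<tau> - \<epsilon>)) = e'" using m by (simp add: \<epsilon>_def field_simps)
  then show "\<exists>\<tau>' C. \<tau>' < \<tau> \<and> 0 < C \<and> (\<forall>R\<ge>1. real (card (bohr_set A R (R powr (- \<tau>')))) \<le> C * R powr e')"
    using C \<epsilon> by - (rule exI[of _ "\<tau> - \<epsilon>"], rule exI[of _ C], auto)
qed

text \<open>\<open>t' < t \<le> 1 / \<omega>\<close> leaves room for \<open>w\<close> above
  \<open>\<omega>\<close> and at most \<open>1 / t'\<close>. In \<open>ereal\<close>,
  \<open>1 / 0\<close> is infinite and \<open>1 / \<infinity>\<close> is 0, so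
  \<open>\<omega> = \<infinity>\<close> contradicts \<open>0 \<le> t' < t\<close>.\<close>

lemma ex_exponent_bound:
  fixes \<omega> :: ereal
  assumes "0 \<le> \<omega>" "ereal t \<le> 1 / \<omega>" "0 \<le> t'" "t' < t"
  shows "\<exists>w>0. \<omega> < ereal w \<and> t' * w \<le> 1"
proof (cases \<omega>)
  case (real z)
  show ?thesis
  proof (cases "t' = 0")
    case True
    then show ?thesis using real assms by (intro exI[of _ "z + 1"]) auto
  next
    case False
    then have t': "0 < t'" using assms by simp
    have "z < 1 / t'"
    proof (cases "z = 0")
      case False
      then have z: "0 < z" using assms real by simp
      then have "t \<le> 1 / z" using assms(2) real by (simp add: one_ereal_def)
      then have "t' < 1 / z" using assms by simp
      then show ?thesis using z t' by (simp add: pos_less_divide_eq mult.commute)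
    qed (use t' in simp)
    then show ?thesis using t' real by (intro exI[of _ "1 / t'"]) auto
  qed
qed (use assms in auto)

theorem theorem2p9:
  fixes A :: "real ^ 'm ^ ('d::finite) option"
    and d m n :: real
    and \<omega> \<sigma> :: ereal
  assumes "d = real CARD('d)" and "m = real CARD('m)" and "n = d + m"
    and "dioph_exponent A = \<omega>"
    and "dioph_exponent (transpose A) = \<sigma>"
  shows "(\<forall>(\<theta> :: real ^ ('d + 'm)) (\<tau> :: real).
      (ereal (1 / n) \<le> ereal \<tau> \<and> ereal \<tau> \<le> 1 / \<omega> \<longrightarrow>
         hausdorff_dim (approximable \<tau> \<theta> \<inter> affine_subspace A)
           \<le> ereal ((n + 1) / (\<tau> + 1) - m)) \<and>
      (1 / \<omega> \<le> ereal \<tau> \<and> ereal \<tau> \<le> 1 / \<omega> + \<sigma> - ereal ((d + 1) / m) \<longrightarrow>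
         hausdorff_dim (approximable \<tau> \<theta> \<inter> affine_subspace A)
           \<le> middle_bound d m \<omega> \<tau>) \<and>
      (1 / \<omega> + \<sigma> - ereal ((d + 1) / m) \<le> ereal \<tau> \<and> ereal \<tau> \<le> \<sigma> \<longrightarrow>
         hausdorff_dim (approximable \<tau> \<theta> \<inter> affine_subspace A)
           \<le> ereal m * (\<sigma> - ereal \<tau>) / ereal (\<tau> + 1)) \<and>
      (\<sigma> \<le> ereal \<tau> \<longrightarrow>
         hausdorff_dim (approximable \<tau> \<theta> \<inter> affine_subspace A) \<le> 0)) \<and>
    (\<forall>\<tau> :: real. ereal (1 / n) \<le> ereal \<tau> \<and> ereal \<tau> < 1 / max (ereal m) \<omega> \<longrightarrow>
       hausdorff_dim (approximable \<tau> (0 :: real ^ ('d + 'm)) \<inter> affine_subspace A)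
         = ereal ((n + 1) / (\<tau> + 1) - m))"
proof -
  have d1: "1 \<le> d" and m1: "1 \<le> m" using assms(1,2) by (simp_all add: Suc_le_eq)
  have n0: "0 < n" using d1 m1 assms(3) by simp
  have \<omega>0: "0 \<le> \<omega>" using dioph_exponent_nonneg[of A] assms(4) by simp
  have \<sigma>0: "ereal ((d + 1) / m) \<le> \<sigma>"
    using dioph_exponent_transpose_ge[of A] assms(1,2,5) by (simp add: add.commute)
  have inv\<omega>: "0 \<le> 1 / \<omega>" using \<omega>0 by simp
  have eq: "(n + 1) / (\<tau> + 1) - m = (real CARD('d) + 1 - real CARD('m) * \<tau>) / (1 + \<tau>)" if "0 < \<tau>" for \<tau>
    using that assms(1-3) by (simp add: field_simps)
  have case1: "hausdorff_dim (approximable \<tau> \<theta> \<inter> affine_subspace A) \<le> ereal ((n + 1) / (\<tau> + 1) - m)"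
    if "0 < \<tau>" "ereal \<tau> \<le> 1 / \<omega>" for \<tau> and \<theta> :: "real^('d + 'm)"
    unfolding eq[OF that(1)]
    by (rule hausdorff_dim_approximable_le_exponent)
       (use that assms(4) ex_exponent_bound[OF \<omega>0 that(2)] in auto)
  have case2: "hausdorff_dim (approximable \<tau> \<theta> \<inter> affine_subspace A) \<le> middle_bound d m \<omega> \<tau>"
    if le: "1 / \<omega> \<le> ereal \<tau>" for \<tau> and \<theta> :: "real^('d + 'm)"
  proof -
    have \<tau>: "0 \<le> \<tau>" using order_trans[OF inv\<omega> le] by simp
    show ?thesis
    proof (cases \<omega>)
      case PInf
      then show ?thesis
        using hausdorff_dim_approximable_le_trivial[OF \<tau>, of \<theta> A] assms(1) by (simp add: middle_bound_def add.commute)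
    next
      case (real z)
      \<comment> \<open>If \<open>\<omega>\<close> were 0, then
        \<open>1 / \<omega> = \<infinity>\<close> could not be at most the real number
        \<open>\<tau>\<close>.\<close>
      have z: "0 < z"
      proof (rule ccontr)
        assume "\<not> 0 < z"
        then have "1 / \<omega> = \<infinity>" using real \<omega>0 by (simp add: divide_ereal_def)
        then show False using le by (simp add: divide_ereal_def)
      qed
      have t: "0 < 1 / z" "1 / z \<le> \<tau>" "ereal (1 / z) \<le> 1 / \<omega>"
        using le z real by (simp_all add: one_ereal_def)
      have "hausdorff_dim (approximable \<tau> \<theta> \<inter> affine_subspace A)
          \<le> ereal ((real CARD('d) + 1 - real CARD('m) * (1 / z)) / (1 + \<tau>))"
        using ex_exponent_bound[OF \<omega>0 t(3)] assms(4) by (intro hausdorff_dim_approximable_le_exponent t) auto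
      also have "(real CARD('d) + 1 - real CARD('m) * (1 / z)) / (1 + \<tau>) = ((d + 1) * z - m) / ((\<tau> + 1) * z)"
        using z \<tau> assms(1,2) by (simp add: field_simps)
      also have "ereal \<dots> = middle_bound d m \<omega> \<tau>"
        using z \<tau> real by (simp add: middle_bound_def)
      finally show ?thesis .
    qed (use \<omega>0 in simp)
  qed
  have case3: "hausdorff_dim (approximable \<tau> \<theta> \<inter> affine_subspace A) \<le> ereal m * (\<sigma> - ereal \<tau>) / ereal (\<tau> + 1)"
    if le: "1 / \<omega> + \<sigma> - ereal ((d + 1) / m) \<le> ereal \<tau>" "ereal \<tau> \<le> \<sigma>" for \<tau> and \<theta> :: "real^('d + 'm)"
  proof -
    \<comment> \<open>An infinite \<open>\<sigma>\<close> would make the left side of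
      \<open>le(1)\<close> infinite.\<close>
    obtain z where z: "\<sigma> = ereal z"
      using le(1) \<sigma>0 inv\<omega> by (cases \<sigma>; cases "1 / \<omega>") auto
    have \<tau>: "0 \<le> \<tau>" using le(1) \<sigma>0 inv\<omega> by (cases "1 / \<omega>") (auto simp: z)
    have "hausdorff_dim (approximable \<tau> \<theta> \<inter> affine_subspace A) \<le> ereal (real CARD('m) * (z - \<tau>) / (1 + \<tau>))"
      using assms(5) le(2) \<tau> by (intro hausdorff_dim_approximable_le_separation) (auto simp: z)
    then show ?thesis using \<tau> assms(2) by (simp add: z add.commute)
  qed
  have case4: "hausdorff_dim (approximable \<tau> \<theta> \<inter> affine_subspace A) \<le> 0"
    if le: "\<sigma> \<le> ereal \<tau>" for \<tau> and \<theta> :: "real^('d + 'm)"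
  proof -
    have "0 < (d + 1) / m" using d1 m1 by simp
    moreover have "(d + 1) / m \<le> \<tau>" using order_trans[OF \<sigma>0 le] by simp
    ultimately have "0 \<le> \<tau>" by linarith
    then show ?thesis
      using hausdorff_dim_approximable_le_separation[of A \<tau> \<tau> \<theta>] assms(5) le by (simp add: zero_ereal_def)
  qed
  have exact: "hausdorff_dim (approximable \<tau> (0 :: real ^ ('d + 'm)) \<inter> affine_subspace A) = ereal ((n + 1) / (\<tau> + 1) - m)"
    if le: "ereal (1 / n) \<le> ereal \<tau>" "ereal \<tau> < 1 / max (ereal m) \<omega>" for \<tau>
  proof -
    have \<tau>n: "1 / n \<le> \<tau>" using le(1) by simp
    moreover have "0 < 1 / n" using n0 by simp
    ultimately have \<tau>: "0 < \<tau>" by linarith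
    \<comment> \<open>\<open>\<omega> = \<infinity>\<close> would force \<open>\<tau> < 0\<close>,
      as \<open>1 / \<infinity> = 0\<close>.\<close>
    obtain z where z: "max (ereal m) \<omega> = ereal z" "1 \<le> z"
      using le(2) \<tau> m1 \<omega>0 by (cases \<omega>) (auto simp: max_def split: if_splits)
    have "\<tau> < 1 / z" using le(2) z by (simp add: one_ereal_def)
    then have "z < 1 / \<tau>" using \<tau> z by (simp add: field_simps)
    \<comment> \<open>A single \<open>w\<close> strictly between the maximum of \<open>m\<close> and
      \<open>\<omega>\<close> and \<open>1 / \<tau>\<close> serves both inequalities.\<close>
    then obtain w where w: "z < w" "w < 1 / \<tau>" using dense by blast
    have "ereal m \<le> ereal z" "\<omega> \<le> ereal z" unfolding z(1)[symmetric] by auto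
    then have mw: "m < w" "\<omega> < ereal w" using w by (auto simp: order_le_less_trans)
    have \<tau>w: "\<tau> * w < 1" using w \<tau> by (simp add: pos_less_divide_eq mult.commute)
    show ?thesis
    proof (rule antisym)
      show "hausdorff_dim (approximable \<tau> (0 :: real ^ ('d + 'm)) \<inter> affine_subspace A) \<le> ereal ((n + 1) / (\<tau> + 1) - m)"
        unfolding eq[OF \<tau>]
      proof (rule hausdorff_dim_approximable_le_exponent[OF \<tau> order_refl])
        fix t' assume t': "0 \<le> t'" "t' < \<tau>"
        have "t' * w \<le> \<tau> * w" using t' mw m1 by (intro mult_right_mono) auto
        then have "t' * w \<le> 1" using \<tau>w by linarith
        then show "\<exists>w>0. dioph_exponent A < ereal w \<and> t' * w \<le> 1"
          using mw m1 assms(4) by (intro exI[of _ w]) auto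
      qed
      show "ereal ((n + 1) / (\<tau> + 1) - m) \<le> hausdorff_dim (approximable \<tau> (0 :: real ^ ('d + 'm)) \<inter> affine_subspace A)"
        unfolding eq[OF \<tau>]
      proof (rule hausdorff_dim_approximable_ge)
        have "1 \<le> n * \<tau>" using \<tau>n n0 by (simp add: pos_divide_le_eq mult.commute)
        then show "1 \<le> (real CARD('d) + real CARD('m)) * \<tau>" using assms(1-3) by simp
      qed (use mw \<tau> \<tau>w assms in auto)
    qed
  qed
  have "0 < \<tau>" if "ereal (1 / n) \<le> ereal \<tau>" for \<tau>
  proof -
    have "0 < 1 / n" using n0 by simp
    then show ?thesis using that by (simp only: ereal_less_eq)
  qed
  then show ?thesis using case1 case2 case3 case4 exact by blast
qed

end
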